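(* Let $\mathscr{V}$ be a topological category over $\mathsf{Set}$, with topological functor $|-| : \mathscr{V} \to \mathsf{Set}$, equipped with the cartesian symmetric monoidal structure $(\otimes, I) = (\times, 1)$, and suppose that $\mathscr{V}$ is cartesian closed. Let $\mathcal{S}$ be a set, let $\mathcal{T} = (\Sigma, \mathcal{E})$ be a $\mathscr{V}$-enriched $\mathcal{S}$-sorted equational theory, let $X$ be an object of $\mathscr{V}^{\mathcal{S}}$, and let $\sim^{\mathcal{E}}$ be the $\Sigma$-congruence on the free $\Sigma$-algebra $F^\Sigma X$ generated by $\mathcal{E}$. Then the carrier object $U^{\mathcal{T}} F^{\mathcal{T}} X$ of the free $\mathcal{T}$-algebra $F^{\mathcal{T}} X$ on $X$ is $$U^{\mathcal{T}} F^{\mathcal{T}} X = \left(\bigvee_n \Omega^n(X)\right)\Big/{\sim^{\mathcal{E}}} = \left(\left(\bigvee_n \Omega^n(X)_S\right)\Big/{\sim^{\mathcal{E}}_S}\right)_{S \in \mathcal{S}},$$ where the objects $\Omega^n(X)$ of $\mathscr{V}^{\mathcal{S}}$ ($n \geq 0$) in the fibre over the $\mathcal{S}$-sorted set $\mathsf{Term}_{|\Sigma|}(|X|)$ are defined as follows: 1. $\Omega^0(X)$ is the final $\mathscr{V}^{\mathcal{S}}$-structure on $\mathsf{Term}_{|\Sigma|}(|X|)$ induced by the $\mathcal{S}$-sorted inclusion function $\eta : |X| \to \mathsf{Term}_{|\Sigma|}(|X|)$. 2. Given $\Omega^n(X) \in \mathsf{Fib}(\mathsf{Term}_{|\Sigma|}(|X|))$,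 for each sort $S \in \mathcal{S}$ let $\Omega^n(X, S) \in \mathsf{Fib}(\mathsf{Term}_{|\Sigma|}(|X|)_S)$ be the final $\mathscr{V}$-structure on the set $\mathsf{Term}_{|\Sigma|}(|X|)_S$ induced by the functions $$\widehat{\sigma} : \left|P \times \Omega^n(X)_{S_1} \times \cdots \times \Omega^n(X)_{S_m}\right| \to \mathsf{Term}_{|\Sigma|}(|X|)_S, \qquad (p, t_1, \ldots, t_m) \mapsto \sigma_p(t_1, \ldots, t_m),$$ for all $\sigma \in \Sigma$ of type $((S_1, \ldots, S_m), S, P)$ (with output sort $S$). Then $$\Omega^{n+1}(X) := \Omega^n(X) \vee \left(\Omega^n(X, S)\right)_{S \in \mathcal{S}}$$ in the fibre over $\mathsf{Term}_{|\Sigma|}(|X|)$.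
   Context: Topological categories. A concrete category over a category $\mathscr{X}$ is a category $\mathscr{V}$ with a faithful functor $|-| : \mathscr{V} \to \mathscr{X}$; an $\mathscr{X}$-morphism $f : |V| \to |W|$ is admissible if it lifts (uniquely) to a morphism $V \to W$. The fibre $\mathsf{Fib}(Y)$ is the preordered class of objects $V$ with $|V| = Y$, where $V \leq V'$ iff $1_Y$ is an admissible morphism $V \to V'$; $\mathscr{V}$ is amnestic if all fibres are partially ordered. A (possibly large) source $(f_i : V \to V_i)_{i}$ is initial if for all $W$ and $f : |W| \to |V|$, $f$ is admissible iff all $f_i \circ f$ are; final sinks are defined dually. $\mathscr{V}$ is topological over $\mathscr{X}$ if it is amnestic and every (possibly large) structured source $(f_i : Y \to |V_i|)_i$ has an initial lift: an object $V$ with $|V| = Y$, each $f_i$ admissible, and $(f_i : V \to V_i)_i$ initial. Then dually every structured sink $(g_i : |V_i| \to Y)_i$ has a final lift $(g_i : V_i \to V)_i$, and $V$ is called the final structure on $Y$ induced by the $g_i$; every fibre is a (possibly large) complete lattice. When $\mathscr{X} = \mathsf{Set}$, the indiscrete object $\mathsf{Indisc}\, Y$ on a set $Y$ is the greatest element of $\mathsf{Fib}(Y)$. One has $|X \times Y| = |X| \times |Y|$. The category $\mathscr{V}^{\mathcal{S}}$ is topological over $\mathsf{Set}^{\mathcal{S}}$ via $|(V_S)_{S}| = (|V_S|)_{S}$; final structures and fibres are computed componentwise. Signatures (with $\otimes = \times$). $\mathcal{S}^*$ is the set of finite sequences of elements of $\mathcal{S}$. A $\mathscr{V}$-enriched $\mathcal{S}$-sorted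 signature is a set $\Sigma$ of operation symbols, each equipped with a type $((S_1, \ldots, S_n), S, P)$: input sorts $(S_1,\ldots,S_n) \in \mathcal{S}^*$, output sort $S \in \mathcal{S}$, parameter object $P \in \mathrm{ob}\,\mathscr{V}$. A $\Sigma$-algebra is an object $A = (A_S)_{S}$ of $\mathscr{V}^{\mathcal{S}}$ with, for each such $\sigma \in \Sigma$, a $\mathscr{V}$-morphism $\sigma^A : P \times (A_{S_1} \times \cdots \times A_{S_n}) \to A_S$. A morphism $f : A \to B$ of $\Sigma$-algebras is a morphism of $\mathscr{V}^{\mathcal{S}}$ with $f_S \circ \sigma^A = \sigma^B \circ (1_P \times (f_{S_1} \times \cdots \times f_{S_n}))$ for all $\sigma$. These form $\Sigma\text{-}\mathsf{Alg}$, with forgetful functor $U^\Sigma$ to $\mathscr{V}^{\mathcal{S}}$. A classical $\mathcal{S}$-sorted signature is the case $\mathscr{V} = \mathsf{Set}$ with all parameters equal to the one-point set. $|\Sigma|$ is the classical signature with an operation symbol $\sigma_p$ with input sorts $(S_1,\ldots,S_n)$ and output sort $S$ for each $\sigma \in \Sigma$ of type $((S_1,\ldots,S_n),S,P)$ and each $p \in |P|$. Each $\Sigma$-algebra $A$ has an underlying $|\Sigma|$-algebra $|A|$ with carrier $(|A_S|)_S$ and $\sigma_p^{|A|} = \sigma^A(p, -)$. For an $\mathcal{S}$-sorted set $Y$, $\mathsf{Term}_{|\Sigma|}(Y)$ is the $\mathcal{S}$-sorted set of ground terms with constants from $Y$: $Y_S \subseteq \mathsf{Term}_{|\Sigma|}(Y)_S$,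 and for $\tau \in |\Sigma|$ with input sorts $(S_1, \ldots, S_n)$, output sort $S$, and $t_i \in \mathsf{Term}_{|\Sigma|}(Y)_{S_i}$, one has $\tau(t_1, \ldots, t_n) \in \mathsf{Term}_{|\Sigma|}(Y)_S$. It carries the free $|\Sigma|$-algebra $F^{|\Sigma|} Y$. $F^\Sigma$ denotes the left adjoint of $U^\Sigma$ (which exists), chosen so that the underlying $|\Sigma|$-algebra of $F^\Sigma X$ is $F^{|\Sigma|}|X|$ and the unit has underlying function the inclusion $|X| \hookrightarrow \mathsf{Term}_{|\Sigma|}(|X|)$. Enriched theories. For $P \in \mathrm{ob}\,\mathscr{V}$ and $\overline{S} = (S_1, \ldots, S_n) \in \mathcal{S}^*$, let $P \times U^{\overline{S}} : \Sigma\text{-}\mathsf{Alg} \to \mathscr{V}$ be $A \mapsto P \times (A_{S_1} \times \cdots \times A_{S_n})$, and $U^S$ be $A \mapsto A_S$. An algebraic $\Sigma$-operation of type $(\overline{S}, S, P)$ is a natural transformation $\omega : P \times U^{\overline{S}} \Rightarrow U^S$. An algebraic $\Sigma$-equation $\omega \doteq \nu$ is a pair of algebraic $\Sigma$-operations of the same type; $A$ satisfies it if $\omega_A = \nu_A$. A $\mathscr{V}$-enriched $\mathcal{S}$-sorted equational theory is a pair $\mathcal{T} = (\Sigma, \mathcal{E})$ with $\mathcal{E}$ a set of algebraic $\Sigma$-equations; $\mathcal{T}\text{-}\mathsf{Alg} \subseteq \Sigma\text{-}\mathsf{Alg}$ is the full subcategory of $\mathcal{T}$-algebras, i.e. $\Sigma$-algebras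 satisfying all equations in $\mathcal{E}$, and $U^{\mathcal{T}} : \mathcal{T}\text{-}\mathsf{Alg} \to \mathscr{V}^{\mathcal{S}}$ is the restriction of $U^\Sigma$. Classical syntax. With fixed pairwise disjoint countably infinite sets of variables for each sort, a context $\overline{v}$ is a finite list $v_1 : S_1, \ldots, v_n : S_n$ of pairwise distinct sorted variables. $|\Sigma|$-terms in context: each $[\overline{v} \vdash v_i : S_i]$, and $[\overline{v} \vdash \tau(t_1, \ldots, t_m) : T]$ for $\tau \in |\Sigma|$ with input sorts $T_1, \ldots, T_m$, output sort $T$, and terms $[\overline{v} \vdash t_j : T_j]$. In a $|\Sigma|$-algebra $D$ a term $[\overline{v} \vdash t : S]$ is interpreted as a function $t^D : D_{S_1} \times \cdots \times D_{S_n} \to D_S$ in the usual recursive way. A syntactic equation is a pair $[\overline{v} \vdash s \doteq t : S]$ of terms of the same sort in the same context. Underlying classical equations $|\mathcal{E}|$. For a $|\Sigma|$-algebra $D$, let $D^{\mathsf{Indisc}}$ be the $\Sigma$-algebra with carrier $(\mathsf{Indisc}\, D_S)_S$ and operations with underlying functions $(p, d_1, \ldots, d_n) \mapsto \sigma_p^D(d_1, \ldots, d_n)$. For an algebraic $\Sigma$-operation $\omega$ of type $((S_1, \ldots, S_n), S, P)$, $p \in |P|$, and a context $\overline{v} \equiv v_1 : S_1, \ldots, v_n : S_n$ of distinct variables, let $D$ be the $|\Sigma|$-algebra of $|\Sigma|$-terms in context $\overline{v}$ and let $t_{\omega, p} := \omega_{D^{\mathsf{Indisc}}}(p, v_1,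 \ldots, v_n) \in D_S$. Then $|\mathcal{E}|$ consists of the syntactic $|\Sigma|$-equations $[\overline{v} \vdash t_{\omega, p} \doteq t_{\nu, p} : S]$ for all $(\omega \doteq \nu) \in \mathcal{E}$ with parameter $P$ and all $p \in |P|$. Congruences and quotients. A $\Sigma$-congruence on a $\Sigma$-algebra $A$ is a family $(\sim_S)_S$ of equivalence relations on the sets $|A_S|$ such that for all $\sigma \in \Sigma$ of type $((S_1, \ldots, S_n), S, P)$, $p \in |P|$, and $a_i \sim_{S_i} b_i$, one has $\sigma^A(p, a_1, \ldots, a_n) \sim_S \sigma^A(p, b_1, \ldots, b_n)$. The $\Sigma$-congruence $\sim^{\mathcal{E}}$ on $A$ generated by $\mathcal{E}$ is the smallest $\Sigma$-congruence with $s^{|A|}(a_1, \ldots, a_n) \sim_S t^{|A|}(a_1, \ldots, a_n)$ for all $[\overline{v} \vdash s \doteq t : S]$ in $|\mathcal{E}|$ and all $a_i \in |A_{S_i}|$. For an object $B$ of $\mathscr{V}^{\mathcal{S}}$ and a family $\sim = (\sim_S)_S$ of equivalence relations on the sets $|B_S|$, $B/{\sim} = (B_S/{\sim_S})_S$ where $B_S/{\sim_S}$ is the set $|B_S|/{\sim_S}$ with the final structure induced by the surjection $|B_S| \to |B_S|/{\sim_S}$. $F^{\mathcal{T}}$ denotes the left adjoint of $U^{\mathcal{T}}$, chosen so that the underlying $|\Sigma|$-algebra of $F^{\mathcal{T}} X$ is the quotient algebra $F^{|\Sigma|}|X|/{\sim^{\mathcal{E}}}$, with unit having underlying function $x \mapsto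 [x]$. *)

theory Defs
  imports Main "HOL-Library.FuncSet"
begin

unbundle cardinal_syntax

section \<open>The universe of sets\<close>

text \<open>
  \<open>Set\<close> is the category of small subsets of a type \<open>'u\<close>, small meaning of cardinality less than
  that of \<open>'u\<close>, where the cardinality of \<open>'u\<close> is (strongly) inaccessible, so that \<open>'u\<close> plays the
  role of a Grothendieck universe.  Arbitrary HOL sets and types serve as (possibly large) classes.
\<close>

definition inaccessible_universe :: "'u itself \<Rightarrow> bool" where
  "inaccessible_universe (_ :: 'u itself) \<longleftrightarrow>
     natLeq <o |UNIV :: 'u set| \<and>
     regularCard |UNIV :: 'u set| \<and>
     (\<forall>A :: 'u set. |A| <o |UNIV :: 'u set| \<longrightarrow> |Pow A| <o |UNIV :: 'u set| )"

definition small :: "'u set \<Rightarrow> bool" where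
  "small A \<longleftrightarrow> |A| <o |UNIV :: 'u set|"

text \<open>
  Tuples of elements of \<open>'u\<close> are coded as elements of \<open>'u\<close> by a fixed injection; lemma \<open>inj_tup\<close>
  shows that one exists.
\<close>

definition tup :: "'u list \<Rightarrow> 'u" where
  "tup = (SOME f. inj f)"

definition untup :: "'u \<Rightarrow> 'u list" where
  "untup = inv tup"

definition proj :: "nat \<Rightarrow> 'u \<Rightarrow> 'u" where
  "proj i x = untup x ! i"

lemma inj_tup:
  assumes "infinite (UNIV :: 'u set)"
  shows "inj (tup :: 'u list \<Rightarrow> 'u)"
proof -
  have "|UNIV \<times> UNIV :: ('u \<times> 'u) set| =o |UNIV :: 'u set|"
    using assms by (rule card_of_Times_same_infinite)
  then obtain b :: "'u \<times> 'u \<Rightarrow> 'u" where "bij_betw b (UNIV \<times> UNIV) UNIV"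
    using card_of_ordIso by blast
  then have b: "inj b"
    by (simp add: bij_betw_def)
  obtain num :: "nat \<Rightarrow> 'u" where num: "inj num"
    using assms infinite_countable_subset by blast
  define g where "g xs = foldr (\<lambda>x y. b (x, y)) xs undefined" for xs
  have b': "b (x, y) = b (x', y') \<longleftrightarrow> x = x' \<and> y = y'" for x y x' y'
    using inj_eq[OF b, of "(x, y)" "(x', y')"] by simp
  have g: "g xs = g ys \<Longrightarrow> xs = ys" if "length xs = length ys" for xs ys
    using that by (induction xs ys rule: list_induct2) (simp_all add: g_def b')
  have "inj (\<lambda>xs. b (num (length xs), g xs))"
    by (rule injI) (use g in \<open>simp add: b' inj_eq[OF num]\<close>)
  then show ?thesis
    unfolding tup_def by (rule someI[of inj])
qed

text \<open>An equivalence class is coded by one of its elements, a quotient set by the set of these codes.\<close>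

definition class_of :: "('u \<times> 'u) set \<Rightarrow> 'u \<Rightarrow> 'u" where
  "class_of r x = (SOME y. y \<in> r `` {x})"

definition quotient_set :: "'u set \<Rightarrow> ('u \<times> 'u) set \<Rightarrow> 'u set" where
  "quotient_set A r = (\<lambda>C. SOME y. y \<in> C) ` (A // r)"


section \<open>Topological categories over \<open>Set\<close>\<close>

record ('o, 'm, 'u) conc_cat =
  objs :: "'o set"
  arrs :: "'m set"
  src :: "'m \<Rightarrow> 'o"
  tgt :: "'m \<Rightarrow> 'o"
  ident :: "'o \<Rightarrow> 'm"
  comp :: "'m \<Rightarrow> 'm \<Rightarrow> 'm"
  und :: "'o \<Rightarrow> 'u set"
  undm :: "'m \<Rightarrow> 'u \<Rightarrow> 'u"

definition hom :: "('o, 'm, 'u) conc_cat \<Rightarrow> 'o \<Rightarrow> 'o \<Rightarrow> 'm set" where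
  "hom V A B = {f \<in> arrs V. src V f = A \<and> tgt V f = B}"

locale concrete_category =
  fixes V :: "('o, 'm, 'u) conc_cat"
  assumes src_obj: "f \<in> arrs V \<Longrightarrow> src V f \<in> objs V"
    and tgt_obj: "f \<in> arrs V \<Longrightarrow> tgt V f \<in> objs V"
    and ident_hom: "A \<in> objs V \<Longrightarrow> ident V A \<in> hom V A A"
    and comp_hom: "f \<in> hom V A B \<Longrightarrow> g \<in> hom V B C \<Longrightarrow> comp V g f \<in> hom V A C"
    and comp_ident: "f \<in> hom V A B \<Longrightarrow> comp V f (ident V A) = f"
    and ident_comp: "f \<in> hom V A B \<Longrightarrow> comp V (ident V B) f = f"
    and comp_assoc: "f \<in> hom V A B \<Longrightarrow> g \<in> hom V B C \<Longrightarrow> h \<in> hom V C D \<Longrightarrow>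
          comp V h (comp V g f) = comp V (comp V h g) f"
    and und_small: "A \<in> objs V \<Longrightarrow> small (und V A)"
    and undm_fun: "f \<in> hom V A B \<Longrightarrow> undm V f \<in> und V A \<rightarrow>\<^sub>E und V B"
    and undm_ident: "A \<in> objs V \<Longrightarrow> undm V (ident V A) = (\<lambda>x\<in>und V A. x)"
    and undm_comp: "f \<in> hom V A B \<Longrightarrow> g \<in> hom V B C \<Longrightarrow>
          undm V (comp V g f) = compose (und V A) (undm V g) (undm V f)"
    and faithful: "A \<in> objs V \<Longrightarrow> B \<in> objs V \<Longrightarrow> inj_on (undm V) (hom V A B)"

text \<open>
  Only the values of \<open>f\<close> on \<open>und V A\<close> matter.  By faithfulness, the morphisms \<open>A \<rightarrow> B\<close> correspond
  to the admissible functions, and morphisms are given by admissible functions below.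
\<close>

definition admissible :: "('o, 'm, 'u) conc_cat \<Rightarrow> 'o \<Rightarrow> 'o \<Rightarrow> ('u \<Rightarrow> 'u) \<Rightarrow> bool" where
  "admissible V A B f \<longleftrightarrow>
     f \<in> und V A \<rightarrow> und V B \<and> (\<exists>m \<in> hom V A B. undm V m = restrict f (und V A))"

definition Fib :: "('o, 'm, 'u) conc_cat \<Rightarrow> 'u set \<Rightarrow> 'o set" where
  "Fib V Y = {A \<in> objs V. und V A = Y}"

definition fib_le :: "('o, 'm, 'u) conc_cat \<Rightarrow> 'o \<Rightarrow> 'o \<Rightarrow> bool" where
  "fib_le V A B \<longleftrightarrow> admissible V A B (\<lambda>x. x)"

text \<open>
  Initiality of a source depends only on the class of its members, so sources and sinks are given
  by sets of pairs of an object and a function instead of indexed families.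
\<close>

definition initial_source ::
  "('o, 'm, 'u) conc_cat \<Rightarrow> 'o \<Rightarrow> ('o \<times> ('u \<Rightarrow> 'u)) set \<Rightarrow> bool" where
  "initial_source V A F \<longleftrightarrow>
     (\<forall>W \<in> objs V. \<forall>g \<in> und V W \<rightarrow> und V A.
        admissible V W A g \<longleftrightarrow> (\<forall>(B, f) \<in> F. admissible V W B (f \<circ> g)))"

definition final_sink ::
  "('o, 'm, 'u) conc_cat \<Rightarrow> 'o \<Rightarrow> ('o \<times> ('u \<Rightarrow> 'u)) set \<Rightarrow> bool" where
  "final_sink V A G \<longleftrightarrow>
     (\<forall>W \<in> objs V. \<forall>h \<in> und V A \<rightarrow> und V W.
        admissible V A W h \<longleftrightarrow> (\<forall>(B, g) \<in> G. admissible V B W (h \<circ> g)))"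

locale topological_category = concrete_category V
  for V :: "('o, 'm, 'u) conc_cat" +
  assumes amnestic: "A \<in> Fib V Y \<Longrightarrow> B \<in> Fib V Y \<Longrightarrow> fib_le V A B \<Longrightarrow> fib_le V B A \<Longrightarrow> A = B"
    and initial_lift: "small Y \<Longrightarrow> (\<And>B f. (B, f) \<in> F \<Longrightarrow> B \<in> objs V \<and> f \<in> Y \<rightarrow> und V B) \<Longrightarrow>
          \<exists>A \<in> Fib V Y. (\<forall>(B, f) \<in> F. admissible V A B f) \<and> initial_source V A F"

definition final_structure ::
  "('o, 'm, 'u) conc_cat \<Rightarrow> 'u set \<Rightarrow> ('o \<times> ('u \<Rightarrow> 'u)) set \<Rightarrow> 'o" where
  "final_structure V Y G =
     (THE A. A \<in> Fib V Y \<and> (\<forall>(B, g) \<in> G. admissible V B A g) \<and> final_sink V A G)"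

definition fib_join :: "('o, 'm, 'u) conc_cat \<Rightarrow> 'u set \<Rightarrow> 'o set \<Rightarrow> 'o" where
  "fib_join V Y \<A> =
     (THE J. J \<in> Fib V Y \<and> (\<forall>A \<in> \<A>. fib_le V A J) \<and>
        (\<forall>B \<in> Fib V Y. (\<forall>A \<in> \<A>. fib_le V A B) \<longrightarrow> fib_le V J B))"

definition Indisc :: "('o, 'm, 'u) conc_cat \<Rightarrow> 'u set \<Rightarrow> 'o" where
  "Indisc V Y = (THE A. A \<in> Fib V Y \<and> (\<forall>B \<in> Fib V Y. fib_le V B A))"

definition quotient_object :: "('o, 'm, 'u) conc_cat \<Rightarrow> 'o \<Rightarrow> ('u \<times> 'u) set \<Rightarrow> 'o" where
  "quotient_object V B r = final_structure V (quotient_set (und V B) r) {(B, class_of r)}"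

text \<open>
  The categorical product of a finite list of objects, chosen so that its underlying set is the set
  of tuples and its projections are those of tuples; the empty list gives a terminal object.
\<close>

definition is_product :: "('o, 'm, 'u) conc_cat \<Rightarrow> 'o list \<Rightarrow> 'o \<Rightarrow> bool" where
  "is_product V Bs A \<longleftrightarrow>
     A \<in> Fib V {tup xs | xs. list_all2 (\<lambda>x B. x \<in> und V B) xs Bs} \<and>
     (\<forall>i < length Bs. admissible V A (Bs ! i) (proj i)) \<and>
     (\<forall>W \<in> objs V. \<forall>f. (\<forall>i < length Bs. admissible V W (Bs ! i) (f i)) \<longrightarrow>
        (\<exists>!h. h \<in> extensional (und V W) \<and> admissible V W A h \<and>
           (\<forall>i < length Bs. \<forall>x \<in> und V W. proj i (h x) = f i x)))"

definition product :: "('o, 'm, 'u) conc_cat \<Rightarrow> 'o list \<Rightarrow> 'o" where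
  "product V Bs = (THE A. is_product V Bs A)"

definition cartesian_closed :: "('o, 'm, 'u) conc_cat \<Rightarrow> bool" where
  "cartesian_closed V \<longleftrightarrow>
     (\<forall>A \<in> objs V. \<forall>B \<in> objs V. \<exists>E \<in> objs V. \<exists>ev.
        admissible V (product V [E, A]) B ev \<and>
        (\<forall>C \<in> objs V. \<forall>f. admissible V (product V [C, A]) B f \<longrightarrow>
           (\<exists>!g. g \<in> extensional (und V C) \<and> admissible V C E g \<and>
              (\<forall>c \<in> und V C. \<forall>a \<in> und V A. ev (tup [g c, a]) = f (tup [c, a])))))"


section \<open>Classical universal algebra\<close>

record ('f, 'u) csig =
  csyms :: "'f set"
  cins :: "'f \<Rightarrow> 'u list"
  cout :: "'f \<Rightarrow> 'u"

record ('f, 'u) calg =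
  ccar :: "'u \<Rightarrow> 'u set"
  cop :: "'f \<Rightarrow> 'u list \<Rightarrow> 'u"

datatype ('f, 'c) trm = Cst 'c | App 'f "('f, 'c) trm list"

inductive has_sort :: "('f, 'u) csig \<Rightarrow> ('u \<Rightarrow> 'c set) \<Rightarrow> ('f, 'c) trm \<Rightarrow> 'u \<Rightarrow> bool"
  for C :: "('f, 'u) csig" and Y :: "'u \<Rightarrow> 'c set" where
  Cst: "x \<in> Y S \<Longrightarrow> has_sort C Y (Cst x) S"
| App: "\<tau> \<in> csyms C \<Longrightarrow> list_all2 (has_sort C Y) ts (cins C \<tau>) \<Longrightarrow>
          has_sort C Y (App \<tau> ts) (cout C \<tau>)"

text \<open>Algebra carriers are subsets of \<open>'u\<close>, so terms are coded as elements of \<open>'u\<close>.\<close>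

primrec enc :: "('u \<times> 'u, 'u) trm \<Rightarrow> 'u" where
  "enc (Cst x) = tup [x]"
| "enc (App \<tau> ts) = tup [fst \<tau>, snd \<tau>, tup (map enc ts)]"

definition dec :: "'u \<Rightarrow> ('u \<times> 'u, 'u) trm" where
  "dec = inv enc"

definition term_alg ::
  "('u \<times> 'u, 'u) csig \<Rightarrow> ('u \<Rightarrow> 'u set) \<Rightarrow> ('u \<times> 'u, 'u) calg" where
  "term_alg C Y =
     \<lparr>ccar = (\<lambda>S. enc ` {t. has_sort C Y t S}), cop = (\<lambda>\<tau> ds. enc (App \<tau> (map dec ds)))\<rparr>"

definition in_args :: "('u \<Rightarrow> 'u set) \<Rightarrow> 'u list \<Rightarrow> 'u list \<Rightarrow> bool" where
  "in_args Y Ss as \<longleftrightarrow> list_all2 (\<lambda>a S. a \<in> Y S) as Ss"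

definition calg_eq ::
  "'u set \<Rightarrow> ('f, 'u) csig \<Rightarrow> ('f, 'u) calg \<Rightarrow> ('f, 'u) calg \<Rightarrow> bool" where
  "calg_eq \<S> C D D' \<longleftrightarrow>
     (\<forall>S \<in> \<S>. ccar D S = ccar D' S) \<and>
     (\<forall>\<tau> \<in> csyms C. \<forall>as. in_args (ccar D) (cins C \<tau>) as \<longrightarrow> cop D \<tau> as = cop D' \<tau> as)"

text \<open>
  The variables of sort \<open>S\<close>; these sets are countably infinite and pairwise disjoint.  A context is
  the list of its variables together with their sorts.
\<close>

definition Var :: "'u \<Rightarrow> 'u set" where
  "Var S = {tup (replicate (Suc i) S) | i. True}"

definition is_context :: "'u set \<Rightarrow> ('u \<times> 'u) list \<Rightarrow> bool" where
  "is_context \<S> \<Gamma> \<longleftrightarrow> distinct \<Gamma> \<and> (\<forall>(v, S) \<in> set \<Gamma>. S \<in> \<S> \<and> v \<in> Var S)"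

definition ctx_vars :: "('u \<times> 'u) list \<Rightarrow> 'u \<Rightarrow> 'u set" where
  "ctx_vars \<Gamma> S = {v. (v, S) \<in> set \<Gamma>}"

fun interp ::
  "('f, 'u) calg \<Rightarrow> ('u \<times> 'u) list \<Rightarrow> ('f, 'u) trm \<Rightarrow> 'u list \<Rightarrow> 'u" where
  "interp D \<Gamma> (Cst v) ds = the (map_of (zip (map fst \<Gamma>) ds) v)"
| "interp D \<Gamma> (App \<tau> ts) ds = cop D \<tau> (map (\<lambda>t. interp D \<Gamma> t ds) ts)"

text \<open>\<open>(\<Gamma>, S, s, t)\<close> is the equation of the terms \<open>s\<close> and \<open>t\<close> of sort \<open>S\<close> in context \<open>\<Gamma>\<close>.\<close>

type_synonym ('f, 'u) ceqn = "('u \<times> 'u) list \<times> 'u \<times> ('f, 'u) trm \<times> ('f, 'u) trm"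

definition is_congruence ::
  "'u set \<Rightarrow> ('f, 'u) csig \<Rightarrow> ('f, 'u) calg \<Rightarrow> ('u \<Rightarrow> ('u \<times> 'u) set) \<Rightarrow> bool" where
  "is_congruence \<S> C D R \<longleftrightarrow>
     (\<forall>S \<in> \<S>. equiv (ccar D S) (R S)) \<and>
     (\<forall>\<tau> \<in> csyms C. \<forall>as bs.
        length as = length (cins C \<tau>) \<and> length bs = length (cins C \<tau>) \<and>
        (\<forall>i < length (cins C \<tau>). (as ! i, bs ! i) \<in> R (cins C \<tau> ! i)) \<longrightarrow>
        (cop D \<tau> as, cop D \<tau> bs) \<in> R (cout C \<tau>))"

definition generated_congruence ::
  "'u set \<Rightarrow> ('f, 'u) csig \<Rightarrow> ('f, 'u) ceqn set \<Rightarrow> ('f, 'u) calg \<Rightarrow> 'u \<Rightarrow> ('u \<times> 'u) set" where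
  "generated_congruence \<S> C Q D S =
     \<Inter> {R S | R. is_congruence \<S> C D R \<and>
        (\<forall>(\<Gamma>, T, s, t) \<in> Q. \<forall>as. in_args (ccar D) (map snd \<Gamma>) as \<longrightarrow>
           (interp D \<Gamma> s as, interp D \<Gamma> t as) \<in> R T)}"

definition is_quotient_alg ::
  "'u set \<Rightarrow> ('f, 'u) csig \<Rightarrow> ('f, 'u) calg \<Rightarrow> ('u \<Rightarrow> ('u \<times> 'u) set) \<Rightarrow> ('f, 'u) calg \<Rightarrow> bool"
  where
  "is_quotient_alg \<S> C D R Q \<longleftrightarrow>
     (\<forall>S \<in> \<S>. ccar Q S = quotient_set (ccar D S) (R S)) \<and>
     (\<forall>\<tau> \<in> csyms C. \<forall>as. in_args (ccar D) (cins C \<tau>) as \<longrightarrow>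
        cop Q \<tau> (map2 (\<lambda>S a. class_of (R S) a) (cins C \<tau>) as) =
          class_of (R (cout C \<tau>)) (cop D \<tau> as))"


section \<open>Enriched signatures, algebras and theories\<close>

record ('o, 'u) esig =
  syms :: "'u set"
  ins :: "'u \<Rightarrow> 'u list"
  out :: "'u \<Rightarrow> 'u"
  par :: "'u \<Rightarrow> 'o"

definition is_signature ::
  "('o, 'm, 'u) conc_cat \<Rightarrow> 'u set \<Rightarrow> ('o, 'u) esig \<Rightarrow> bool" where
  "is_signature V \<S> \<Sigma> \<longleftrightarrow>
     small (syms \<Sigma>) \<and> (\<forall>\<sigma> \<in> syms \<Sigma>. set (ins \<Sigma> \<sigma>) \<subseteq> \<S> \<and> out \<Sigma> \<sigma> \<in> \<S> \<and> par \<Sigma> \<sigma> \<in> objs V)"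

text \<open>The object \<open>P \<times> (A\<^bsub>S\<^sub>1\<^esub> \<times> \<dots> \<times> A\<^bsub>S\<^sub>n\<^esub>)\<close> and its elements.\<close>

definition dom_obj ::
  "('o, 'm, 'u) conc_cat \<Rightarrow> 'o \<Rightarrow> 'u list \<Rightarrow> ('u \<Rightarrow> 'o) \<Rightarrow> 'o" where
  "dom_obj V P Ss A = product V [P, product V (map A Ss)]"

definition arg :: "'u \<Rightarrow> 'u list \<Rightarrow> 'u" where
  "arg p as = tup [p, tup as]"

definition arg_par :: "'u \<Rightarrow> 'u" where
  "arg_par x = proj 0 x"

definition arg_list :: "'u \<Rightarrow> 'u list" where
  "arg_list x = untup (proj 1 x)"

record ('o, 'u) ealg =
  car :: "'u \<Rightarrow> 'o"
  opn :: "'u \<Rightarrow> 'u \<Rightarrow> 'u"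

definition is_algebra ::
  "('o, 'm, 'u) conc_cat \<Rightarrow> 'u set \<Rightarrow> ('o, 'u) esig \<Rightarrow> ('o, 'u) ealg \<Rightarrow> bool" where
  "is_algebra V \<S> \<Sigma> A \<longleftrightarrow>
     (\<forall>S \<in> \<S>. car A S \<in> objs V) \<and>
     (\<forall>\<sigma> \<in> syms \<Sigma>.
        admissible V (dom_obj V (par \<Sigma> \<sigma>) (ins \<Sigma> \<sigma>) (car A)) (car A (out \<Sigma> \<sigma>)) (opn A \<sigma>))"

definition is_hom ::
  "('o, 'm, 'u) conc_cat \<Rightarrow> 'u set \<Rightarrow> ('o, 'u) esig \<Rightarrow> ('o, 'u) ealg \<Rightarrow> ('o, 'u) ealg \<Rightarrow>
     ('u \<Rightarrow> 'u \<Rightarrow> 'u) \<Rightarrow> bool" where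
  "is_hom V \<S> \<Sigma> A B f \<longleftrightarrow>
     (\<forall>S \<in> \<S>. admissible V (car A S) (car B S) (f S)) \<and>
     (\<forall>\<sigma> \<in> syms \<Sigma>. \<forall>p \<in> und V (par \<Sigma> \<sigma>). \<forall>as. in_args (\<lambda>S. und V (car A S)) (ins \<Sigma> \<sigma>) as \<longrightarrow>
        f (out \<Sigma> \<sigma>) (opn A \<sigma> (arg p as)) = opn B \<sigma> (arg p (map2 f (ins \<Sigma> \<sigma>) as)))"

definition und_sig :: "('o, 'm, 'u) conc_cat \<Rightarrow> ('o, 'u) esig \<Rightarrow> ('u \<times> 'u, 'u) csig" where
  "und_sig V \<Sigma> =
     \<lparr>csyms = {(\<sigma>, p). \<sigma> \<in> syms \<Sigma> \<and> p \<in> und V (par \<Sigma> \<sigma>)},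
      cins = (\<lambda>(\<sigma>, p). ins \<Sigma> \<sigma>), cout = (\<lambda>(\<sigma>, p). out \<Sigma> \<sigma>)\<rparr>"

definition und_alg :: "('o, 'm, 'u) conc_cat \<Rightarrow> ('o, 'u) ealg \<Rightarrow> ('u \<times> 'u, 'u) calg" where
  "und_alg V A =
     \<lparr>ccar = (\<lambda>S. und V (car A S)), cop = (\<lambda>(\<sigma>, p) as. opn A \<sigma> (arg p as))\<rparr>"

definition indisc_alg :: "('o, 'm, 'u) conc_cat \<Rightarrow> ('u \<times> 'u, 'u) calg \<Rightarrow> ('o, 'u) ealg" where
  "indisc_alg V D =
     \<lparr>car = (\<lambda>S. Indisc V (ccar D S)),
      opn = (\<lambda>\<sigma> x. cop D (\<sigma>, arg_par x) (arg_list x))\<rparr>"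

definition is_alg_operation ::
  "('o, 'm, 'u) conc_cat \<Rightarrow> 'u set \<Rightarrow> ('o, 'u) esig \<Rightarrow> 'u list \<Rightarrow> 'u \<Rightarrow> 'o \<Rightarrow>
     (('o, 'u) ealg \<Rightarrow> 'u \<Rightarrow> 'u) \<Rightarrow> bool" where
  "is_alg_operation V \<S> \<Sigma> Ss S P \<omega> \<longleftrightarrow>
     (\<forall>A. is_algebra V \<S> \<Sigma> A \<longrightarrow> admissible V (dom_obj V P Ss (car A)) (car A S) (\<omega> A)) \<and>
     (\<forall>A B f. is_algebra V \<S> \<Sigma> A \<and> is_algebra V \<S> \<Sigma> B \<and> is_hom V \<S> \<Sigma> A B f \<longrightarrow>
        (\<forall>p \<in> und V P. \<forall>as. in_args (\<lambda>T. und V (car A T)) Ss as \<longrightarrow>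
           f S (\<omega> A (arg p as)) = \<omega> B (arg p (map2 f Ss as))))"

record ('o, 'u) eeqn =
  eins :: "'u list"
  eout :: "'u"
  epar :: "'o"
  lhs :: "('o, 'u) ealg \<Rightarrow> 'u \<Rightarrow> 'u"
  rhs :: "('o, 'u) ealg \<Rightarrow> 'u \<Rightarrow> 'u"

definition is_equation ::
  "('o, 'm, 'u) conc_cat \<Rightarrow> 'u set \<Rightarrow> ('o, 'u) esig \<Rightarrow> ('o, 'u) eeqn \<Rightarrow> bool" where
  "is_equation V \<S> \<Sigma> e \<longleftrightarrow>
     set (eins e) \<subseteq> \<S> \<and> eout e \<in> \<S> \<and> epar e \<in> objs V \<and>
     is_alg_operation V \<S> \<Sigma> (eins e) (eout e) (epar e) (lhs e) \<and>
     is_alg_operation V \<S> \<Sigma> (eins e) (eout e) (epar e) (rhs e)"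

definition satisfies ::
  "('o, 'm, 'u) conc_cat \<Rightarrow> ('o, 'u) ealg \<Rightarrow> ('o, 'u) eeqn \<Rightarrow> bool" where
  "satisfies V A e \<longleftrightarrow>
     (\<forall>x \<in> und V (dom_obj V (epar e) (eins e) (car A)). lhs e A x = rhs e A x)"

definition is_equational_theory ::
  "('o, 'm, 'u) conc_cat \<Rightarrow> 'u set \<Rightarrow> ('o, 'u) esig \<Rightarrow> ('o, 'u) eeqn set \<Rightarrow> bool" where
  "is_equational_theory V \<S> \<Sigma> \<E> \<longleftrightarrow>
     is_signature V \<S> \<Sigma> \<and> |\<E>| <o |UNIV :: 'u set| \<and> (\<forall>e \<in> \<E>. is_equation V \<S> \<Sigma> e)"

definition is_theory_algebra ::
  "('o, 'm, 'u) conc_cat \<Rightarrow> 'u set \<Rightarrow> ('o, 'u) esig \<Rightarrow> ('o, 'u) eeqn set \<Rightarrow>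
     ('o, 'u) ealg \<Rightarrow> bool" where
  "is_theory_algebra V \<S> \<Sigma> \<E> A \<longleftrightarrow> is_algebra V \<S> \<Sigma> A \<and> (\<forall>e \<in> \<E>. satisfies V A e)"

text \<open>The term \<open>t\<^bsub>\<omega>,p\<^esub>\<close> in context \<open>\<Gamma>\<close>.\<close>

definition op_term ::
  "('o, 'm, 'u) conc_cat \<Rightarrow> ('o, 'u) esig \<Rightarrow> (('o, 'u) ealg \<Rightarrow> 'u \<Rightarrow> 'u) \<Rightarrow>
     'u \<Rightarrow> ('u \<times> 'u) list \<Rightarrow> ('u \<times> 'u, 'u) trm" where
  "op_term V \<Sigma> \<omega> p \<Gamma> =
     dec (\<omega> (indisc_alg V (term_alg (und_sig V \<Sigma>) (ctx_vars \<Gamma>)))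
            (arg p (map (\<lambda>(v, S). enc (Cst v)) \<Gamma>)))"

text \<open>One equation is included for each context with the required sorts.\<close>

definition und_eqns ::
  "('o, 'm, 'u) conc_cat \<Rightarrow> 'u set \<Rightarrow> ('o, 'u) esig \<Rightarrow> ('o, 'u) eeqn set \<Rightarrow>
     ('u \<times> 'u, 'u) ceqn set" where
  "und_eqns V \<S> \<Sigma> \<E> =
     {(\<Gamma>, eout e, op_term V \<Sigma> (lhs e) p \<Gamma>, op_term V \<Sigma> (rhs e) p \<Gamma>) | e p \<Gamma>.
        e \<in> \<E> \<and> p \<in> und V (epar e) \<and> is_context \<S> \<Gamma> \<and> map snd \<Gamma> = eins e}"

text \<open>
  The congruence \<open>\<sim>\<^sup>\<E>\<close> on a \<open>\<Sigma>\<close>-algebra; a \<open>\<Sigma>\<close>-congruence on \<open>A\<close> is literally a congruence on the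
  underlying \<open>|\<Sigma>|\<close>-algebra of \<open>A\<close>.
\<close>

definition theory_congruence ::
  "('o, 'm, 'u) conc_cat \<Rightarrow> 'u set \<Rightarrow> ('o, 'u) esig \<Rightarrow> ('o, 'u) eeqn set \<Rightarrow>
     ('o, 'u) ealg \<Rightarrow> 'u \<Rightarrow> ('u \<times> 'u) set" where
  "theory_congruence V \<S> \<Sigma> \<E> A =
     generated_congruence \<S> (und_sig V \<Sigma>) (und_eqns V \<S> \<Sigma> \<E>) (und_alg V A)"


section \<open>Free algebras\<close>

text \<open>
  \<open>\<eta> : X \<rightarrow> A\<close> is a universal arrow from \<open>X\<close> to the forgetful functor from the full subcategory
  \<open>K\<close> of the category of \<open>\<Sigma>\<close>-algebras.
\<close>

definition is_free ::
  "('o, 'm, 'u) conc_cat \<Rightarrow> 'u set \<Rightarrow> ('o, 'u) esig \<Rightarrow> (('o, 'u) ealg \<Rightarrow> bool) \<Rightarrow>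
     ('u \<Rightarrow> 'o) \<Rightarrow> ('o, 'u) ealg \<Rightarrow> ('u \<Rightarrow> 'u \<Rightarrow> 'u) \<Rightarrow> bool" where
  "is_free V \<S> \<Sigma> K X A \<eta> \<longleftrightarrow>
     K A \<and> (\<forall>S \<in> \<S>. admissible V (X S) (car A S) (\<eta> S)) \<and>
     (\<forall>B g. K B \<and> (\<forall>S \<in> \<S>. admissible V (X S) (car B S) (g S)) \<longrightarrow>
        (\<exists>h. is_hom V \<S> \<Sigma> A B h \<and> (\<forall>S \<in> \<S>. \<forall>x \<in> und V (X S). h S (\<eta> S x) = g S x) \<and>
           (\<forall>h'. is_hom V \<S> \<Sigma> A B h' \<and> (\<forall>S \<in> \<S>. \<forall>x \<in> und V (X S). h' S (\<eta> S x) = g S x) \<longrightarrow>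
              (\<forall>S \<in> \<S>. \<forall>a \<in> und V (car A S). h' S a = h S a))))"

definition Term_alg ::
  "('o, 'm, 'u) conc_cat \<Rightarrow> ('o, 'u) esig \<Rightarrow> ('u \<Rightarrow> 'o) \<Rightarrow> ('u \<times> 'u, 'u) calg" where
  "Term_alg V \<Sigma> X = term_alg (und_sig V \<Sigma>) (\<lambda>S. und V (X S))"

abbreviation Term ::
  "('o, 'm, 'u) conc_cat \<Rightarrow> ('o, 'u) esig \<Rightarrow> ('u \<Rightarrow> 'o) \<Rightarrow> 'u \<Rightarrow> 'u set" where
  "Term V \<Sigma> X \<equiv> ccar (Term_alg V \<Sigma> X)"

definition incl :: "'u \<Rightarrow> 'u" where
  "incl x = enc (Cst x)"

text \<open>\<open>A\<close> is \<open>F\<^sup>\<Sigma> X\<close>, with the prescribed underlying algebra and unit.\<close>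

definition is_free_algebra ::
  "('o, 'm, 'u) conc_cat \<Rightarrow> 'u set \<Rightarrow> ('o, 'u) esig \<Rightarrow> ('u \<Rightarrow> 'o) \<Rightarrow> ('o, 'u) ealg \<Rightarrow> bool" where
  "is_free_algebra V \<S> \<Sigma> X A \<longleftrightarrow>
     calg_eq \<S> (und_sig V \<Sigma>) (und_alg V A) (Term_alg V \<Sigma> X) \<and>
     is_free V \<S> \<Sigma> (is_algebra V \<S> \<Sigma>) X A (\<lambda>S. incl)"

text \<open>
  \<open>A\<close> is \<open>F\<^sup>\<T> X\<close>, with the prescribed underlying algebra and unit, where \<open>R\<close> is the congruence
  \<open>\<sim>\<^sup>\<E>\<close> on terms.
\<close>

definition is_free_theory_algebra ::
  "('o, 'm, 'u) conc_cat \<Rightarrow> 'u set \<Rightarrow> ('o, 'u) esig \<Rightarrow> ('o, 'u) eeqn set \<Rightarrow> ('u \<Rightarrow> 'o) \<Rightarrow>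
     ('o, 'u) ealg \<Rightarrow> bool" where
  "is_free_theory_algebra V \<S> \<Sigma> \<E> X A \<longleftrightarrow>
     (let D = Term_alg V \<Sigma> X;
          R = generated_congruence \<S> (und_sig V \<Sigma>) (und_eqns V \<S> \<Sigma> \<E>) D
      in is_quotient_alg \<S> (und_sig V \<Sigma>) D R (und_alg V A) \<and>
         is_free V \<S> \<Sigma> (is_theory_algebra V \<S> \<Sigma> \<E>) X A (\<lambda>S x. class_of (R S) (incl x)))"


section \<open>The objects \<open>\<Omega>\<^sup>n(X)\<close>\<close>

definition sigma_hat ::
  "('o, 'm, 'u) conc_cat \<Rightarrow> ('o, 'u) esig \<Rightarrow> ('u \<Rightarrow> 'o) \<Rightarrow> 'u \<Rightarrow> 'u \<Rightarrow> 'u" where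
  "sigma_hat V \<Sigma> X \<sigma> x = cop (Term_alg V \<Sigma> X) (\<sigma>, arg_par x) (arg_list x)"

primrec Omega ::
  "('o, 'm, 'u) conc_cat \<Rightarrow> ('o, 'u) esig \<Rightarrow> ('u \<Rightarrow> 'o) \<Rightarrow> nat \<Rightarrow> 'u \<Rightarrow> 'o" where
  "Omega V \<Sigma> X 0 = (\<lambda>S. final_structure V (Term V \<Sigma> X S) {(X S, incl)})"
| "Omega V \<Sigma> X (Suc n) =
     (\<lambda>S. fib_join V (Term V \<Sigma> X S)
        {Omega V \<Sigma> X n S,
         final_structure V (Term V \<Sigma> X S)
           {(dom_obj V (par \<Sigma> \<sigma>) (ins \<Sigma> \<sigma>) (Omega V \<Sigma> X n), sigma_hat V \<Sigma> X \<sigma>) | \<sigma>.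
              \<sigma> \<in> syms \<Sigma> \<and> out \<Sigma> \<sigma> = S}})"

end

theory Submission
  imports Defs
begin

text \<open>
  In a cartesian closed topological category, \<open>- \<times> B\<close> preserves surjective final sinks, hence so do
  finite products in each argument.  As the \<open>\<Omega>\<^sup>n(X)\<close> form an increasing chain, the operation
  \<open>\<sigma>\<close> therefore maps \<open>P \<times> \<Prod>\<^sub>i \<Or>\<^sub>n \<Omega>\<^sup>n(X)\<close> into \<open>\<Or>\<^sub>n \<Omega>\<^sup>n(X)\<close>, and by the finality of each \<open>\<Omega>\<^sup>n(X)\<close>
  evaluation of terms in an algebra is admissible, so that this join carries the free algebra.  The
  quotient maps are final and surjective, so the operations descend to the quotient.  Finally,
  naturality along \<open>A \<rightarrow> A'\<close>, with \<open>A'\<close> the indiscrete algebra on \<open>|A|\<close>, shows that an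
  algebraic operation acts on every algebra as the term \<open>t\<^sub>\<omega>\<^sub>,\<^sub>p\<close>; hence the algebras of the theory
  are the algebras satisfying the underlying classical equations, and the quotient is free among them.
  The carrier of any other free algebra with the same underlying data agrees with it by amnesticity.
\<close>

section \<open>Small sets, final structures and products\<close>

text \<open>Final structures are available only on small sets, so inaccessibility enters before
  anything else: it bounds the terms over \<open>X\<close> by stratifying them by size. The obstacle
  is that finality of a sink is in general lost under products, while every operation has a product
  as its domain. Cartesian closedness moves the other factors into an exponential, where finality
  can be applied. Doing this one coordinate at a time leads to all choices of one sink member per
  argument. For the join such a choice is a tuple of levels, whereas the construction of
  \<open>\<Omega>\<^sup>n(X)\<close> only controls equal levels; monotonicity in \<open>n\<close>
  makes equal levels cofinal. For a quotient there is a single choice. Naturality is used in an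
  indiscrete algebra because every function into an indiscrete object is admissible: interpretation
  of terms is then a homomorphism out of the indiscrete term algebra, although it need not be one
  into \<open>A\<close> itself. Quotient elements are coded by representatives, so the quotient of
  the terms is again a set of terms and evaluation restricts to it.\<close>

locale topological_universe = topological_category V
  for V :: "('o, 'm, 'u) conc_cat" +
  assumes inaccessible: "inaccessible_universe TYPE('u)"
begin

section \<open>Smallness and the coding of tuples\<close>

lemma infinite_universe: "infinite (UNIV :: 'u set)"
proof -
  have "natLeq <o |UNIV :: 'u set|"
    using inaccessible by (simp add: inaccessible_universe_def)
  then show ?thesis
    using infinite_iff_natLeq_ordLeq ordLess_imp_ordLeq by blast
qed

lemma inj_tup_u: "inj (tup :: 'u list \<Rightarrow> 'u)"
  using infinite_universe by (rule inj_tup)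

lemma tup_eq_iff [simp]: "tup xs = (tup ys :: 'u) \<longleftrightarrow> xs = ys"
  using inj_tup_u by (simp add: inj_eq)

lemma untup_tup [simp]: "untup (tup xs :: 'u) = xs"
  unfolding untup_def using inj_tup_u by simp

lemma proj_tup [simp]: "proj i (tup xs :: 'u) = xs ! i"
  by (simp add: proj_def)

lemma arg_par_arg [simp]: "arg_par (arg p as :: 'u) = p"
  by (simp add: arg_par_def arg_def)

lemma arg_list_arg [simp]: "arg_list (arg p as :: 'u) = as"
  by (simp add: arg_list_def arg_def)

lemma arg_eq_iff [simp]: "arg p as = (arg q bs :: 'u) \<longleftrightarrow> p = q \<and> as = bs"
  by (simp add: arg_def)

lemma small_subset: "small B \<Longrightarrow> A \<subseteq> B \<Longrightarrow> small (A :: 'u set)"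
  unfolding small_def using card_of_mono1 ordLeq_ordLess_trans by blast

lemma small_image: "small A \<Longrightarrow> small (f ` A :: 'u set)" for A :: "'u set"
  unfolding small_def using card_of_image ordLeq_ordLess_trans by blast

lemma small_finite: "finite A \<Longrightarrow> small (A :: 'u set)"
  unfolding small_def using infinite_universe finite_ordLess_infinite
  by (metis Field_card_of card_of_Well_order)

text \<open>Regularity of the cardinal of the universe is what is used. The index set may have any
  type, so that countable unions are an instance.\<close>

lemma small_UN_class:
  assumes "|I| <o |UNIV :: 'u set|" "\<And>i. i \<in> I \<Longrightarrow> small (A i :: 'u set)"
  shows "small (\<Union>i\<in>I. A i)"
proof -
  have "regularCard |UNIV :: 'u set|"
    using inaccessible by (simp add: inaccessible_universe_def)
  moreover have "Cinfinite |UNIV :: 'u set|"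
    using infinite_universe unfolding cinfinite_def Field_card_of by (intro conjI card_of_card_order_on)
  ultimately show ?thesis
    using assms unfolding small_def
    by (intro card_of_UNION_ordLess_infinite_Field_regularCard) auto
qed

lemma small_UN: "small I \<Longrightarrow> (\<And>i. i \<in> I \<Longrightarrow> small (A i)) \<Longrightarrow> small (\<Union>i\<in>I. A i :: 'u set)"
  for I :: "'u set"
  by (rule small_UN_class) (auto simp: small_def)

lemma small_UN_nat: "(\<And>n :: nat. small (A n)) \<Longrightarrow> small (\<Union>n. A n :: 'u set)"
proof (rule small_UN_class)
  have "natLeq <o |UNIV :: 'u set|"
    using inaccessible by (simp add: inaccessible_universe_def)
  then show "|UNIV :: nat set| <o |UNIV :: 'u set|"
    using card_of_nat ordIso_ordLess_trans by blast
qed auto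

lemma small_Un: "small A \<Longrightarrow> small B \<Longrightarrow> small (A \<union> B :: 'u set)"
  unfolding small_def using infinite_universe by (rule card_of_Un_ordLess_infinite)

text \<open>Tuples are fibred over their first entry, so finite products reduce to small unions of
  images.\<close>

lemma small_tuples:
  "(\<And>B. B \<in> set Bs \<Longrightarrow> small B) \<Longrightarrow> small {tup xs :: 'u | xs. list_all2 (\<lambda>x B. x \<in> B) xs Bs}"
proof (induction Bs)
  case Nil
  then show ?case by (simp add: small_finite)
next
  case (Cons B Bs)
  have "{tup xs :: 'u | xs. list_all2 (\<lambda>x B. x \<in> B) xs (B # Bs)} \<subseteq>
      (\<Union>b\<in>B. (\<lambda>y. tup (b # untup y)) ` {tup xs | xs. list_all2 (\<lambda>x B. x \<in> B) xs Bs})"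
    by (force simp: list_all2_Cons2 image_iff)
  moreover have "small \<dots>"
    using Cons by (intro small_UN small_image) auto
  ultimately show ?case
    by (rule small_subset[rotated])
qed

text \<open>Admissibility looks only at the restriction to \<open>und V A\<close>. Most admissible
  maps below arise by composition, and this rule then exchanges the composite for the formula that
  is wanted.\<close>

lemma admissible_mono:
  assumes "admissible V A B f" and eq: "\<And>x. x \<in> und V A \<Longrightarrow> f x = g x"
  shows "admissible V A B g"
proof -
  have "restrict f (und V A) = restrict g (und V A)"
    using eq by (rule restrict_ext)
  with assms show ?thesis
    by (simp add: admissible_def Pi_iff)
qed

lemma admissible_mem: "admissible V A B f \<Longrightarrow> x \<in> und V A \<Longrightarrow> f x \<in> und V B"
  by (auto simp: admissible_def)

lemma admissible_objs: "admissible V A B f \<Longrightarrow> A \<in> objs V \<and> B \<in> objs V"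
  unfolding admissible_def hom_def using src_obj tgt_obj by auto

lemma admissible_id: "A \<in> objs V \<Longrightarrow> admissible V A A (\<lambda>x. x)"
  unfolding admissible_def using ident_hom undm_ident by force

lemma admissible_comp:
  assumes "admissible V A B f" "admissible V B C g"
  shows "admissible V A C (\<lambda>x. g (f x))"
proof -
  obtain m n where "m \<in> hom V A B" "undm V m = restrict f (und V A)"
    "n \<in> hom V B C" "undm V n = restrict g (und V B)"
    using assms by (auto simp: admissible_def)
  moreover from this have "undm V (comp V n m) = restrict (\<lambda>x. g (f x)) (und V A)"
    using assms(1) by (auto simp: undm_comp compose_def admissible_def fun_eq_iff)
  ultimately show ?thesis
    using assms comp_hom unfolding admissible_def by (fastforce simp: Pi_iff)
qed

section \<open>Final structures, joins in a fibre, and indiscrete objects\<close>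

lemma fibre_antisym:
  "A \<in> Fib V Y \<Longrightarrow> B \<in> Fib V Y \<Longrightarrow> admissible V A B (\<lambda>x. x) \<Longrightarrow> admissible V B A (\<lambda>x. x) \<Longrightarrow> A = B"
  using amnestic by (auto simp: fib_le_def)

lemma final_sinkD:
  assumes "final_sink V A G" "W \<in> objs V" "\<And>x. x \<in> und V A \<Longrightarrow> h x \<in> und V W"
    and "\<And>B g. (B, g) \<in> G \<Longrightarrow> admissible V B W (\<lambda>x. h (g x))"
  shows "admissible V A W h"
  using assms unfolding final_sink_def by (fastforce simp: o_def)

text \<open>Final lifts come from initial ones: lift the source of all functions out of
  \<open>Y\<close> whose composites with the whole sink are admissible. Initiality makes each member
  of the sink admissible, and every function that finality has to test already belongs to the
  source.\<close>

lemma final_lift: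
  fixes Y :: "'u set"
  assumes "small Y" "\<And>B g. (B, g) \<in> G \<Longrightarrow> B \<in> objs V \<and> g \<in> und V B \<rightarrow> Y"
  shows "\<exists>A \<in> Fib V Y. (\<forall>(B, g) \<in> G. admissible V B A g) \<and> final_sink V A G"
proof -
  define F where "F = {(C, f). C \<in> objs V \<and> f \<in> Y \<rightarrow> und V C \<and>
    (\<forall>(B, g) \<in> G. admissible V B C (f \<circ> g))}"
  obtain A where A: "A \<in> Fib V Y" "\<forall>(C, f) \<in> F. admissible V A C f" "initial_source V A F"
    using initial_lift[of Y F] assms(1) by (auto simp: F_def)
  have Y: "und V A = Y"
    using A(1) by (simp add: Fib_def)
  have adm: "admissible V B A g" if "(B, g) \<in> G" for B g
    using A(3) assms(2)[OF that] that unfolding initial_source_def Y F_def by blast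
  moreover have "final_sink V A G"
    unfolding final_sink_def
  proof (intro ballI iffI)
    fix W h assume "W \<in> objs V" "h \<in> und V A \<rightarrow> und V W" "\<forall>(B, g) \<in> G. admissible V B W (h \<circ> g)"
    then show "admissible V A W h"
      using A(2) Y by (auto simp: F_def)
  qed (use adm admissible_comp in \<open>fastforce simp: o_def\<close>)
  ultimately show ?thesis
    using A(1) by blast
qed

lemma final_lift_unique:
  assumes "A \<in> Fib V Y" "\<forall>(B, g) \<in> G. admissible V B A g" "final_sink V A G"
    and "A' \<in> Fib V Y" "\<forall>(B, g) \<in> G. admissible V B A' g" "final_sink V A' G"
  shows "A = A'"
  using assms
  by (intro fibre_antisym final_sinkD[of A G] final_sinkD[of A' G]) (auto simp: Fib_def)

lemma final_structure:
  fixes Y :: "'u set"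
  assumes "small Y" "\<And>B g. (B, g) \<in> G \<Longrightarrow> B \<in> objs V \<and> g \<in> und V B \<rightarrow> Y"
  shows "final_structure V Y G \<in> Fib V Y"
    and "(B, g) \<in> G \<Longrightarrow> admissible V B (final_structure V Y G) g"
    and "final_sink V (final_structure V Y G) G"
proof -
  let ?P = "\<lambda>A. A \<in> Fib V Y \<and> (\<forall>(B, g) \<in> G. admissible V B A g) \<and> final_sink V A G"
  obtain A where A: "?P A"
    using final_lift[OF assms] by blast
  then have "B = A" if "?P B" for B
    using that by (intro final_lift_unique[of B Y G A]) auto
  from theI[of ?P, OF A this] have "?P (final_structure V Y G)"
    unfolding final_structure_def .
  then show "final_structure V Y G \<in> Fib V Y"
    "(B, g) \<in> G \<Longrightarrow> admissible V B (final_structure V Y G) g"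
    "final_sink V (final_structure V Y G) G"
    by auto
qed

text \<open>The join is the final structure induced by identity functions. This is stronger than
  being a least upper bound: it also tests functions that leave the fibre, such as evaluation of
  terms in another algebra.\<close>

lemma fib_join:
  assumes Y: "small Y" and \<A>: "\<A> \<subseteq> Fib V Y"
  shows "fib_join V Y \<A> \<in> Fib V Y"
    and "A \<in> \<A> \<Longrightarrow> admissible V A (fib_join V Y \<A>) (\<lambda>x. x)"
    and "final_sink V (fib_join V Y \<A>) ((\<lambda>A. (A, \<lambda>x. x)) ` \<A>)"
proof -
  let ?G = "(\<lambda>A. (A, \<lambda>x. x)) ` \<A>"
  let ?J = "final_structure V Y ?G"
  have G: "B \<in> objs V \<and> g \<in> und V B \<rightarrow> Y" if "(B, g) \<in> ?G" for B g
    using that \<A> by (auto simp: Fib_def)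
  note J = final_structure[OF Y G]
  have "fib_join V Y \<A> = ?J"
    unfolding fib_join_def
  proof (rule the_equality)
    show *: "?J \<in> Fib V Y \<and> (\<forall>A \<in> \<A>. fib_le V A ?J) \<and>
        (\<forall>B \<in> Fib V Y. (\<forall>A \<in> \<A>. fib_le V A B) \<longrightarrow> fib_le V ?J B)"
      unfolding fib_le_def
      using J(1) J(2) final_sinkD[OF J(3)] by (fastforce simp: Fib_def)
    show "J = ?J" if "J \<in> Fib V Y \<and> (\<forall>A \<in> \<A>. fib_le V A J) \<and>
        (\<forall>B \<in> Fib V Y. (\<forall>A \<in> \<A>. fib_le V A B) \<longrightarrow> fib_le V J B)" for J
      using that * by (meson amnestic)
  qed
  then show "fib_join V Y \<A> \<in> Fib V Y" "A \<in> \<A> \<Longrightarrow> admissible V A (fib_join V Y \<A>) (\<lambda>x. x)"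
    "final_sink V (fib_join V Y \<A>) ?G"
    using J by auto
qed

text \<open>The initial lift of the empty source imposes no condition, so every function into it is
  admissible, not only the identities that make it the greatest element of the fibre.\<close>

lemma Indisc:
  fixes Y :: "'u set"
  assumes "small Y"
  shows "Indisc V Y \<in> Fib V Y"
    and "W \<in> objs V \<Longrightarrow> f \<in> und V W \<rightarrow> Y \<Longrightarrow> admissible V W (Indisc V Y) f"
proof -
  obtain A where A: "A \<in> Fib V Y" "initial_source V A {}"
    using initial_lift[of Y "{}"] assms by auto
  have adm: "admissible V W A f" if "W \<in> objs V" "f \<in> und V W \<rightarrow> Y" for W f
    using A that by (auto simp: initial_source_def Fib_def)
  have "Indisc V Y = A"
    unfolding Indisc_def
  proof (rule the_equality)
    show *: "A \<in> Fib V Y \<and> (\<forall>B \<in> Fib V Y. fib_le V B A)"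
      using A adm by (auto simp: fib_le_def Fib_def)
    show "B = A" if "B \<in> Fib V Y \<and> (\<forall>C \<in> Fib V Y. fib_le V C B)" for B
      using that * by (meson amnestic)
  qed
  then show "Indisc V Y \<in> Fib V Y"
    "W \<in> objs V \<Longrightarrow> f \<in> und V W \<rightarrow> Y \<Longrightarrow> admissible V W (Indisc V Y) f"
    using A adm by auto
qed

section \<open>Finite products with tuples as elements\<close>

definition tuples :: "'o list \<Rightarrow> 'u list set" where
  "tuples Bs = {xs. list_all2 (\<lambda>x B. x \<in> und V B) xs Bs}"

lemma tuplesI:
  "length xs = length Bs \<Longrightarrow> (\<And>i. i < length Bs \<Longrightarrow> xs ! i \<in> und V (Bs ! i)) \<Longrightarrow> xs \<in> tuples Bs"
  by (simp add: tuples_def list_all2_conv_all_nth)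

lemma tuples_length: "xs \<in> tuples Bs \<Longrightarrow> length xs = length Bs"
  by (simp add: tuples_def list_all2_lengthD)

lemma tuples_nth: "xs \<in> tuples Bs \<Longrightarrow> i < length Bs \<Longrightarrow> xs ! i \<in> und V (Bs ! i)"
  by (simp add: tuples_def list_all2_conv_all_nth)

lemma tuple_eqI:
  assumes "x \<in> tup ` tuples Bs" "length ys = length Bs" "\<And>i. i < length Bs \<Longrightarrow> proj i x = ys ! i"
  shows "x = tup ys"
  using assms by (auto simp: tuples_length intro!: nth_equalityI)

lemma is_product_universal:
  assumes "is_product V Bs A" "W \<in> objs V" "\<And>i. i < length Bs \<Longrightarrow> admissible V W (Bs ! i) (f i)"
  obtains h where "admissible V W A h" "\<forall>i < length Bs. \<forall>x \<in> und V W. proj i (h x) = f i x"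
proof -
  have "\<exists>!h. h \<in> extensional (und V W) \<and> admissible V W A h \<and>
      (\<forall>i < length Bs. \<forall>x \<in> und V W. proj i (h x) = f i x)"
    using assms(1) unfolding is_product_def using assms(2,3) by (elim conjE) simp
  then show thesis
    using that by (elim ex1E) blast
qed

text \<open>The underlying set and the projections are prescribed, so the comparison map is the
  identity function and amnesticity turns the isomorphism into an equality. This is what makes the
  \<open>THE\<close> in \<open>product\<close> meaningful.\<close>

lemma is_product_unique: "is_product V Bs A \<Longrightarrow> is_product V Bs B \<Longrightarrow> A = B"
proof -
  have le: "admissible V A B (\<lambda>x. x)" if prods: "is_product V Bs A" "is_product V Bs B" for A B
  proof -
    have A: "A \<in> objs V" "und V A = tup ` tuples Bs" "und V B = tup ` tuples Bs"
      "\<forall>i < length Bs. admissible V A (Bs ! i) (proj i)"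
      using prods by (auto simp: is_product_def Fib_def tuples_def)
    then obtain h where h: "admissible V A B h"
      "\<forall>i < length Bs. \<forall>x \<in> und V A. proj i (h x) = proj i x"
      using is_product_universal[OF prods(2), of A proj] A(1,4) by blast
    have "h x = x" if x: "x \<in> und V A" for x
    proof -
      obtain xs where xs: "x = tup xs" "xs \<in> tuples Bs"
        using x A by auto
      have "h x \<in> tup ` tuples Bs"
        using admissible_mem[OF h(1) x] A by simp
      then show ?thesis
        unfolding xs(1) by (rule tuple_eqI) (use h(2) x xs in \<open>simp_all add: tuples_length\<close>)
    qed
    then show ?thesis
      by (rule admissible_mono[OF h(1)])
  qed
  assume "is_product V Bs A" "is_product V Bs B"
  moreover from this have "A \<in> Fib V (tup ` tuples Bs)" "B \<in> Fib V (tup ` tuples Bs)"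
    by (simp_all add: is_product_def tuples_def setcompr_eq_image)
  ultimately show "A = B"
    using fibre_antisym le by blast
qed

text \<open>The product is the initial lift of the projections: initiality converts admissibility of
  all components into admissibility of the tupling.\<close>

lemma is_product_product:
  assumes "set Bs \<subseteq> objs V"
  shows "is_product V Bs (product V Bs)"
proof -
  let ?Y = "tup ` tuples Bs"
  let ?F = "{(Bs ! i, proj i) | i. i < length Bs}"
  have "small {tup xs :: 'u | xs. list_all2 (\<lambda>x B. x \<in> B) xs (map (und V) Bs)}"
    using assms by (intro small_tuples) (auto simp: und_small)
  then have "small ?Y"
    by (simp add: tuples_def list.rel_map setcompr_eq_image)
  moreover have "Bs ! i \<in> objs V \<and> proj i \<in> ?Y \<rightarrow> und V (Bs ! i)" if "i < length Bs" for i
    using that assms by (auto simp: tuples_nth)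
  ultimately obtain A where A: "A \<in> Fib V ?Y" "\<forall>i < length Bs. admissible V A (Bs ! i) (proj i)"
    "initial_source V A ?F"
    using initial_lift[of ?Y ?F] by fastforce
  have "is_product V Bs A"
    unfolding is_product_def
  proof (intro conjI ballI allI impI)
    show "A \<in> Fib V {tup xs | xs. list_all2 (\<lambda>x B. x \<in> und V B) xs Bs}"
      using A(1) by (simp add: tuples_def setcompr_eq_image)
    fix W f assume W: "W \<in> objs V" "\<forall>i < length Bs. admissible V W (Bs ! i) (f i)"
    define h where "h = (\<lambda>x\<in>und V W. tup (map (\<lambda>i. f i x) [0..<length Bs]))"
    have hY: "h \<in> und V W \<rightarrow> und V A"
      using A(1) W(2) by (auto simp: h_def Fib_def intro!: imageI tuplesI intro: admissible_mem[rotated])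
    have "admissible V W (Bs ! i) (proj i \<circ> h)" if "i < length Bs" for i
      using that by (intro admissible_mono[OF W(2)[rule_format]]) (auto simp: h_def)
    then have "admissible V W A h"
      using A(3) W(1) hY by (auto simp: initial_source_def)
    moreover have "h' = h" if h': "h' \<in> extensional (und V W)" "admissible V W A h'"
      "\<forall>i < length Bs. \<forall>x \<in> und V W. proj i (h' x) = f i x" for h'
    proof (rule extensionalityI[OF h'(1)])
      fix x assume x: "x \<in> und V W"
      have "h' x \<in> tup ` tuples Bs"
        using admissible_mem[OF h'(2) x] A(1) by (simp add: Fib_def)
      then show "h' x = h x"
        unfolding h_def restrict_apply'[OF x] by (rule tuple_eqI) (use h'(3) x in simp_all)
    qed (simp add: h_def)
    ultimately show "\<exists>!h. h \<in> extensional (und V W) \<and> admissible V W A h \<and>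
        (\<forall>i < length Bs. \<forall>x \<in> und V W. proj i (h x) = f i x)"
      by (intro ex1I[of _ h]) (auto simp: h_def)
  qed (use A(2) in auto)
  from theI[of "is_product V Bs", OF this is_product_unique[OF _ this]] show ?thesis
    unfolding product_def .
qed

lemma product_objs: "set Bs \<subseteq> objs V \<Longrightarrow> product V Bs \<in> objs V"
  using is_product_product by (auto simp: is_product_def Fib_def)

lemma und_product: "set Bs \<subseteq> objs V \<Longrightarrow> und V (product V Bs) = tup ` tuples Bs"
  using is_product_product[of Bs] by (simp add: is_product_def Fib_def tuples_def setcompr_eq_image)

lemma admissible_proj:
  "set Bs \<subseteq> objs V \<Longrightarrow> i < length Bs \<Longrightarrow> admissible V (product V Bs) (Bs ! i) (proj i)"
  using is_product_product by (simp add: is_product_def)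

lemma admissible_tup:
  assumes "set Bs \<subseteq> objs V" "W \<in> objs V" "\<And>w. w \<in> und V W \<Longrightarrow> length (k w) = length Bs"
    and "\<And>i. i < length Bs \<Longrightarrow> admissible V W (Bs ! i) (\<lambda>w. k w ! i)"
  shows "admissible V W (product V Bs) (\<lambda>w. tup (k w))"
proof -
  obtain h where h: "admissible V W (product V Bs) h"
    "\<forall>i < length Bs. \<forall>x \<in> und V W. proj i (h x) = k x ! i"
    using is_product_universal[OF is_product_product[OF assms(1)] assms(2), of "\<lambda>i w. k w ! i"] assms(4)
    by auto
  have "h x = tup (k x)" if x: "x \<in> und V W" for x
    using admissible_mem[OF h(1) x] h(2) assms(1,3) x
    by (intro tuple_eqI[of _ Bs]) (simp_all add: und_product)
  then show ?thesis
    by (rule admissible_mono[OF h(1)])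
qed

end

section \<open>Products of final sinks in the cartesian closed case\<close>

context topological_universe
begin

lemma tuples_append_Cons_update:
  assumes "xs \<in> tuples (pre @ A # post)" "a \<in> und V B"
  shows "xs[length pre := a] \<in> tuples (pre @ B # post)"
proof (rule tuplesI)
  show "length (xs[length pre := a]) = length (pre @ B # post)"
    using tuples_length[OF assms(1)] by simp
  show "xs[length pre := a] ! i \<in> und V ((pre @ B # post) ! i)" if "i < length (pre @ B # post)" for i
    using tuples_nth[OF assms(1), of i] tuples_length[OF assms(1)] that assms(2)
    by (auto simp: nth_list_update nth_append nth_Cons' split: if_splits)
qed

lemma und_pair:
  "A \<in> objs V \<Longrightarrow> B \<in> objs V \<Longrightarrow>
    und V (product V [A, B]) = {tup [a, b] | a b. a \<in> und V A \<and> b \<in> und V B}"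
  by (auto simp: und_product tuples_def list_all2_Cons2)

lemma admissible_pair:
  assumes "admissible V W A f" "admissible V W B g"
  shows "admissible V W (product V [A, B]) (\<lambda>w. tup [f w, g w])"
  using assms admissible_objs
  by (intro admissible_tup) (auto simp: less_Suc_eq)

lemma admissible_fst: "A \<in> objs V \<Longrightarrow> B \<in> objs V \<Longrightarrow> admissible V (product V [A, B]) A (proj 0)"
  using admissible_proj[of "[A, B]" 0] by simp

lemma admissible_snd: "A \<in> objs V \<Longrightarrow> B \<in> objs V \<Longrightarrow> admissible V (product V [A, B]) B (proj 1)"
  using admissible_proj[of "[A, B]" 1] by simp

text \<open>Two instances matter: the identity functions from the levels of a chain to its join, and
  a single quotient map.\<close>

definition surjective_final_sink :: "'o \<Rightarrow> ('o \<times> ('u \<Rightarrow> 'u)) set \<Rightarrow> bool" where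
  "surjective_final_sink A G \<longleftrightarrow> A \<in> objs V \<and> (\<forall>(B, g) \<in> G. admissible V B A g) \<and>
     final_sink V A G \<and> (\<forall>a \<in> und V A. \<exists>(B, g) \<in> G. a \<in> g ` und V B)"

section \<open>The domain objects of operations\<close>

lemma tuples_map: "as \<in> tuples (map A Ss) \<longleftrightarrow> in_args (\<lambda>S. und V (A S)) Ss as"
  by (simp add: tuples_def in_args_def list.rel_map)

lemma und_dom_obj:
  assumes "P \<in> objs V" "\<And>S. S \<in> set Ss \<Longrightarrow> A S \<in> objs V"
  shows "und V (dom_obj V P Ss A) =
    {arg p as | p as. p \<in> und V P \<and> in_args (\<lambda>S. und V (A S)) Ss as}"
proof -
  have "set (map A Ss) \<subseteq> objs V"
    using assms(2) by auto
  then have "und V (dom_obj V P Ss A) =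
      {tup [p, x] | p x. p \<in> und V P \<and> x \<in> tup ` tuples (map A Ss)}"
    unfolding dom_obj_def using assms(1) by (simp only: und_pair product_objs und_product)
  also have "\<dots> = {arg p as | p as. p \<in> und V P \<and> in_args (\<lambda>S. und V (A S)) Ss as}"
    unfolding arg_def tuples_map[symmetric] by blast
  finally show ?thesis .
qed

lemma dom_obj_objs:
  assumes "P \<in> objs V" "\<And>S. S \<in> set Ss \<Longrightarrow> A S \<in> objs V"
  shows "dom_obj V P Ss A \<in> objs V"
  unfolding dom_obj_def using assms by (intro product_objs) (auto intro!: product_objs)

text \<open>Flattens the nested product of the parameter object and the arguments, so that arguments
  about single coordinates need only handle one list of factors.\<close>

lemma admissible_dom_obj_iff:
  assumes P: "P \<in> objs V" and A: "\<And>S. S \<in> set Ss \<Longrightarrow> A S \<in> objs V"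
  shows "admissible V (dom_obj V P Ss A) C f \<longleftrightarrow>
    admissible V (product V (P # map A Ss)) C (\<lambda>z. f (arg (proj 0 z) (tl (untup z))))"
    (is "?L \<longleftrightarrow> ?R")
proof
  have Ss: "set (map A Ss) \<subseteq> objs V" and PSs: "set (P # map A Ss) \<subseteq> objs V"
    using assms by auto
  have "admissible V (product V (P # map A Ss)) (map A Ss ! i) (\<lambda>z. tl (untup z) ! i)"
    if "i < length Ss" for i
    using admissible_proj[OF PSs, of "Suc i"] that
    by (auto elim!: admissible_mono simp: und_product[OF PSs] nth_tl tuples_length)
  then have "admissible V (product V (P # map A Ss)) (product V (map A Ss)) (\<lambda>z. tup (tl (untup z)))"
    using Ss PSs
    by (intro admissible_tup product_objs) (auto simp: und_product[OF PSs] tuples_length)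
  then have "admissible V (product V (P # map A Ss)) (dom_obj V P Ss A)
      (\<lambda>z. arg (proj 0 z) (tl (untup z)))"
    unfolding arg_def dom_obj_def
    using admissible_proj[OF PSs, of 0] by (intro admissible_pair) auto
  then show ?R if ?L
    using admissible_comp that by blast
next
  assume R: ?R
  have Ss: "set (map A Ss) \<subseteq> objs V" and PSs: "set (P # map A Ss) \<subseteq> objs V"
    using assms by auto
  let ?D = "dom_obj V P Ss A"
  have par: "admissible V ?D P (proj 0)"
    and list: "admissible V ?D (product V (map A Ss)) (proj 1)"
    unfolding dom_obj_def
    using P product_objs[OF Ss] by (rule admissible_fst admissible_snd)+
  have "admissible V ?D (product V (P # map A Ss)) (\<lambda>z. tup (arg_par z # arg_list z))"
  proof (rule admissible_tup[OF PSs dom_obj_objs[OF P A]])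
    show "length (arg_par z # arg_list z) = length (P # map A Ss)" if "z \<in> und V ?D" for z
      using that by (auto simp: und_dom_obj[OF P A] in_args_def dest: list_all2_lengthD)
    show "admissible V ?D ((P # map A Ss) ! i) (\<lambda>z. (arg_par z # arg_list z) ! i)"
      if "i < length (P # map A Ss)" for i
    proof (cases i)
      case 0
      then show ?thesis
        using par by (simp add: arg_par_def)
    next
      case (Suc j)
      then show ?thesis
        using admissible_comp[OF list admissible_proj[OF Ss, of j]] that
        by (simp add: arg_list_def proj_def)
    qed
  qed
  from admissible_comp[OF this R] show ?L
    by (rule admissible_mono) (auto simp: und_dom_obj[OF P A])
qed

end

section \<open>Consequences of cartesian closedness\<close>

locale closed_topological_universe = topological_universe V
  for V :: "('o, 'm, 'u) conc_cat" +
  assumes cartesian_closed: "cartesian_closed V"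
begin

text \<open>
  The transposes of the restrictions of \<open>f\<close> along the sink glue to a transpose of \<open>f\<close>: they agree
  on points by uniqueness of transposes of maps out of a discrete point.  The underlying set of an
  exponential need not be a set of functions, so this uses that the sink is surjective.
\<close>

lemma final_sink_times:
  assumes sink: "surjective_final_sink A G" and B: "B \<in> objs V" and C: "C \<in> objs V"
    and f: "\<And>a b. a \<in> und V A \<Longrightarrow> b \<in> und V B \<Longrightarrow> f a b \<in> und V C"
    and adm: "\<And>D g. (D, g) \<in> G \<Longrightarrow>
      admissible V (product V [D, B]) C (\<lambda>z. f (g (proj 0 z)) (proj 1 z))"
  shows "admissible V (product V [A, B]) C (\<lambda>z. f (proj 0 z) (proj 1 z))"
proof -
  have A: "A \<in> objs V" and fin: "final_sink V A G"
    and mem: "\<And>D g. (D, g) \<in> G \<Longrightarrow> admissible V D A g"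
    and surj: "\<And>a. a \<in> und V A \<Longrightarrow> \<exists>(D, g) \<in> G. a \<in> g ` und V D"
    using sink by (auto simp: surjective_final_sink_def)
  from cartesian_closed[unfolded cartesian_closed_def, rule_format, OF B C]
  obtain E ev where E: "E \<in> objs V" "admissible V (product V [E, B]) C ev"
    and transpose: "\<forall>D \<in> objs V. \<forall>f. admissible V (product V [D, B]) C f \<longrightarrow>
      (\<exists>!g. g \<in> extensional (und V D) \<and> admissible V D E g \<and>
        (\<forall>d \<in> und V D. \<forall>b \<in> und V B. ev (tup [g d, b]) = f (tup [d, b])))"
    by (elim bexE exE conjE) (rule that)
  have "\<exists>h. admissible V D E h \<and> (\<forall>d \<in> und V D. \<forall>b \<in> und V B. ev (tup [h d, b]) = f (g d) b)"
    if "(D, g) \<in> G" for D g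
    using transpose[rule_format, OF _ adm[OF that]] admissible_objs[OF mem[OF that]] by fastforce
  then have "\<forall>D g. \<exists>h. (D, g) \<in> G \<longrightarrow> admissible V D E h \<and>
      (\<forall>d \<in> und V D. \<forall>b \<in> und V B. ev (tup [h d, b]) = f (g d) b)"
    by blast
  then obtain h where h: "\<And>D g. (D, g) \<in> G \<Longrightarrow> admissible V D E (h D g)"
    "\<And>D g d b. (D, g) \<in> G \<Longrightarrow> d \<in> und V D \<Longrightarrow> b \<in> und V B \<Longrightarrow> ev (tup [h D g d, b]) = f (g d) b"
    by metis
  have agree: "h D g x = h D' g' y"
    if D: "(D, g) \<in> G" "x \<in> und V D" and D': "(D', g') \<in> G" "y \<in> und V D'" and eq: "g x = g' y"
    for D g D' g' x y
  proof -
    \<comment> \<open>Finality for the empty sink makes \<open>pt\<close> discrete: every function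
      out of this point is admissible.\<close>
    define pt where "pt = final_structure V {x} {}"
    have pt: "pt \<in> objs V" "und V pt = {x}" "final_sink V pt {}"
      using final_structure[of "{x}" "{}"] small_finite[of "{x}"] by (auto simp: pt_def Fib_def)
    have pt_adm: "admissible V pt W k" if "W \<in> objs V" "k x \<in> und V W" for W k
      using final_sinkD[OF pt(3) that(1)] that(2) pt(2) by auto
    have DB: "admissible V (product V [pt, B]) (product V [D, B]) (\<lambda>z. tup [x, proj 1 z])"
    proof (rule admissible_pair)
      have "admissible V pt D (\<lambda>_. x)"
        using D mem admissible_objs by (intro pt_adm) blast+
      then show "admissible V (product V [pt, B]) D (\<lambda>_. x)"
        using admissible_comp[OF admissible_fst[OF pt(1) B]] by blast
    qed (rule admissible_snd[OF pt(1) B])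
    have "admissible V (product V [pt, B]) C (\<lambda>z. f (g x) (proj 1 z))"
      using admissible_comp[OF DB adm[OF D(1)]] by simp
    note ex1 = transpose[rule_format, OF pt(1) this, unfolded pt(2)]
    have unique: "k = k'" if "k \<in> extensional {x}" "k' \<in> extensional {x}" "k x \<in> und V E" "k' x \<in> und V E"
      "\<forall>b \<in> und V B. ev (tup [k x, b]) = f (g x) b" "\<forall>b \<in> und V B. ev (tup [k' x, b]) = f (g x) b"
      for k k'
    proof (rule alt_ex1E[OF ex1])
      fix l
      assume eq: "\<forall>l l'. (l \<in> extensional {x} \<and> admissible V pt E l \<and>
          (\<forall>d\<in>{x}. \<forall>b\<in>und V B. ev (tup [l d, b]) = f (g x) (proj 1 (tup [d, b])))) \<and>
        l' \<in> extensional {x} \<and> admissible V pt E l' \<and>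
          (\<forall>d\<in>{x}. \<forall>b\<in>und V B. ev (tup [l' d, b]) = f (g x) (proj 1 (tup [d, b]))) \<longrightarrow> l = l'"
      show "k = k'"
        using that pt_adm[OF E(1), of k] pt_adm[OF E(1), of k'] by (intro eq[rule_format]) simp
    qed
    have "(\<lambda>_\<in>{x}. h D g x) = (\<lambda>_\<in>{x}. h D' g' y)"
      using admissible_mem[OF h(1)] D D' h(2)[OF D] h(2)[OF D'] eq by (intro unique) auto
    then show ?thesis
      by (metis restrict_apply' singletonI)
  qed
  \<comment> \<open>The glued transpose. By \<open>agree\<close> its value does not depend on the
    chosen preimage of \<open>a\<close>, and joint surjectivity provides a preimage for every
    \<open>a\<close> in \<open>und V A\<close>.\<close>
  define k where "k a = (SOME e. \<exists>D g x. (D, g) \<in> G \<and> x \<in> und V D \<and> g x = a \<and> e = h D g x)" for a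
  have k: "k (g x) = h D g x" if "(D, g) \<in> G" "x \<in> und V D" for D g x
    unfolding k_def using that agree by (intro some_equality) blast+
  have "admissible V A E k"
  proof (rule final_sinkD[OF fin E(1)])
    show "k a \<in> und V E" if "a \<in> und V A" for a
      using surj[OF that] k admissible_mem[OF h(1)] by fastforce
    show "admissible V D E (\<lambda>x. k (g x))" if "(D, g) \<in> G" for D g
      using h(1)[OF that] by (rule admissible_mono) (simp add: k[OF that])
  qed
  then have "admissible V (product V [A, B]) E (\<lambda>z. k (proj 0 z))"
    using admissible_comp[OF admissible_fst[OF A B]] by blast
  from admissible_comp[OF admissible_pair[OF this admissible_snd[OF A B]] E(2)]
  show ?thesis
  proof (rule admissible_mono)
    fix z assume "z \<in> und V (product V [A, B])"
    then obtain a b where z: "z = tup [a, b]" "a \<in> und V A" "b \<in> und V B"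
      by (auto simp: und_pair[OF A B])
    then show "ev (tup [k (proj 0 z), proj 1 z]) = f (proj 0 z) (proj 1 z)"
      using surj[of a] k h(2) by fastforce
  qed
qed

text \<open>No factor has to be moved past another: the whole product \<open>?Q\<close> serves as
  the second factor in \<open>final_sink_times\<close>, applied to the function that overwrites one
  coordinate of a tuple. Precomposition with \<open>z \<mapsto> (proj ?n z, z)\<close> then
  overwrites the coordinate by itself.\<close>

lemma final_sink_coordinate:
  assumes sink: "surjective_final_sink A G" and pre: "set pre \<subseteq> objs V" and post: "set post \<subseteq> objs V"
    and C: "C \<in> objs V" and \<phi>: "\<And>xs. xs \<in> tuples (pre @ A # post) \<Longrightarrow> \<phi> xs \<in> und V C"
    and adm: "\<And>D g. (D, g) \<in> G \<Longrightarrow> admissible V (product V (pre @ D # post)) C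
      (\<lambda>z. \<phi> ((untup z)[length pre := g (proj (length pre) z)]))"
  shows "admissible V (product V (pre @ A # post)) C (\<lambda>z. \<phi> (untup z))"
proof -
  let ?n = "length pre"
  let ?Q = "product V (pre @ A # post)"
  define f where "f a z = \<phi> ((untup z)[?n := a])" for a z
  have A: "A \<in> objs V" and mem: "\<And>D g. (D, g) \<in> G \<Longrightarrow> admissible V D A g"
    using sink by (auto simp: surjective_final_sink_def)
  have objs: "set (pre @ A # post) \<subseteq> objs V"
    using A pre post by auto
  have Q: "?Q \<in> objs V"
    using objs by (rule product_objs)
  have "admissible V (product V [A, ?Q]) C (\<lambda>z. f (proj 0 z) (proj 1 z))"
  proof (rule final_sink_times[OF sink Q C])
    show "f a b \<in> und V C" if "a \<in> und V A" "b \<in> und V ?Q" for a b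
      using that by (auto simp: f_def und_product[OF objs] intro!: \<phi> tuples_append_Cons_update[of _ pre A post _ A])
    show "admissible V (product V [D, ?Q]) C (\<lambda>z. f (g (proj 0 z)) (proj 1 z))" if "(D, g) \<in> G" for D g
    proof -
      let ?k = "\<lambda>z. (untup (proj 1 z))[?n := proj 0 z]"
      have D: "D \<in> objs V"
        using mem[OF that] admissible_objs by blast
      have objsD: "set (pre @ D # post) \<subseteq> objs V"
        using D pre post by auto
      have und: "\<exists>d xs. z = tup [d, tup xs] \<and> xs \<in> tuples (pre @ A # post)"
        if "z \<in> und V (product V [D, ?Q])" for z
        using that by (auto simp: und_pair[OF D Q] und_product[OF objs])
      \<comment> \<open>Overwriting changes the type of a single factor: the entry in
        \<open>A\<close> is forgotten and the entry in \<open>D\<close> takes its place.\<close>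
      have "admissible V (product V [D, ?Q]) (product V (pre @ D # post)) (\<lambda>z. tup (?k z))"
      proof (rule admissible_tup[OF objsD])
        show "product V [D, ?Q] \<in> objs V"
          using D Q by (simp add: product_objs)
        show "length (?k z) = length (pre @ D # post)" if "z \<in> und V (product V [D, ?Q])" for z
          using und[OF that] by (auto simp: tuples_length)
        show "admissible V (product V [D, ?Q]) ((pre @ D # post) ! i) (\<lambda>z. ?k z ! i)"
          if i: "i < length (pre @ D # post)" for i
        proof (cases "i = ?n")
          case True
          have "proj 0 z = ?k z ! ?n" if "z \<in> und V (product V [D, ?Q])" for z
            using und[OF that] by (auto simp: tuples_length)
          then show ?thesis
            using admissible_mono[OF admissible_fst[OF D Q]] True by simp
        next
          case False
          then have "(pre @ D # post) ! i = (pre @ A # post) ! i"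
            by (simp add: nth_append nth_Cons')
          then show ?thesis
            using admissible_comp[OF admissible_snd[OF D Q] admissible_proj[OF objs, of i]] i False
            by (simp add: proj_def)
        qed
      qed
      from admissible_comp[OF this adm[OF that]] show ?thesis
        by (rule admissible_mono) (use und in \<open>force simp: f_def tuples_length\<close>)
    qed
  qed
  moreover have "admissible V ?Q (product V [A, ?Q]) (\<lambda>z. tup [proj ?n z, z])"
    using admissible_proj[OF objs, of ?n] Q by (intro admissible_pair admissible_id) auto
  ultimately have "admissible V ?Q C (\<lambda>z. f (proj ?n z) z)"
    using admissible_comp by fastforce
  then show ?thesis
    by (simp add: f_def proj_def)
qed

text \<open>Induction on the coordinates that still carry a sink. Once the first of them is replaced
  by a sink member \<open>D\<close>, it joins the prefix; hence both \<open>pre\<close> and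
  \<open>\<phi>\<close> must be arbitrary in the induction.\<close>

lemma final_sinks_product:
  assumes "list_all2 (\<lambda>G B. surjective_final_sink B G) Gs Bs" and "set pre \<subseteq> objs V"
    and "C \<in> objs V" and "\<And>xs. xs \<in> tuples (pre @ Bs) \<Longrightarrow> \<phi> xs \<in> und V C"
    and "\<And>cs. list_all2 (\<lambda>c G. c \<in> G) cs Gs \<Longrightarrow> admissible V (product V (pre @ map fst cs)) C
      (\<lambda>z. \<phi> (take (length pre) (untup z) @ map2 snd cs (drop (length pre) (untup z))))"
  shows "admissible V (product V (pre @ Bs)) C (\<lambda>z. \<phi> (untup z))"
  using assms
proof (induction Gs Bs arbitrary: pre \<phi> rule: list_all2_induct)
  case Nil
  have "admissible V (product V pre) C (\<lambda>z. \<phi> (take (length pre) (untup z)))"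
    using Nil(4)[of "[]"] by simp
  then have "admissible V (product V pre) C (\<lambda>z. \<phi> (untup z))"
    by (rule admissible_mono) (use Nil in \<open>auto simp: und_product tuples_length\<close>)
  then show ?case
    by simp
next
  case (Cons G Gs B Bs)
  have B: "set Bs \<subseteq> objs V"
    using Cons(2) by (auto simp: list_all2_conv_all_nth in_set_conv_nth surjective_final_sink_def)
  have mem: "\<And>D g. (D, g) \<in> G \<Longrightarrow> admissible V D B g"
    using Cons(1) by (auto simp: surjective_final_sink_def)
  show ?case
  proof (rule final_sink_coordinate[OF Cons(1) Cons(4) B Cons(5)])
    fix D g assume D: "(D, g) \<in> G"
    let ?n = "length pre"
    \<comment> \<open>Absorbing \<open>g\<close> into the function lets the induction hypothesis
      treat \<open>D\<close> as an ordinary fixed factor.\<close>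
    define \<psi> where "\<psi> xs = \<phi> (xs[?n := g (xs ! ?n)])" for xs
    have Dobj: "D \<in> objs V"
      using mem[OF D] admissible_objs by blast
    have "admissible V (product V ((pre @ [D]) @ Bs)) C (\<lambda>z. \<psi> (untup z))"
    proof (rule Cons(3))
      show "set (pre @ [D]) \<subseteq> objs V"
        using Cons(4) Dobj by auto
      show "\<psi> xs \<in> und V C" if "xs \<in> tuples ((pre @ [D]) @ Bs)" for xs
      proof -
        have xs: "xs \<in> tuples (pre @ D # Bs)"
          using that by simp
        have "g (xs ! ?n) \<in> und V B"
          using admissible_mem[OF mem[OF D]] tuples_nth[OF xs, of ?n] by simp
        with xs show ?thesis
          unfolding \<psi>_def by (intro Cons(6) tuples_append_Cons_update)
      qed
      fix cs assume cs: "list_all2 (\<lambda>c G. c \<in> G) cs Gs"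
      have "set (map fst cs) \<subseteq> objs V"
      proof -
        have "fst c \<in> objs V" if c: "c \<in> set cs" for c
        proof -
          obtain i where i: "i < length cs" "c = cs ! i"
            using c by (auto simp: in_set_conv_nth)
          then have "c \<in> Gs ! i" "surjective_final_sink (Bs ! i) (Gs ! i)"
            using cs Cons(2) by (auto simp: list_all2_conv_all_nth)
          then show ?thesis
            using admissible_objs by (fastforce simp: surjective_final_sink_def)
        qed
        then show ?thesis
          by auto
      qed
      then have objs: "set (pre @ D # map fst cs) \<subseteq> objs V"
        using Cons(4) Dobj by auto
      have "admissible V (product V (pre @ D # map fst cs)) C
        (\<lambda>z. \<phi> (take ?n (untup z) @ map2 snd ((D, g) # cs) (drop ?n (untup z))))"
        using Cons(7)[of "(D, g) # cs"] cs D by simp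
      then have "admissible V (product V (pre @ D # map fst cs)) C
        (\<lambda>z. \<psi> (take (Suc ?n) (untup z) @ map2 snd cs (drop (Suc ?n) (untup z))))"
      proof (rule admissible_mono)
        fix z assume "z \<in> und V (product V (pre @ D # map fst cs))"
        then obtain u where u: "z = tup u" "u \<in> tuples (pre @ D # map fst cs)"
          by (auto simp: und_product[OF objs])
        then have "?n < length u"
          by (simp add: tuples_length)
        then obtain us y vs where "u = us @ y # vs" "length us = ?n"
          by (metis id_take_nth_drop length_take less_imp_le min.absorb2)
        then show "\<phi> (take ?n (untup z) @ map2 snd ((D, g) # cs) (drop ?n (untup z))) =
            \<psi> (take (Suc ?n) (untup z) @ map2 snd cs (drop (Suc ?n) (untup z)))"
          by (simp add: \<psi>_def u(1) list_update_append nth_append)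
      qed
      then show "admissible V (product V ((pre @ [D]) @ map fst cs)) C
        (\<lambda>z. \<psi> (take (length (pre @ [D])) (untup z) @ map2 snd cs (drop (length (pre @ [D])) (untup z))))"
        by simp
    qed fact
    then show "admissible V (product V (pre @ D # Bs)) C (\<lambda>z. \<phi> ((untup z)[?n := g (proj ?n z)]))"
      by (simp add: \<psi>_def proj_def)
  qed (use Cons(6) in auto)
qed

text \<open>The parameter object is the initial prefix and so is never replaced. The list
  \<open>cs\<close> may pick unrelated sink members for different arguments, even for arguments of
  the same sort.\<close>

lemma final_sinks_dom_obj:
  assumes P: "P \<in> objs V" and C: "C \<in> objs V"
    and sinks: "\<And>S. S \<in> set Ss \<Longrightarrow> surjective_final_sink (B S) (G S)"
    and mem: "\<And>p as. p \<in> und V P \<Longrightarrow> in_args (\<lambda>S. und V (B S)) Ss as \<Longrightarrow> f (arg p as) \<in> und V C"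
    and adm: "\<And>cs. list_all2 (\<lambda>c S. c \<in> G S) cs Ss \<Longrightarrow> admissible V (product V (P # map fst cs)) C
      (\<lambda>z. f (arg (proj 0 z) (map2 snd cs (tl (untup z)))))"
  shows "admissible V (dom_obj V P Ss B) C f"
proof -
  have B: "B S \<in> objs V" if "S \<in> set Ss" for S
    using sinks[OF that] by (simp add: surjective_final_sink_def)
  have "admissible V (product V ([P] @ map B Ss)) C (\<lambda>z. f (arg (untup z ! 0) (tl (untup z))))"
  proof (rule final_sinks_product[where Gs = "map G Ss"])
    show "list_all2 (\<lambda>G B. surjective_final_sink B G) (map G Ss) (map B Ss)"
      using sinks by (simp add: list.rel_map list_all2_same)
    show "f (arg (xs ! 0) (tl xs)) \<in> und V C" if "xs \<in> tuples ([P] @ map B Ss)" for xs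
      using that by (cases xs) (auto simp: tuples_def in_args_def list.rel_map intro!: mem)
    fix cs assume cs: "list_all2 (\<lambda>c G. c \<in> G) cs (map G Ss)"
    have objs: "set (P # map fst cs) \<subseteq> objs V"
    proof -
      have "fst c \<in> objs V" if c: "c \<in> set cs" for c
      proof -
        obtain i where "i < length Ss" "c = cs ! i" "cs ! i \<in> G (Ss ! i)"
          using c cs by (auto simp: list_all2_conv_all_nth in_set_conv_nth)
        then show ?thesis
          using admissible_objs sinks[of "Ss ! i"] by (fastforce simp: surjective_final_sink_def)
      qed
      with P show ?thesis
        by auto
    qed
    from cs have "list_all2 (\<lambda>c S. c \<in> G S) cs Ss"
      by (simp add: list.rel_map)
    from adm[OF this] show "admissible V (product V ([P] @ map fst cs)) C
      (\<lambda>z. f (arg ((take (length [P]) (untup z) @ map2 snd cs (drop (length [P]) (untup z))) ! 0)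
        (tl (take (length [P]) (untup z) @ map2 snd cs (drop (length [P]) (untup z))))))"
    proof (simp, elim admissible_mono)
      fix z assume "z \<in> und V (product V (P # map fst cs))"
      then obtain x xs where "z = tup (x # xs)"
        by (auto simp: und_product[OF objs] tuples_def list_all2_Cons2)
      then show "f (arg (proj 0 z) (map2 snd cs (tl (untup z)))) =
        f (arg ((take (Suc 0) (untup z) @ map2 snd cs (drop (Suc 0) (untup z))) ! 0)
          (tl (take (Suc 0) (untup z) @ map2 snd cs (drop (Suc 0) (untup z)))))"
        by simp
    qed
  qed (use P C in auto)
  then show ?thesis
    using admissible_dom_obj_iff[OF P B] by (simp add: proj_def)
qed

text \<open>Sinks with one member leave a single choice \<open>cs\<close>, so it is enough to test
  \<open>f\<close> after applying \<open>q\<close> to all arguments simultaneously.\<close>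

lemma final_dom_obj_quotient:
  assumes P: "P \<in> objs V" and C: "C \<in> objs V"
    and sinks: "\<And>S. S \<in> set Ss \<Longrightarrow> surjective_final_sink (B S) {(A S, q S)}"
    and mem: "\<And>p as. p \<in> und V P \<Longrightarrow> in_args (\<lambda>S. und V (B S)) Ss as \<Longrightarrow> f (arg p as) \<in> und V C"
    and adm: "admissible V (dom_obj V P Ss A) C (\<lambda>x. f (arg (arg_par x) (map2 q Ss (arg_list x))))"
  shows "admissible V (dom_obj V P Ss B) C f"
proof (rule final_sinks_dom_obj[where f = f and B = B and G = "\<lambda>S. {(A S, q S)}", OF P C sinks mem])
  fix cs assume "list_all2 (\<lambda>c S. c \<in> {(A S, q S)}) cs Ss"
  then have cs: "cs = map (\<lambda>S. (A S, q S)) Ss"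
    by (auto simp: list_all2_conv_all_nth intro: nth_equalityI)
  have A: "A S \<in> objs V" if "S \<in> set Ss" for S
    using sinks[OF that] admissible_objs by (auto simp: surjective_final_sink_def)
  have "map2 snd cs as = map2 q Ss as" for as
    by (simp add: cs zip_map1 case_prod_unfold)
  then show "admissible V (product V (P # map fst cs)) C
      (\<lambda>z. f (arg (proj 0 z) (map2 snd cs (tl (untup z)))))"
    using adm admissible_dom_obj_iff[OF P A] by (simp add: cs o_def)
qed

text \<open>A choice of sink members puts the arguments on different levels \<open>ns i\<close>.
  There are finitely many arguments, so one level \<open>N\<close> bounds them all, and the identity
  functions of the chain carry the mixed product into the product at level \<open>N\<close>, where
  \<open>adm\<close> applies.\<close>

lemma final_dom_obj_chain:
  assumes P: "P \<in> objs V" and C: "C \<in> objs V"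
    and sinks: "\<And>S. S \<in> set Ss \<Longrightarrow> surjective_final_sink (B S) {(A n S, \<lambda>x. x) | n. True}"
    and chain: "\<And>S m n. S \<in> set Ss \<Longrightarrow> m \<le> n \<Longrightarrow> admissible V (A m S) (A n S) (\<lambda>x. x)"
    and mem: "\<And>p as. p \<in> und V P \<Longrightarrow> in_args (\<lambda>S. und V (B S)) Ss as \<Longrightarrow> f (arg p as) \<in> und V C"
    and adm: "\<And>n :: nat. admissible V (dom_obj V P Ss (A n)) C f"
  shows "admissible V (dom_obj V P Ss B) C f"
proof (rule final_sinks_dom_obj[where f = f and B = B and G = "\<lambda>S. {(A n S, \<lambda>x. x) | n. True}", OF P C sinks mem])
  fix cs :: "('o \<times> ('u \<Rightarrow> 'u)) list"
  assume cs: "list_all2 (\<lambda>c S. c \<in> {(A n S, \<lambda>x. x) | n. True}) cs Ss"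
  then have "\<forall>i. \<exists>n. i < length Ss \<longrightarrow> cs ! i = (A n (Ss ! i), \<lambda>x. x)"
    by (auto simp: list_all2_conv_all_nth)
  then obtain ns where ns: "\<And>i. i < length Ss \<Longrightarrow> cs ! i = (A (ns i) (Ss ! i), \<lambda>x. x)"
    by metis
  have len: "length cs = length Ss"
    using cs by (rule list_all2_lengthD)
  obtain N where N: "\<And>i. i < length Ss \<Longrightarrow> ns i \<le> N"
    using finite_nat_set_iff_bounded_le[of "ns ` {..<length Ss}"] by auto
  have A: "A n S \<in> objs V" if "S \<in> set Ss" for n S
    using chain[OF that order_refl] admissible_objs by blast
  then have objsN: "set (P # map (A N) Ss) \<subseteq> objs V"
    using P by auto
  have objs: "set (P # map fst cs) \<subseteq> objs V"
    using P ns len A by (force simp: in_set_conv_nth)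
  have und: "\<exists>x xs. z = tup (x # xs) \<and> length xs = length Ss"
    if "z \<in> und V (product V (P # map fst cs))" for z
    using that len
    by (auto simp: und_product[OF objs] tuples_def list_all2_Cons2 dest: list_all2_lengthD)
  have "admissible V (product V (P # map fst cs)) (product V (P # map (A N) Ss)) (\<lambda>z. tup (untup z))"
  proof (rule admissible_tup[OF objsN product_objs[OF objs]])
    show "length (untup z) = length (P # map (A N) Ss)" if "z \<in> und V (product V (P # map fst cs))" for z
      using und[OF that] by auto
    fix i assume i: "i < length (P # map (A N) Ss)"
    have "admissible V ((P # map fst cs) ! i) ((P # map (A N) Ss) ! i) (\<lambda>x. x)"
      using i ns N chain admissible_id[OF P] len by (cases i) auto
    from admissible_comp[OF admissible_proj[OF objs, of i] this] i len
    show "admissible V (product V (P # map fst cs)) ((P # map (A N) Ss) ! i) (\<lambda>z. untup z ! i)"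
      by (simp add: proj_def)
  qed
  moreover have "admissible V (product V (P # map (A N) Ss)) C (\<lambda>z. f (arg (proj 0 z) (tl (untup z))))"
    using adm[of N] admissible_dom_obj_iff[OF P A] by simp
  ultimately have "admissible V (product V (P # map fst cs)) C
      (\<lambda>z. f (arg (proj 0 (tup (untup z))) (tl (untup (tup (untup z))))))"
    by (rule admissible_comp)
  then show "admissible V (product V (P # map fst cs)) C
      (\<lambda>z. f (arg (proj 0 z) (map2 snd cs (tl (untup z)))))"
  proof (rule admissible_mono)
    fix z assume "z \<in> und V (product V (P # map fst cs))"
    then obtain x xs where z: "z = tup (x # xs)" "length xs = length Ss"
      using und by blast
    then have "map2 snd cs xs = xs"
      using ns len by (intro nth_equalityI) auto
    then show "f (arg (proj 0 (tup (untup z))) (tl (untup (tup (untup z))))) =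
        f (arg (proj 0 z) (map2 snd cs (tl (untup z))))"
      by (simp add: z)
  qed
qed

end

section \<open>Classical algebras and terms\<close>

text \<open>Only compatibility with the operations is recorded. That carriers are mapped into
  carriers is a separate matter, supplied by admissibility for maps of enriched algebras.\<close>

definition calg_hom ::
  "('f, 'u) csig \<Rightarrow> ('f, 'u) calg \<Rightarrow> ('f, 'u) calg \<Rightarrow> ('u \<Rightarrow> 'u \<Rightarrow> 'u) \<Rightarrow> bool" where
  "calg_hom C D D' f \<longleftrightarrow> (\<forall>\<tau> \<in> csyms C. \<forall>as. in_args (ccar D) (cins C \<tau>) as \<longrightarrow>
     f (cout C \<tau>) (cop D \<tau> as) = cop D' \<tau> (map2 f (cins C \<tau>) as))"

definition calg_closed :: "('f, 'u) csig \<Rightarrow> ('f, 'u) calg \<Rightarrow> bool" where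
  "calg_closed C D \<longleftrightarrow> (\<forall>\<tau> \<in> csyms C. \<forall>as. in_args (ccar D) (cins C \<tau>) as \<longrightarrow>
     cop D \<tau> as \<in> ccar D (cout C \<tau>))"

lemma calg_homD:
  "calg_hom C D D' f \<Longrightarrow> \<tau> \<in> csyms C \<Longrightarrow> in_args (ccar D) (cins C \<tau>) as \<Longrightarrow>
    f (cout C \<tau>) (cop D \<tau> as) = cop D' \<tau> (map2 f (cins C \<tau>) as)"
  by (simp add: calg_hom_def)

lemma calg_closedD:
  "calg_closed C D \<Longrightarrow> \<tau> \<in> csyms C \<Longrightarrow> in_args (ccar D) (cins C \<tau>) as \<Longrightarrow>
    cop D \<tau> as \<in> ccar D (cout C \<tau>)"
  by (simp add: calg_closed_def)

lemma in_args_length: "in_args Y Ss as \<Longrightarrow> length as = length Ss"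
  by (simp add: in_args_def list_all2_lengthD)

lemma in_args_nth: "in_args Y Ss as \<Longrightarrow> i < length Ss \<Longrightarrow> as ! i \<in> Y (Ss ! i)"
  by (simp add: in_args_def list_all2_conv_all_nth)

lemma in_argsI:
  "length as = length Ss \<Longrightarrow> (\<And>i. i < length Ss \<Longrightarrow> as ! i \<in> Y (Ss ! i)) \<Longrightarrow> in_args Y Ss as"
  by (simp add: in_args_def list_all2_conv_all_nth)

lemma in_args_map2:
  "in_args Y Ss as \<Longrightarrow> (\<And>S a. S \<in> set Ss \<Longrightarrow> a \<in> Y S \<Longrightarrow> f S a \<in> Z S) \<Longrightarrow> in_args Z Ss (map2 f Ss as)"
  by (simp add: in_args_def list_all2_conv_all_nth)

lemma in_args_mono:
  "in_args Y Ss as \<Longrightarrow> (\<And>S. S \<in> set Ss \<Longrightarrow> Y S \<subseteq> Z S) \<Longrightarrow> in_args Z Ss as"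
  by (meson in_argsI in_args_length in_args_nth nth_mem subsetD)

lemma map2_snd: "length xs = length ys \<Longrightarrow> map2 (\<lambda>x y. f y) xs ys = map f ys"
  by (induction xs ys rule: list_induct2) simp_all

lemma map2_map2: "map2 f xs (map2 g xs ys) = map2 (\<lambda>x y. f x (g x y)) xs ys"
  by (induction xs ys rule: list_induct2') simp_all

section \<open>Interpretation of terms in context\<close>

lemma interp_Cst_nth:
  assumes "distinct (map fst \<Gamma>)" "length as = length \<Gamma>" "i < length \<Gamma>"
  shows "interp D \<Gamma> (Cst (fst (\<Gamma> ! i))) as = as ! i"
  using map_of_zip_nth[of "map fst \<Gamma>" as i] assms by simp

lemma interp_closed:
  assumes D: "calg_closed C D" and \<Gamma>: "distinct (map fst \<Gamma>)"
    and as: "in_args (ccar D) (map snd \<Gamma>) as"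
    and t: "has_sort C (ctx_vars \<Gamma>) t S"
  shows "interp D \<Gamma> t as \<in> ccar D S"
  using t
proof (induction rule: has_sort.induct)
  case (Cst v S)
  then obtain i where "i < length \<Gamma>" "\<Gamma> ! i = (v, S)"
    by (auto simp: ctx_vars_def in_set_conv_nth)
  then show ?case
    using interp_Cst_nth[OF \<Gamma>, of as i D] in_args_length[OF as] in_args_nth[OF as, of i]
    by (simp del: interp.simps)
next
  case (App \<tau> ts)
  then have "in_args (ccar D) (cins C \<tau>) (map (\<lambda>t. interp D \<Gamma> t as) ts)"
    by (auto simp: in_args_def list.rel_map elim: list_all2_mono)
  then show ?case
    using D App(1) by (simp add: calg_closed_def)
qed

text \<open>Closedness of \<open>D\<close> enters because \<open>calg_hom\<close> speaks only about
  arguments in the carriers, so interpretations of subterms must be known to lie there.\<close>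

lemma interp_hom:
  assumes hom: "calg_hom C D D' f" and D: "calg_closed C D" and \<Gamma>: "distinct (map fst \<Gamma>)"
    and as: "in_args (ccar D) (map snd \<Gamma>) as"
    and t: "has_sort C (ctx_vars \<Gamma>) t S"
  shows "interp D' \<Gamma> t (map2 f (map snd \<Gamma>) as) = f S (interp D \<Gamma> t as)"
  using t
proof (induction rule: has_sort.induct)
  case (Cst v S)
  then obtain i where "i < length \<Gamma>" "\<Gamma> ! i = (v, S)"
    by (auto simp: ctx_vars_def in_set_conv_nth)
  then show ?case
    using interp_Cst_nth[OF \<Gamma>, of as i D] in_args_length[OF as]
      interp_Cst_nth[OF \<Gamma>, of "map2 f (map snd \<Gamma>) as" i D']
    by (simp del: interp.simps)
next
  case (App \<tau> ts)
  let ?bs = "map (\<lambda>t. interp D \<Gamma> t as) ts"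
  have bs: "in_args (ccar D) (cins C \<tau>) ?bs"
    using App(2) interp_closed[OF D \<Gamma> as]
    by (auto simp: in_args_def list.rel_map elim: list_all2_mono)
  have "map (\<lambda>t. interp D' \<Gamma> t (map2 f (map snd \<Gamma>) as)) ts = map2 f (cins C \<tau>) ?bs"
    using App(2) by (intro nth_equalityI) (auto simp: list_all2_conv_all_nth)
  then show ?case
    using calg_homD[OF hom App(1) bs] by simp
qed

text \<open>Evaluation takes the sort as an argument because the constants of different sorts may overlap.\<close>

primrec evaluate ::
  "('f, 'u) csig \<Rightarrow> ('f, 'u) calg \<Rightarrow> ('u \<Rightarrow> 'c \<Rightarrow> 'u) \<Rightarrow> ('f, 'c) trm \<Rightarrow> 'u \<Rightarrow> 'u" where
  "evaluate C D g (Cst x) = (\<lambda>S. g S x)"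
| "evaluate C D g (App \<tau> ts) =
     (\<lambda>S. cop D \<tau> (map2 (\<lambda>S h. h S) (cins C \<tau>) (map (evaluate C D g) ts)))"

text \<open>Both codings apply the same choice to the same equivalence class, so the quotient set
  consists exactly of the chosen representatives.\<close>

lemma quotient_set_eq: "quotient_set A r = class_of r ` A"
proof -
  have "A // r = (\<lambda>x. r `` {x}) ` A"
    by (auto simp: quotient_def)
  then show ?thesis
    by (simp add: quotient_set_def class_of_def image_image)
qed

lemma class_of_related: "equiv A r \<Longrightarrow> x \<in> A \<Longrightarrow> (x, class_of r x) \<in> r"
  unfolding class_of_def using someI[of "\<lambda>y. y \<in> r `` {x}" x] by (auto simp: equiv_def refl_on_def)

lemma class_of_eq_iff: "equiv A r \<Longrightarrow> x \<in> A \<Longrightarrow> y \<in> A \<Longrightarrow> class_of r x = class_of r y \<longleftrightarrow> (x, y) \<in> r"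
  using class_of_related[of A r x] class_of_related[of A r y]
  by (metis class_of_def equiv_class_eq equiv_def symE transE)

lemma class_of_mem: "equiv A r \<Longrightarrow> x \<in> A \<Longrightarrow> class_of r x \<in> A"
  using class_of_related[of A r x] by (metis equiv_class_eq_iff)

section \<open>Generated congruences\<close>

definition respects_equations ::
  "'u set \<Rightarrow> ('f, 'u) csig \<Rightarrow> ('f, 'u) ceqn set \<Rightarrow> ('f, 'u) calg \<Rightarrow> ('u \<Rightarrow> ('u \<times> 'u) set) \<Rightarrow> bool"
  where
  "respects_equations \<S> C Q D R \<longleftrightarrow> is_congruence \<S> C D R \<and>
     (\<forall>(\<Gamma>, T, s, t) \<in> Q. \<forall>as. in_args (ccar D) (map snd \<Gamma>) as \<longrightarrow>
        (interp D \<Gamma> s as, interp D \<Gamma> t as) \<in> R T)"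

lemma generated_congruence_eq:
  "generated_congruence \<S> C Q D S = \<Inter> {R S | R. respects_equations \<S> C Q D R}"
  by (simp add: generated_congruence_def respects_equations_def)

lemma generated_congruence_least:
  "respects_equations \<S> C Q D R \<Longrightarrow> generated_congruence \<S> C Q D S \<subseteq> R S"
  unfolding generated_congruence_eq by blast

locale classical_theory =
  fixes \<S> :: "'u set" and C :: "('f, 'u) csig" and Q :: "('f, 'u) ceqn set"
  assumes cins_sorts: "\<tau> \<in> csyms C \<Longrightarrow> set (cins C \<tau>) \<subseteq> \<S>"
    and cout_sort: "\<tau> \<in> csyms C \<Longrightarrow> cout C \<tau> \<in> \<S>"
    and eqn_sorts: "(\<Gamma>, T, s, t) \<in> Q \<Longrightarrow> T \<in> \<S> \<and> snd ` set \<Gamma> \<subseteq> \<S>"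
    and eqn_ctx: "(\<Gamma>, T, s, t) \<in> Q \<Longrightarrow> distinct (map fst \<Gamma>)"
    and eqn_terms: "(\<Gamma>, T, s, t) \<in> Q \<Longrightarrow>
      has_sort C (ctx_vars \<Gamma>) s T \<and> has_sort C (ctx_vars \<Gamma>) t T"
begin

lemma calg_eq_sym:
  assumes "calg_eq \<S> C D D'"
  shows "calg_eq \<S> C D' D"
proof -
  have "in_args (ccar D') (cins C \<tau>) as \<longleftrightarrow> in_args (ccar D) (cins C \<tau>) as" if "\<tau> \<in> csyms C" for \<tau> as
    using assms cins_sorts[OF that]
    by (auto simp: calg_eq_def intro: in_args_mono)
  then show ?thesis
    using assms by (simp add: calg_eq_def)
qed

lemma calg_eq_hom: "calg_eq \<S> C D D' \<Longrightarrow> calg_hom C D D' (\<lambda>S x. x)"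
  by (auto simp: calg_hom_def calg_eq_def map2_snd[of _ _ "\<lambda>x. x"] in_args_length)

text \<open>Shows that the intersection defining the generated congruence is taken over a nonempty
  family and is therefore contained in the square of the carrier.\<close>

lemma respects_equations_total:
  assumes "calg_closed C D"
  shows "respects_equations \<S> C Q D (\<lambda>S. ccar D S \<times> ccar D S)"
  unfolding respects_equations_def
proof (intro conjI)
  show "is_congruence \<S> C D (\<lambda>S. ccar D S \<times> ccar D S)"
    using assms unfolding is_congruence_def
    by (auto simp: calg_closed_def equiv_def refl_on_def sym_def trans_def intro!: in_argsI)
  show "\<forall>(\<Gamma>, T, s, t) \<in> Q. \<forall>as. in_args (ccar D) (map snd \<Gamma>) as \<longrightarrow>
      (interp D \<Gamma> s as, interp D \<Gamma> t as) \<in> ccar D T \<times> ccar D T"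
    using interp_closed[OF assms] eqn_ctx eqn_terms by blast
qed

lemma generated_congruence_respects:
  assumes "calg_closed C D"
  shows "respects_equations \<S> C Q D (generated_congruence \<S> C Q D)"
proof -
  let ?G = "generated_congruence \<S> C Q D"
  have mem: "(a, b) \<in> ?G S \<longleftrightarrow> (\<forall>R. respects_equations \<S> C Q D R \<longrightarrow> (a, b) \<in> R S)" for a b S
    unfolding generated_congruence_eq by blast
  have "equiv (ccar D S) (?G S)" if S: "S \<in> \<S>" for S
  proof -
    have eq: "equiv (ccar D S) (R S)" if "respects_equations \<S> C Q D R" for R
      using that S by (simp add: respects_equations_def is_congruence_def)
    have "?G S \<subseteq> ccar D S \<times> ccar D S"
      using generated_congruence_least[OF respects_equations_total[OF assms]] .
    moreover have "(a, a) \<in> ?G S" if "a \<in> ccar D S" for a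
      unfolding mem using eq that by (simp add: equiv_def refl_on_def)
    moreover have "(b, a) \<in> ?G S" if "(a, b) \<in> ?G S" for a b
      using that eq unfolding mem equiv_def by (blast dest: symD)
    moreover have "(a, c) \<in> ?G S" if ab: "(a, b) \<in> ?G S" and bc: "(b, c) \<in> ?G S" for a b c
      unfolding mem
    proof (intro allI impI)
      fix R assume R: "respects_equations \<S> C Q D R"
      then have "(a, b) \<in> R S" "(b, c) \<in> R S"
        using ab bc unfolding mem by simp_all
      then show "(a, c) \<in> R S"
        using eq[OF R] unfolding equiv_def by (blast dest: transD)
    qed
    ultimately show ?thesis
      unfolding equiv_def refl_on_def sym_def trans_def by blast
  qed
  moreover have "(cop D \<tau> as, cop D \<tau> bs) \<in> ?G (cout C \<tau>)"
    if prems: "\<tau> \<in> csyms C" "length as = length (cins C \<tau>)" "length bs = length (cins C \<tau>)"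
      "\<forall>i < length (cins C \<tau>). (as ! i, bs ! i) \<in> ?G (cins C \<tau> ! i)" for \<tau> as bs
  proof -
    have "(cop D \<tau> as, cop D \<tau> bs) \<in> R (cout C \<tau>)" if R: "respects_equations \<S> C Q D R" for R
    proof -
      have "\<forall>i < length (cins C \<tau>). (as ! i, bs ! i) \<in> R (cins C \<tau> ! i)"
        using prems(4) R unfolding mem by blast
      then show ?thesis
        using R prems(1-3) by (simp add: respects_equations_def is_congruence_def)
    qed
    then show ?thesis
      unfolding mem by blast
  qed
  moreover have "(interp D \<Gamma> s as, interp D \<Gamma> t as) \<in> ?G T"
    if "(\<Gamma>, T, s, t) \<in> Q" "in_args (ccar D) (map snd \<Gamma>) as" for \<Gamma> T s t as
    using that unfolding mem respects_equations_def by blast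
  ultimately show ?thesis
    by (auto simp: respects_equations_def is_congruence_def)
qed

text \<open>The congruence condition ranges over all lists, whereas \<open>calg_eq\<close> compares
  operations only on the carriers. Related elements lie in the carriers because each
  \<open>R S\<close> is an equivalence relation there. Interpretations agree because the identity is
  a homomorphism from \<open>D\<close> to \<open>D'\<close>.\<close>

lemma respects_equations_cong:
  assumes eq: "calg_eq \<S> C D D'" and closed: "calg_closed C D"
    and R: "respects_equations \<S> C Q D R"
  shows "respects_equations \<S> C Q D' R"
proof -
  have car: "ccar D' S = ccar D S" if "S \<in> \<S>" for S
    using eq that by (simp add: calg_eq_def)
  have equiv: "equiv (ccar D S) (R S)" if "S \<in> \<S>" for S
    using R that by (simp add: respects_equations_def is_congruence_def)
  have "(cop D' \<tau> as, cop D' \<tau> bs) \<in> R (cout C \<tau>)"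
    if \<tau>: "\<tau> \<in> csyms C" and len: "length as = length (cins C \<tau>)" "length bs = length (cins C \<tau>)"
      and rel: "\<forall>i < length (cins C \<tau>). (as ! i, bs ! i) \<in> R (cins C \<tau> ! i)" for \<tau> as bs
  proof -
    have "as ! i \<in> ccar D (cins C \<tau> ! i) \<and> bs ! i \<in> ccar D (cins C \<tau> ! i)" if "i < length (cins C \<tau>)" for i
      using equiv[of "cins C \<tau> ! i"] cins_sorts[OF \<tau>] rel that
      by (meson equiv_class_eq_iff nth_mem subsetD)
    then have "in_args (ccar D) (cins C \<tau>) as" "in_args (ccar D) (cins C \<tau>) bs"
      using len by (auto intro: in_argsI)
    then have "cop D' \<tau> as = cop D \<tau> as" "cop D' \<tau> bs = cop D \<tau> bs"
      using eq \<tau> by (simp_all add: calg_eq_def)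
    then show ?thesis
      using R \<tau> len rel by (simp add: respects_equations_def is_congruence_def)
  qed
  moreover have "(interp D' \<Gamma> s as, interp D' \<Gamma> t as) \<in> R T"
    if Q: "(\<Gamma>, T, s, t) \<in> Q" and as: "in_args (ccar D') (map snd \<Gamma>) as" for \<Gamma> T s t as
  proof -
    have as': "in_args (ccar D) (map snd \<Gamma>) as"
      using as by (rule in_args_mono) (use eqn_sorts[OF Q] car in force)
    have "map2 (\<lambda>S x. x) (map snd \<Gamma>) as = as"
      using in_args_length[OF as] by (simp add: map2_snd[of _ _ "\<lambda>x. x"])
    then have "interp D' \<Gamma> u as = interp D \<Gamma> u as" if "has_sort C (ctx_vars \<Gamma>) u T" for u
      using interp_hom[OF calg_eq_hom[OF eq] closed eqn_ctx[OF Q] as' that] by simp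
    then show ?thesis
      using eqn_terms[OF Q] R Q as' by (fastforce simp: respects_equations_def)
  qed
  ultimately show ?thesis
    using equiv car by (auto simp: respects_equations_def is_congruence_def)
qed

lemma generated_congruence_cong:
  assumes "calg_eq \<S> C D D'" "calg_closed C D" "calg_closed C D'"
  shows "generated_congruence \<S> C Q D S = generated_congruence \<S> C Q D' S"
  unfolding generated_congruence_eq
  using respects_equations_cong[OF assms(1,2)] respects_equations_cong[OF calg_eq_sym[OF assms(1)] assms(3)]
  by blast

end

section \<open>Coded terms and contexts\<close>

context topological_universe
begin

text \<open>Constants are coded by tuples of length one and applications by tuples of length three,
  so lengths separate the constructors and injectivity of \<open>tup\<close> recovers the
  parts.\<close>

lemma enc_eq_iff [simp]: "enc t = (enc t' :: 'u) \<longleftrightarrow> t = t'"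
proof
  show "enc t = (enc t' :: 'u) \<Longrightarrow> t = t'"
  proof (induction t arbitrary: t')
    case (Cst x)
    then show ?case by (cases t') simp_all
  next
    case (App \<tau> ts)
    then obtain \<tau>' ts' where "t' = App \<tau>' ts'"
      by (cases t') simp_all
    note t' = this
    have "\<tau> = \<tau>'" "map enc ts = map enc ts'"
      using App.prems by (simp_all add: t' prod_eq_iff)
    moreover from App.IH list.inj_map_strong[OF _ this(2)] have "ts = ts'"
      by blast
    ultimately show ?case
      by (simp add: t')
  qed
qed simp

declare enc.simps [simp del]

lemma dec_enc [simp]: "dec (enc t :: 'u) = t"
  unfolding dec_def by (intro inv_f_f injI) simp

lemma term_alg_simps [simp]:
  "ccar (term_alg C Y) S = (enc ` {t. has_sort C Y t S} :: 'u set)"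
  "cop (term_alg C Y) \<tau> ds = (enc (App \<tau> (map dec ds)) :: 'u)"
  by (simp_all add: term_alg_def)

lemma term_alg_closed: "calg_closed C (term_alg C Y :: ('u \<times> 'u, 'u) calg)"
  unfolding calg_closed_def
proof (intro ballI allI impI)
  fix \<tau> as assume \<tau>: "\<tau> \<in> csyms C" and "in_args (ccar (term_alg C Y)) (cins C \<tau>) as"
  then have "list_all2 (has_sort C Y) (map dec as) (cins C \<tau>)"
    by (auto simp: in_args_def list.rel_map elim: list_all2_mono)
  then show "cop (term_alg C Y) \<tau> as \<in> ccar (term_alg C Y) (cout C \<tau>)"
    using \<tau> by (auto intro: has_sort.App)
qed

lemma evaluate_hom: "calg_hom C (term_alg C Y) D (\<lambda>S d. evaluate C D g (dec d) S)" for D :: "('u \<times> 'u, 'u) calg"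
  by (simp add: calg_hom_def zip_map2 case_prod_unfold o_def)

text \<open>The sets of variables of different sorts are disjoint, so a context is determined by its
  variable names.\<close>

lemma is_context_distinct:
  assumes "is_context \<S> (\<Gamma> :: ('u \<times> 'u) list)"
  shows "distinct (map fst \<Gamma>)"
proof -
  have disjoint: "S = S'" if "(v :: 'u) \<in> Var S" "v \<in> Var S'" for v S S'
    using that by (auto simp: Var_def)
  have "inj_on fst (set \<Gamma>)"
  proof (rule inj_onI)
    fix x y assume xy: "x \<in> set \<Gamma>" "y \<in> set \<Gamma>" "fst x = fst y"
    then have "fst x \<in> Var (snd x)" "fst x \<in> Var (snd y)"
      using assms by (auto simp: is_context_def)
    with disjoint xy(3) show "x = y"
      by (blast intro: prod_eqI)
  qed
  then show ?thesis
    using assms by (simp add: distinct_map is_context_def)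
qed

text \<open>The variable at position \<open>i\<close> is coded by a word of length
  \<open>i + 1\<close>, so the variables are distinct even where a sort is repeated.\<close>

lemma context_exists:
  assumes "set Ss \<subseteq> (\<S> :: 'u set)"
  obtains \<Gamma> where "is_context \<S> \<Gamma>" "map snd \<Gamma> = Ss"
proof -
  let ?\<Gamma> = "map (\<lambda>i. (tup (replicate (Suc i) (Ss ! i)), Ss ! i)) [0..<length Ss] :: ('u \<times> 'u) list"
  have "length (replicate (Suc i) S) \<noteq> length (replicate (Suc j) S')" if "i \<noteq> j" for i j and S S' :: 'u
    using that by simp
  then have "inj (\<lambda>i. (tup (replicate (Suc i) (Ss ! i)), Ss ! i))"
    unfolding inj_def by (metis prod.inject tup_eq_iff)
  then have "distinct ?\<Gamma>"
    unfolding distinct_map using inj_on_subset[OF _ subset_UNIV] distinct_upt by blast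
  moreover have "\<forall>(v, S) \<in> set ?\<Gamma>. S \<in> \<S> \<and> v \<in> Var S"
    using assms by (force simp: Var_def)
  moreover have "map snd ?\<Gamma> = Ss"
    by (simp add: o_def map_nth)
  ultimately show thesis
    using that[of ?\<Gamma>] by (simp only: is_context_def)
qed

end

section \<open>Term algebras, indiscrete algebras and algebraic operations\<close>

locale enriched_signature = topological_universe V
  for V :: "('o, 'm, 'u) conc_cat" +
  fixes \<S> :: "'u set" and \<Sigma> :: "('o, 'u) esig"
  assumes small_sorts: "small \<S>"
    and signature: "is_signature V \<S> \<Sigma>"
begin

abbreviation C :: "('u \<times> 'u, 'u) csig" where
  "C \<equiv> und_sig V \<Sigma>"

lemma und_sig_simps [simp]:
  "(\<sigma>, p) \<in> csyms C \<longleftrightarrow> \<sigma> \<in> syms \<Sigma> \<and> p \<in> und V (par \<Sigma> \<sigma>)"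
  "cins C (\<sigma>, p) = ins \<Sigma> \<sigma>"
  "cout C (\<sigma>, p) = out \<Sigma> \<sigma>"
  by (simp_all add: und_sig_def)

lemma und_alg_simps [simp]:
  "ccar (und_alg V A) S = und V (car A S)"
  "cop (und_alg V A) (\<sigma>, p) as = opn A \<sigma> (arg p as)"
  by (simp_all add: und_alg_def)

lemma ins_sorts: "\<sigma> \<in> syms \<Sigma> \<Longrightarrow> S \<in> set (ins \<Sigma> \<sigma>) \<Longrightarrow> S \<in> \<S>"
  and out_sort: "\<sigma> \<in> syms \<Sigma> \<Longrightarrow> out \<Sigma> \<sigma> \<in> \<S>"
  and par_objs: "\<sigma> \<in> syms \<Sigma> \<Longrightarrow> par \<Sigma> \<sigma> \<in> objs V"
  using signature by (auto simp: is_signature_def)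

text \<open>Carriers are controlled only at sorts in \<open>\<S>\<close>, so the induction carries
  along that all sorts that occur belong to \<open>\<S>\<close>.\<close>

lemma has_sort_induct [consumes 2, case_names Cst App]:
  assumes "has_sort C Y t S" "S \<in> \<S>"
    and "\<And>x S. S \<in> \<S> \<Longrightarrow> x \<in> Y S \<Longrightarrow> P (Cst x) S"
    and "\<And>\<sigma> p ts. \<sigma> \<in> syms \<Sigma> \<Longrightarrow> p \<in> und V (par \<Sigma> \<sigma>) \<Longrightarrow>
      list_all2 (\<lambda>t S. S \<in> \<S> \<and> has_sort C Y t S \<and> P t S) ts (ins \<Sigma> \<sigma>) \<Longrightarrow>
      P (App (\<sigma>, p) ts) (out \<Sigma> \<sigma>)"
  shows "P t S"
  using assms(1,2)
proof (induction rule: has_sort.induct)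
  case (Cst x S)
  then show ?case using assms(3) by blast
next
  case (App \<tau> ts)
  obtain \<sigma> p where \<tau>: "\<tau> = (\<sigma>, p)" "\<sigma> \<in> syms \<Sigma>" "p \<in> und V (par \<Sigma> \<sigma>)"
    using App(1) by (cases \<tau>) simp
  then have "list_all2 (\<lambda>t S. S \<in> \<S> \<and> has_sort C Y t S \<and> P t S) ts (ins \<Sigma> \<sigma>)"
    using App(2) ins_sorts by (auto simp: list_all2_conv_all_nth)
  then show ?case
    using assms(4) \<tau> by simp
qed

text \<open>Terms are a countable union of the strata of bounded size. A term in the next stratum is
  a constant or is given by a symbol, a parameter and a tuple from the previous stratum, so the
  strata stay small.\<close>

lemma small_terms:
  assumes Y: "\<And>S. S \<in> \<S> \<Longrightarrow> small (Y S)" and S: "S \<in> \<S>"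
  shows "small (ccar (term_alg C Y) S)"
proof -
  \<comment> \<open>All sorts are pooled because subterms may have sorts other than that of the
    term; the strict bound makes \<open>K 0\<close> empty.\<close>
  define K where "K n = enc ` {t. size t < n \<and> (\<exists>S \<in> \<S>. has_sort C Y t S)}" for n
  have "small (K n)" for n
  proof (induction n)
    case 0
    then show ?case by (simp add: K_def small_finite)
  next
    case (Suc n)
    let ?A = "\<Union>S\<in>\<S>. (\<lambda>x. enc (Cst x)) ` Y S"
    \<comment> \<open>The sorts of the arguments are ignored here, which only enlarges the
      bound.\<close>
    let ?T = "\<lambda>\<sigma>. {tup xs | xs. list_all2 (\<lambda>x B. x \<in> B) xs (replicate (length (ins \<Sigma> \<sigma>)) (K n))}"
    let ?B = "\<Union>\<sigma>\<in>syms \<Sigma>. \<Union>p\<in>und V (par \<Sigma> \<sigma>). (\<lambda>y. tup [\<sigma>, p, y]) ` ?T \<sigma>"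
    have "enc t \<in> ?A \<union> ?B" if "size t < Suc n" "S \<in> \<S>" "has_sort C Y t S" for t S
      using that(3)
    proof cases
      case (Cst x)
      then show ?thesis using that by auto
    next
      case (App \<tau> ts)
      obtain \<sigma> p where \<tau>: "\<tau> = (\<sigma>, p)" "\<sigma> \<in> syms \<Sigma>" "p \<in> und V (par \<Sigma> \<sigma>)"
        using App(3) by (cases \<tau>) simp
      have "enc u \<in> K n" if "i < length ts" "u = ts ! i" for i u
      proof -
        have "size u < n"
          using \<open>size t < Suc n\<close> App(1) size_list_estimation'[of u ts "size u" size] that by simp
        moreover have "has_sort C Y u (ins \<Sigma> \<sigma> ! i)" "ins \<Sigma> \<sigma> ! i \<in> \<S>"
          using App(4) that \<tau> ins_sorts by (auto simp: list_all2_conv_all_nth)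
        ultimately show ?thesis
          by (auto simp: K_def)
      qed
      moreover have "length ts = length (ins \<Sigma> \<sigma>)"
        using App(4) \<tau> by (auto dest: list_all2_lengthD)
      ultimately have "tup (map enc ts) \<in> ?T \<sigma>"
        by (auto simp: list_all2_conv_all_nth)
      moreover have "enc t = tup [\<sigma>, p, tup (map enc ts)]"
        by (simp add: App(1) \<tau>(1) enc.simps)
      ultimately show ?thesis
        using \<tau>(2,3) by (intro UnI2 UN_I image_eqI)
    qed
    then have "K (Suc n) \<subseteq> ?A \<union> ?B"
      unfolding K_def[of "Suc n"] by blast
    moreover have "small (?A \<union> ?B)"
      using Suc Y small_sorts signature par_objs
      by (intro small_Un small_UN small_image small_tuples)
        (auto simp: is_signature_def und_small)
    ultimately show ?case
      by (rule small_subset[rotated])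
  qed
  moreover have "ccar (term_alg C Y) S \<subseteq> (\<Union>n. K n)"
    using S by (auto simp: K_def)
  ultimately show ?thesis
    using small_UN_nat small_subset by blast
qed

lemma term_homs_eq:
  fixes D :: "('u \<times> 'u, 'u) calg"
  assumes h: "calg_hom C (term_alg C Y) D h" "calg_hom C (term_alg C Y) D h'"
    and eq: "\<And>S x. S \<in> \<S> \<Longrightarrow> x \<in> Y S \<Longrightarrow> h S (incl x) = h' S (incl x)"
    and S: "S \<in> \<S>" and a: "a \<in> ccar (term_alg C Y) S"
  shows "h S a = h' S a"
proof -
  obtain t where t: "a = enc t" "has_sort C Y t S"
    using a by auto
  have "h S (enc t) = h' S (enc t)"
    using t(2) S
  proof (induction rule: has_sort_induct)
    case (Cst x S)
    then show ?case using eq by (simp add: incl_def)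
  next
    case (App \<sigma> p ts)
    have args: "in_args (ccar (term_alg C Y)) (ins \<Sigma> \<sigma>) (map enc ts)"
      using App(3) by (auto simp: in_args_def list.rel_map elim: list_all2_mono)
    have "map2 h (ins \<Sigma> \<sigma>) (map enc ts) = map2 h' (ins \<Sigma> \<sigma>) (map enc ts)"
      using App(3) by (intro nth_equalityI) (simp_all add: list_all2_conv_all_nth)
    moreover have "h (out \<Sigma> \<sigma>) (enc (App (\<sigma>, p) ts)) = cop D (\<sigma>, p) (map2 h (ins \<Sigma> \<sigma>) (map enc ts))"
      using calg_homD[OF h(1), of "(\<sigma>, p)" "map enc ts"] App(1,2) args by (simp add: o_def)
    moreover have "h' (out \<Sigma> \<sigma>) (enc (App (\<sigma>, p) ts)) = cop D (\<sigma>, p) (map2 h' (ins \<Sigma> \<sigma>) (map enc ts))"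
      using calg_homD[OF h(2), of "(\<sigma>, p)" "map enc ts"] App(1,2) args by (simp add: o_def)
    ultimately show ?case
      by (simp only:)
  qed
  then show ?thesis
    by (simp add: t)
qed

lemma is_hom_iff:
  "is_hom V \<S> \<Sigma> A B f \<longleftrightarrow> (\<forall>S \<in> \<S>. admissible V (car A S) (car B S) (f S)) \<and>
    calg_hom C (und_alg V A) (und_alg V B) f"
  by (simp add: is_hom_def calg_hom_def split_paired_Ball_Sigma und_sig_def und_alg_def in_args_def)
    (auto simp: list_all2_conv_all_nth)

lemma algebra_closed: "is_algebra V \<S> \<Sigma> A \<Longrightarrow> calg_closed C (und_alg V A)"
proof (unfold calg_closed_def, intro ballI allI impI)
  fix \<tau> as
  assume A: "is_algebra V \<S> \<Sigma> A" and \<tau>: "\<tau> \<in> csyms C"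
    and as: "in_args (ccar (und_alg V A)) (cins C \<tau>) as"
  obtain \<sigma> p where \<sigma>: "\<tau> = (\<sigma>, p)" "\<sigma> \<in> syms \<Sigma>" "p \<in> und V (par \<Sigma> \<sigma>)"
    using \<tau> by (cases \<tau>) simp
  have "arg p as \<in> und V (dom_obj V (par \<Sigma> \<sigma>) (ins \<Sigma> \<sigma>) (car A))"
    using \<sigma> as A ins_sorts[OF \<sigma>(2)] par_objs[OF \<sigma>(2)]
    by (subst und_dom_obj) (auto simp: is_algebra_def in_args_def)
  moreover have "admissible V (dom_obj V (par \<Sigma> \<sigma>) (ins \<Sigma> \<sigma>) (car A)) (car A (out \<Sigma> \<sigma>)) (opn A \<sigma>)"
    using A \<sigma> by (simp add: is_algebra_def)
  ultimately show "cop (und_alg V A) \<tau> as \<in> ccar (und_alg V A) (cout C \<tau>)"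
    using \<sigma> admissible_mem by simp
qed

lemma und_indisc_alg:
  fixes D :: "('u \<times> 'u, 'u) calg"
  assumes "S \<in> \<S>" "small (ccar D S)"
  shows "car (indisc_alg V D) S \<in> objs V" "und V (car (indisc_alg V D) S) = ccar D S"
  using Indisc(1)[OF assms(2)] by (simp_all add: indisc_alg_def Fib_def)

lemma indisc_algebra:
  fixes D :: "('u \<times> 'u, 'u) calg"
  assumes "calg_closed C D" "\<And>S. S \<in> \<S> \<Longrightarrow> small (ccar D S)"
  shows "is_algebra V \<S> \<Sigma> (indisc_alg V D)"
  unfolding is_algebra_def
proof (intro conjI ballI)
  show obj: "car (indisc_alg V D) S \<in> objs V" if "S \<in> \<S>" for S
    using und_indisc_alg that assms(2) by blast
  fix \<sigma> assume \<sigma>: "\<sigma> \<in> syms \<Sigma>"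
  note dom = par_objs[OF \<sigma>] obj[OF ins_sorts[OF \<sigma>]]
  let ?D = "dom_obj V (par \<Sigma> \<sigma>) (ins \<Sigma> \<sigma>) (car (indisc_alg V D))"
  have "opn (indisc_alg V D) \<sigma> x \<in> ccar D (out \<Sigma> \<sigma>)" if "x \<in> und V ?D" for x
  proof -
    obtain p as where x: "x = arg p as" "p \<in> und V (par \<Sigma> \<sigma>)"
      "in_args (\<lambda>S. und V (car (indisc_alg V D) S)) (ins \<Sigma> \<sigma>) as"
      using \<open>x \<in> und V ?D\<close> by (auto simp: und_dom_obj[OF dom])
    have "in_args (ccar D) (ins \<Sigma> \<sigma>) as"
      using x(3) by (rule in_args_mono) (use und_indisc_alg ins_sorts[OF \<sigma>] assms(2) in auto)
    then show ?thesis
      using calg_closedD[OF assms(1), of "(\<sigma>, p)" as] x(2) \<sigma> by (simp add: x(1) indisc_alg_def)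
  qed
  then show "admissible V ?D (car (indisc_alg V D) (out \<Sigma> \<sigma>)) (opn (indisc_alg V D) \<sigma>)"
    using Indisc(2)[OF assms(2)[OF out_sort[OF \<sigma>]] dom_obj_objs[OF dom],
        where f = "opn (indisc_alg V D) \<sigma>"]
    by (auto simp: indisc_alg_def)
qed

text \<open>Admissibility into indiscrete carriers is automatic, so a homomorphism of classical
  algebras suffices.\<close>

lemma is_hom_indisc:
  fixes D :: "('u \<times> 'u, 'u) calg"
  assumes A: "is_algebra V \<S> \<Sigma> A" and D: "\<And>S. S \<in> \<S> \<Longrightarrow> small (ccar D S)"
    and f: "\<And>S a. S \<in> \<S> \<Longrightarrow> a \<in> und V (car A S) \<Longrightarrow> f S a \<in> ccar D S"
    and hom: "calg_hom C (und_alg V A) D f"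
  shows "is_hom V \<S> \<Sigma> A (indisc_alg V D) f"
  unfolding is_hom_iff
proof (intro conjI ballI)
  show "admissible V (car A S) (car (indisc_alg V D) S) (f S)" if "S \<in> \<S>" for S
    using Indisc(2)[OF D[OF that], of "car A S" "f S"] A f that by (auto simp: indisc_alg_def is_algebra_def)
  show "calg_hom C (und_alg V A) (und_alg V (indisc_alg V D)) f"
    using hom by (auto simp: calg_hom_def indisc_alg_def split: prod.splits)
qed

text \<open>Two naturality squares meet in \<open>?AI\<close>: one for the identity out of
  \<open>A\<close>, one for interpretation of terms at \<open>as\<close> out of \<open>?DI\<close>.
  They send \<open>as\<close> and the tuple of variables \<open>?vs\<close> to the same arguments.
  Hence \<open>\<omega> A\<close> at \<open>as\<close> is the interpretation of whatever term
  \<open>\<omega>\<close> produces from the variables.\<close>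

lemma operation_term:
  assumes \<omega>: "is_alg_operation V \<S> \<Sigma> Ss S P \<omega>" and Ss: "set Ss \<subseteq> \<S>" and S: "S \<in> \<S>"
    and P: "P \<in> objs V" and \<Gamma>: "is_context \<S> \<Gamma>" "map snd \<Gamma> = Ss" and p: "p \<in> und V P"
  shows "has_sort C (ctx_vars \<Gamma>) (op_term V \<Sigma> \<omega> p \<Gamma>) S"
    and "is_algebra V \<S> \<Sigma> A \<Longrightarrow> in_args (\<lambda>T. und V (car A T)) Ss as \<Longrightarrow>
      \<omega> A (arg p as) = interp (und_alg V A) \<Gamma> (op_term V \<Sigma> \<omega> p \<Gamma>) as"
proof -
  let ?D = "term_alg C (ctx_vars \<Gamma>)"
  let ?DI = "indisc_alg V ?D"
  let ?vs = "map (\<lambda>(v, S). enc (Cst v)) \<Gamma>"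
  have dist: "distinct (map fst \<Gamma>)"
    using \<Gamma>(1) by (rule is_context_distinct)
  have small: "small (ccar ?D S)" if "S \<in> \<S>" for S
  proof (rule small_terms[OF _ that])
    show "small (ctx_vars \<Gamma> S)" for S
      by (rule small_finite, rule finite_subset[of _ "fst ` set \<Gamma>"]) (force simp: ctx_vars_def)+
  qed
  have DI: "is_algebra V \<S> \<Sigma> ?DI"
    using term_alg_closed small by (rule indisc_algebra)
  have vs: "in_args (\<lambda>S. und V (car ?DI S)) Ss ?vs"
  proof (rule in_argsI)
    fix i assume i: "i < length Ss"
    then have "(fst (\<Gamma> ! i), Ss ! i) = \<Gamma> ! i" "Ss ! i \<in> \<S>" "i < length \<Gamma>"
      using \<Gamma>(2) Ss by auto
    then have "has_sort C (ctx_vars \<Gamma>) (Cst (fst (\<Gamma> ! i))) (Ss ! i)"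
      by (intro has_sort.Cst) (auto simp: ctx_vars_def)
    then show "?vs ! i \<in> und V (car ?DI (Ss ! i))"
      using und_indisc_alg(2)[OF \<open>Ss ! i \<in> \<S>\<close> small[OF \<open>Ss ! i \<in> \<S>\<close>]] \<open>i < length \<Gamma>\<close>
      by (simp add: case_prod_unfold)
  qed (use \<Gamma>(2) in auto)
  have "arg p ?vs \<in> und V (dom_obj V P Ss (car ?DI))"
    using P DI Ss p vs by (subst und_dom_obj) (auto simp: is_algebra_def)
  then have "\<omega> ?DI (arg p ?vs) \<in> und V (car ?DI S)"
    using \<omega> DI admissible_mem unfolding is_alg_operation_def by blast
  then obtain t where t: "\<omega> ?DI (arg p ?vs) = enc t" "has_sort C (ctx_vars \<Gamma>) t S"
    using und_indisc_alg(2)[OF S small[OF S]] by auto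
  then have op_t: "op_term V \<Sigma> \<omega> p \<Gamma> = t"
    by (simp add: op_term_def)
  with t(2) show "has_sort C (ctx_vars \<Gamma>) (op_term V \<Sigma> \<omega> p \<Gamma>) S"
    by simp
  assume A: "is_algebra V \<S> \<Sigma> A" and as: "in_args (\<lambda>T. und V (car A T)) Ss as"
  let ?A = "und_alg V A"
  have as': "in_args (ccar ?A) (map snd \<Gamma>) as"
    using as \<Gamma>(2) by (simp add: in_args_def)
  let ?AI = "indisc_alg V ?A"
  let ?h = "\<lambda>S d. interp ?A \<Gamma> (dec d) as"
  have smallA: "small (ccar ?A S)" if "S \<in> \<S>" for S
    using A that by (simp add: is_algebra_def und_small)
  have AI: "is_algebra V \<S> \<Sigma> ?AI"
    using algebra_closed[OF A] smallA by (rule indisc_algebra)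
  have natural: "f S (\<omega> B (arg p bs)) = \<omega> B' (arg p (map2 f Ss bs))"
    if "is_algebra V \<S> \<Sigma> B" "is_algebra V \<S> \<Sigma> B'" "is_hom V \<S> \<Sigma> B B' f"
      "in_args (\<lambda>T. und V (car B T)) Ss bs" for B B' f bs
    using \<omega> that p unfolding is_alg_operation_def by blast
  have id: "map2 (\<lambda>S x. x) Ss as = as"
    using in_args_length[OF as] by (simp add: map2_snd[of _ _ "\<lambda>x. x"])
  have "is_hom V \<S> \<Sigma> A ?AI (\<lambda>S x. x)"
    by (rule is_hom_indisc[OF A smallA])
      (auto simp: calg_hom_def map2_snd[of _ _ "\<lambda>x. x"] in_args_length)
  from natural[OF A AI this as] have "\<omega> A (arg p as) = \<omega> ?AI (arg p as)"
    by (simp add: id)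
  also have "\<dots> = \<omega> ?AI (arg p (map2 ?h Ss ?vs))"
  proof (rule arg_cong[of as _ "\<lambda>bs. \<omega> ?AI (arg p bs)"])
    show "as = map2 ?h Ss ?vs"
    proof (rule nth_equalityI)
      fix i assume "i < length as"
      moreover have "length as = length \<Gamma>" "length Ss = length \<Gamma>"
        using in_args_length[OF as] \<Gamma>(2) by auto
      ultimately show "as ! i = map2 ?h Ss ?vs ! i"
        using interp_Cst_nth[OF dist, of as i ?A] by (simp add: case_prod_unfold del: interp.simps)
    qed (use in_args_length[OF as] \<Gamma>(2) in auto)
  qed
  \<comment> \<open>Naturality along \<open>?h\<close>, which is available only because the carriers
    of \<open>?AI\<close> are indiscrete.\<close>
  also have "\<dots> = ?h S (\<omega> ?DI (arg p ?vs))"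
  proof (rule natural[OF DI AI _ vs, symmetric])
    show "is_hom V \<S> \<Sigma> ?DI ?AI ?h"
    proof (rule is_hom_indisc[OF DI smallA])
      show "?h S d \<in> ccar ?A S" if "S \<in> \<S>" "d \<in> und V (car ?DI S)" for S d
        using that und_indisc_alg(2)[OF that(1) small[OF that(1)]]
          interp_closed[OF algebra_closed[OF A] dist as'] by auto
      show "calg_hom C (und_alg V ?DI) ?A ?h"
        by (auto simp: calg_hom_def indisc_alg_def o_def in_args_length
            map2_snd[of _ _ "\<lambda>d. interp ?A \<Gamma> (dec d) as"])
    qed
  qed
  also have "\<dots> = interp ?A \<Gamma> (op_term V \<Sigma> \<omega> p \<Gamma>) as"
    by (simp add: t(1) op_t)
  finally show "\<omega> A (arg p as) = interp ?A \<Gamma> (op_term V \<Sigma> \<omega> p \<Gamma>) as" .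
qed

end

section \<open>Free algebras\<close>

context topological_universe
begin

lemma admissible_dom_obj_map:
  assumes P: "P \<in> objs V" and h: "\<And>S. S \<in> set Ss \<Longrightarrow> admissible V (A S) (B S) (h S)"
  shows "admissible V (dom_obj V P Ss A) (dom_obj V P Ss B)
    (\<lambda>x. arg (arg_par x) (map2 h Ss (arg_list x)))"
proof -
  have A: "A S \<in> objs V" and B: "B S \<in> objs V" if "S \<in> set Ss" for S
    using h[OF that] admissible_objs by auto
  have As: "set (map A Ss) \<subseteq> objs V" and Bs: "set (map B Ss) \<subseteq> objs V"
    using A B by auto
  let ?D = "dom_obj V P Ss A"
  have par: "admissible V ?D P (proj 0)" and list: "admissible V ?D (product V (map A Ss)) (proj 1)"
    unfolding dom_obj_def
    using P product_objs[OF As] by (rule admissible_fst admissible_snd)+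
  have "admissible V ?D (product V (map B Ss)) (\<lambda>x. tup (map2 h Ss (arg_list x)))"
  proof (rule admissible_tup[OF Bs dom_obj_objs[OF P A]])
    have len: "length (arg_list x) = length Ss" if "x \<in> und V ?D" for x
      using that by (auto simp: und_dom_obj[OF P A] in_args_length)
    then show "length (map2 h Ss (arg_list x)) = length (map B Ss)" if "x \<in> und V ?D" for x
      using that by simp
    fix i assume i: "i < length (map B Ss)"
    then have "admissible V ?D (A (Ss ! i)) (\<lambda>x. arg_list x ! i)"
      using admissible_comp[OF list admissible_proj[OF As, of i]] by (simp add: arg_list_def proj_def)
    from admissible_comp[OF this h]
    show "admissible V ?D (map B Ss ! i) (\<lambda>x. map2 h Ss (arg_list x) ! i)"
      using i len by (auto elim: admissible_mono)
  qed
  with par show ?thesis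
    unfolding arg_def arg_par_def dom_obj_def[of V P Ss B] by (intro admissible_pair)
qed

end

locale free_construction = closed_topological_universe V + enriched_signature V \<S> \<Sigma>
  for V :: "('o, 'm, 'u) conc_cat" and \<S> :: "'u set" and \<Sigma> :: "('o, 'u) esig" +
  fixes X :: "'u \<Rightarrow> 'o"
  assumes X_objs: "S \<in> \<S> \<Longrightarrow> X S \<in> objs V"
begin

abbreviation D :: "('u \<times> 'u, 'u) calg" where
  "D \<equiv> Term_alg V \<Sigma> X"

lemma Term_alg_eq: "D = term_alg C (\<lambda>S. und V (X S))"
  by (simp add: Term_alg_def)

lemma small_Term: "S \<in> \<S> \<Longrightarrow> small (Term V \<Sigma> X S)"
  unfolding Term_alg_eq by (rule small_terms) (auto intro: und_small X_objs)

lemma Term_closed: "calg_closed C D"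
  unfolding Term_alg_eq by (rule term_alg_closed)

lemma incl_Term: "x \<in> und V (X S) \<Longrightarrow> incl x \<in> Term V \<Sigma> X S"
  unfolding Term_alg_eq by (auto simp: incl_def intro: has_sort.Cst)

lemma sigma_hat_arg: "sigma_hat V \<Sigma> X \<sigma> (arg p as) = cop D (\<sigma>, p) as"
  by (simp add: sigma_hat_def)

lemma cop_Term:
  "\<sigma> \<in> syms \<Sigma> \<Longrightarrow> p \<in> und V (par \<Sigma> \<sigma>) \<Longrightarrow> in_args (Term V \<Sigma> X) (ins \<Sigma> \<sigma>) as \<Longrightarrow>
    cop D (\<sigma>, p) as \<in> Term V \<Sigma> X (out \<Sigma> \<sigma>)"
  using calg_closedD[OF Term_closed, of "(\<sigma>, p)" as] by simp

lemma in_args_Fib: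
  assumes "\<sigma> \<in> syms \<Sigma>" "\<And>S. S \<in> \<S> \<Longrightarrow> B S \<in> Fib V (Y S)"
  shows "in_args (\<lambda>S. und V (B S)) (ins \<Sigma> \<sigma>) as \<longleftrightarrow> in_args Y (ins \<Sigma> \<sigma>) as"
proof -
  have "und V (B S) = Y S" if "S \<in> set (ins \<Sigma> \<sigma>)" for S
    using assms(2)[OF ins_sorts[OF assms(1) that]] by (simp add: Fib_def)
  then show ?thesis
    by (auto elim!: in_args_mono)
qed

lemma und_dom_obj_Fib:
  assumes "\<sigma> \<in> syms \<Sigma>" "\<And>S. S \<in> \<S> \<Longrightarrow> B S \<in> Fib V (Y S)"
  shows "und V (dom_obj V (par \<Sigma> \<sigma>) (ins \<Sigma> \<sigma>) B) =
      {arg p as | p as. p \<in> und V (par \<Sigma> \<sigma>) \<and> in_args Y (ins \<Sigma> \<sigma>) as}"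
    and "dom_obj V (par \<Sigma> \<sigma>) (ins \<Sigma> \<sigma>) B \<in> objs V"
proof -
  have B: "B S \<in> objs V" if "S \<in> set (ins \<Sigma> \<sigma>)" for S
    using assms(2)[OF ins_sorts[OF assms(1) that]] by (simp add: Fib_def)
  show "und V (dom_obj V (par \<Sigma> \<sigma>) (ins \<Sigma> \<sigma>) B) =
      {arg p as | p as. p \<in> und V (par \<Sigma> \<sigma>) \<and> in_args Y (ins \<Sigma> \<sigma>) as}"
    by (simp add: und_dom_obj[OF par_objs[OF assms(1)] B] in_args_Fib[OF assms])
  show "dom_obj V (par \<Sigma> \<sigma>) (ins \<Sigma> \<sigma>) B \<in> objs V"
    using dom_obj_objs par_objs[OF assms(1)] B by blast
qed

section \<open>The chain of structures on the terms and its join\<close>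

abbreviation \<Omega> :: "nat \<Rightarrow> 'u \<Rightarrow> 'o" where
  "\<Omega> \<equiv> Omega V \<Sigma> X"

definition hat_sink :: "nat \<Rightarrow> 'u \<Rightarrow> ('o \<times> ('u \<Rightarrow> 'u)) set" where
  "hat_sink n S = {(dom_obj V (par \<Sigma> \<sigma>) (ins \<Sigma> \<sigma>) (\<Omega> n), sigma_hat V \<Sigma> X \<sigma>) | \<sigma>.
     \<sigma> \<in> syms \<Sigma> \<and> out \<Sigma> \<sigma> = S}"

text \<open>This is the object \<open>\<Omega>\<^sup>n(X, S)\<close>.\<close>

definition hat_structure :: "nat \<Rightarrow> 'u \<Rightarrow> 'o" where
  "hat_structure n S = final_structure V (Term V \<Sigma> X S) (hat_sink n S)"

lemma Omega_Suc: "\<Omega> (Suc n) S = fib_join V (Term V \<Sigma> X S) {\<Omega> n S, hat_structure n S}"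
  by (simp add: hat_structure_def hat_sink_def)

declare Omega.simps [simp del]

lemma hat_sink_wf:
  assumes "\<And>S. S \<in> \<S> \<Longrightarrow> \<Omega> n S \<in> Fib V (Term V \<Sigma> X S)" and "(B, g) \<in> hat_sink n S"
  shows "B \<in> objs V \<and> g \<in> und V B \<rightarrow> Term V \<Sigma> X S"
proof -
  obtain \<sigma> where \<sigma>: "\<sigma> \<in> syms \<Sigma>" "out \<Sigma> \<sigma> = S" "g = sigma_hat V \<Sigma> X \<sigma>"
    "B = dom_obj V (par \<Sigma> \<sigma>) (ins \<Sigma> \<sigma>) (\<Omega> n)"
    using assms(2) by (auto simp: hat_sink_def)
  note dom = und_dom_obj_Fib[OF \<sigma>(1), of "\<Omega> n", OF assms(1)]
  show ?thesis
    using cop_Term[OF \<sigma>(1)] dom(2) by (auto simp: \<sigma>(3,4) dom(1) sigma_hat_arg \<sigma>(2)[symmetric])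
qed

lemma Omega_0:
  assumes "S \<in> \<S>"
  shows "\<Omega> 0 S \<in> Fib V (Term V \<Sigma> X S)" "admissible V (X S) (\<Omega> 0 S) incl"
    "final_sink V (\<Omega> 0 S) {(X S, incl)}"
  using final_structure[of "Term V \<Sigma> X S" "{(X S, incl)}"] small_Term[OF assms] X_objs[OF assms]
    incl_Term by (auto simp: Omega.simps)

lemma Omega_Fib: "S \<in> \<S> \<Longrightarrow> \<Omega> n S \<in> Fib V (Term V \<Sigma> X S)"
proof (induction n arbitrary: S)
  case 0
  then show ?case by (rule Omega_0)
next
  case (Suc n)
  have "hat_structure n S \<in> Fib V (Term V \<Sigma> X S)"
    unfolding hat_structure_def using hat_sink_wf[OF Suc.IH] small_Term[OF Suc.prems]
    by (intro final_structure(1)) auto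
  then show ?case
    unfolding Omega_Suc using Suc small_Term by (intro fib_join(1)) auto
qed

lemma hat_structure:
  assumes "S \<in> \<S>"
  shows "hat_structure n S \<in> Fib V (Term V \<Sigma> X S)"
    "(B, g) \<in> hat_sink n S \<Longrightarrow> admissible V B (hat_structure n S) g"
    "final_sink V (hat_structure n S) (hat_sink n S)"
  unfolding hat_structure_def using hat_sink_wf[OF Omega_Fib] small_Term[OF assms]
  by (blast intro: final_structure)+

lemma Omega_Suc_join:
  assumes "S \<in> \<S>"
  shows "admissible V (\<Omega> n S) (\<Omega> (Suc n) S) (\<lambda>x. x)"
    "admissible V (hat_structure n S) (\<Omega> (Suc n) S) (\<lambda>x. x)"
    "final_sink V (\<Omega> (Suc n) S) {(\<Omega> n S, \<lambda>x. x), (hat_structure n S, \<lambda>x. x)}"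
proof -
  have "{\<Omega> n S, hat_structure n S} \<subseteq> Fib V (Term V \<Sigma> X S)"
    using Omega_Fib hat_structure(1) assms by blast
  note join = fib_join[OF small_Term[OF assms] this]
  show "admissible V (\<Omega> n S) (\<Omega> (Suc n) S) (\<lambda>x. x)"
    "admissible V (hat_structure n S) (\<Omega> (Suc n) S) (\<lambda>x. x)"
    "final_sink V (\<Omega> (Suc n) S) {(\<Omega> n S, \<lambda>x. x), (hat_structure n S, \<lambda>x. x)}"
    unfolding Omega_Suc using join(2,3) by auto
qed

lemma sigma_hat_admissible:
  assumes "\<sigma> \<in> syms \<Sigma>"
  shows "admissible V (dom_obj V (par \<Sigma> \<sigma>) (ins \<Sigma> \<sigma>) (\<Omega> n)) (\<Omega> (Suc n) (out \<Sigma> \<sigma>))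
    (sigma_hat V \<Sigma> X \<sigma>)"
proof -
  have "(dom_obj V (par \<Sigma> \<sigma>) (ins \<Sigma> \<sigma>) (\<Omega> n), sigma_hat V \<Sigma> X \<sigma>) \<in> hat_sink n (out \<Sigma> \<sigma>)"
    using assms by (auto simp: hat_sink_def)
  from hat_structure(2)[OF out_sort[OF assms] this]
  show ?thesis
    using admissible_comp Omega_Suc_join(2)[OF out_sort[OF assms]] by fastforce
qed

lemma Omega_mono:
  assumes "S \<in> \<S>" "m \<le> n"
  shows "admissible V (\<Omega> m S) (\<Omega> n S) (\<lambda>x. x)"
  using assms(2)
proof (induction rule: dec_induct)
  case base
  then show ?case
    using Omega_Fib[OF assms(1)] by (auto simp: Fib_def intro: admissible_id)
next
  case (step n)
  from admissible_comp[OF step.IH Omega_Suc_join(1)[OF assms(1)]] show ?case .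
qed

text \<open>Each stage is final for a sink on which \<open>h\<close> can be tested. On the unit this
  is the hypothesis \<open>unit\<close>; on \<open>sigma_hat\<close> the homomorphism law rewrites
  the composite as the operation of \<open>B\<close> after \<open>h\<close> on the arguments, and
  those lie one level lower.\<close>

lemma Omega_hom_admissible:
  assumes B: "is_algebra V \<S> \<Sigma> B" and hom: "calg_hom C D (und_alg V B) h"
    and h: "\<And>S a. S \<in> \<S> \<Longrightarrow> a \<in> Term V \<Sigma> X S \<Longrightarrow> h S a \<in> und V (car B S)"
    and unit: "\<And>S. S \<in> \<S> \<Longrightarrow> admissible V (X S) (car B S) (\<lambda>x. h S (incl x))"
    and S: "S \<in> \<S>"
  shows "admissible V (\<Omega> n S) (car B S) (h S)"
  using S
proof (induction n arbitrary: S)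
  case 0
  then show ?case
    using B h unit Omega_0(1)[OF 0]
    by (intro final_sinkD[OF Omega_0(3)[OF 0]]) (auto simp: is_algebra_def Fib_def)
next
  case (Suc n)
  have obj: "car B S \<in> objs V"
    using B Suc.prems by (simp add: is_algebra_def)
  have "admissible V (hat_structure n S) (car B S) (h S)"
  proof (rule final_sinkD[OF hat_structure(3)[OF Suc.prems] obj])
    show "h S x \<in> und V (car B S)" if "x \<in> und V (hat_structure n S)" for x
      using h[OF Suc.prems] hat_structure(1)[OF Suc.prems] that by (auto simp: Fib_def)
    fix E g assume "(E, g) \<in> hat_sink n S"
    then obtain \<sigma> where \<sigma>: "\<sigma> \<in> syms \<Sigma>" "out \<Sigma> \<sigma> = S" "g = sigma_hat V \<Sigma> X \<sigma>"
      "E = dom_obj V (par \<Sigma> \<sigma>) (ins \<Sigma> \<sigma>) (\<Omega> n)"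
      by (auto simp: hat_sink_def)
    have "admissible V E (dom_obj V (par \<Sigma> \<sigma>) (ins \<Sigma> \<sigma>) (car B))
        (\<lambda>x. arg (arg_par x) (map2 h (ins \<Sigma> \<sigma>) (arg_list x)))"
      unfolding \<sigma>(4) using Suc.IH ins_sorts[OF \<sigma>(1)]
      by (intro admissible_dom_obj_map par_objs[OF \<sigma>(1)]) auto
    moreover have "admissible V (dom_obj V (par \<Sigma> \<sigma>) (ins \<Sigma> \<sigma>) (car B)) (car B S) (opn B \<sigma>)"
      using B \<sigma> by (auto simp: is_algebra_def)
    ultimately have "admissible V E (car B S)
        (\<lambda>x. opn B \<sigma> (arg (arg_par x) (map2 h (ins \<Sigma> \<sigma>) (arg_list x))))"
      by (rule admissible_comp)
    then show "admissible V E (car B S) (\<lambda>x. h S (g x))"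
    proof (rule admissible_mono)
      fix x assume "x \<in> und V E"
      then obtain p as where x: "x = arg p as" "p \<in> und V (par \<Sigma> \<sigma>)"
        "in_args (Term V \<Sigma> X) (ins \<Sigma> \<sigma>) as"
        by (auto simp: \<sigma>(4) und_dom_obj_Fib(1)[OF \<sigma>(1), of "\<Omega> n", OF Omega_Fib])
      then show "opn B \<sigma> (arg (arg_par x) (map2 h (ins \<Sigma> \<sigma>) (arg_list x))) = h S (g x)"
        using calg_homD[OF hom, of "(\<sigma>, p)" as] \<sigma> by (simp add: sigma_hat_arg)
    qed
  qed
  moreover have "admissible V (\<Omega> n S) (car B S) (h S)"
    using Suc by blast
  ultimately show ?case
    using h[OF Suc.prems] Omega_Fib[OF Suc.prems, of "Suc n"] obj
    by (intro final_sinkD[OF Omega_Suc_join(3)[OF Suc.prems]]) (auto simp: Fib_def)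
qed

definition Omega_sup :: "'u \<Rightarrow> 'o" where
  "Omega_sup S = fib_join V (Term V \<Sigma> X S) {\<Omega> n S | n. True}"

lemma Omega_join:
  assumes "S \<in> \<S>"
  shows "Omega_sup S \<in> Fib V (Term V \<Sigma> X S)"
    "admissible V (\<Omega> n S) (Omega_sup S) (\<lambda>x. x)"
    "surjective_final_sink (Omega_sup S) {(\<Omega> n S, \<lambda>x. x) | n. True}"
proof -
  have *: "{\<Omega> n S | n. True} \<subseteq> Fib V (Term V \<Sigma> X S)"
    using Omega_Fib[OF assms] by blast
  note join = fib_join[OF small_Term[OF assms] *, folded Omega_sup_def]
  show fib: "Omega_sup S \<in> Fib V (Term V \<Sigma> X S)" and adm: "admissible V (\<Omega> n S) (Omega_sup S) (\<lambda>x. x)" for n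
    using join(1,2) by auto
  have "(\<lambda>A. (A, (\<lambda>x. x) :: 'u \<Rightarrow> 'u)) ` {\<Omega> n S | n. True} = {(\<Omega> n S, \<lambda>x. x) | n. True}"
    by auto
  with join(3) have "final_sink V (Omega_sup S) {(\<Omega> n S, \<lambda>x. x) | n. True}"
    by simp
  \<comment> \<open>Level zero already has all terms as its underlying set, so it alone gives joint
    surjectivity.\<close>
  moreover have "und V (Omega_sup S) = und V (\<Omega> 0 S)"
    using fib Omega_Fib[OF assms, of 0] by (simp add: Fib_def)
  then have "\<forall>a \<in> und V (Omega_sup S). \<exists>(B, g) \<in> {(\<Omega> n S, \<lambda>x. x) | n. True}. a \<in> g ` und V B"
    by (intro ballI bexI[of _ "(\<Omega> 0 S, \<lambda>x. x)"]) auto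
  ultimately show "surjective_final_sink (Omega_sup S) {(\<Omega> n S, \<lambda>x. x) | n. True}"
    unfolding surjective_final_sink_def using fib adm by (auto simp: Fib_def)
qed

lemma Omega_join_hom_admissible:
  assumes "is_algebra V \<S> \<Sigma> B" "calg_hom C D (und_alg V B) h"
    and h: "\<And>S a. S \<in> \<S> \<Longrightarrow> a \<in> Term V \<Sigma> X S \<Longrightarrow> h S a \<in> und V (car B S)"
    and "\<And>S. S \<in> \<S> \<Longrightarrow> admissible V (X S) (car B S) (\<lambda>x. h S (incl x))"
    and S: "S \<in> \<S>"
  shows "admissible V (Omega_sup S) (car B S) (h S)"
proof (rule final_sinkD)
  show "final_sink V (Omega_sup S) {(\<Omega> n S, \<lambda>x. x) | n. True}"
    using Omega_join(3)[OF S] by (simp add: surjective_final_sink_def)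
  show "car B S \<in> objs V"
    using assms by (simp add: is_algebra_def)
  show "h S x \<in> und V (car B S)" if "x \<in> und V (Omega_sup S)" for x
    using h S Omega_join(1)[OF S] that by (auto simp: Fib_def)
  show "admissible V A (car B S) (\<lambda>x. h S (g x))" if "(A, g) \<in> {(\<Omega> n S, \<lambda>x. x) | n. True}" for A g
    using that Omega_hom_admissible[OF assms] by auto
qed

text \<open>At level \<open>n\<close> the operation lands in level \<open>Suc n\<close> and hence in
  the join. Passing to the join in the arguments is the point where cartesian closedness is needed
  for the free algebra.\<close>

lemma sigma_hat_join_admissible:
  assumes \<sigma>: "\<sigma> \<in> syms \<Sigma>"
  shows "admissible V (dom_obj V (par \<Sigma> \<sigma>) (ins \<Sigma> \<sigma>) Omega_sup) (Omega_sup (out \<Sigma> \<sigma>)) (sigma_hat V \<Sigma> X \<sigma>)"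
proof (rule final_dom_obj_chain[where A = \<Omega>])
  note out = out_sort[OF \<sigma>] and ins = ins_sorts[OF \<sigma>]
  show "Omega_sup (out \<Sigma> \<sigma>) \<in> objs V"
    using Omega_join(1)[OF out] by (simp add: Fib_def)
  show "surjective_final_sink (Omega_sup S) {(\<Omega> n S, \<lambda>x. x) | n. True}" if "S \<in> set (ins \<Sigma> \<sigma>)" for S
    using Omega_join(3) ins that by blast
  show "admissible V (\<Omega> m S) (\<Omega> n S) (\<lambda>x. x)" if "S \<in> set (ins \<Sigma> \<sigma>)" "m \<le> n" for S m n
    using Omega_mono ins that by blast
  show "sigma_hat V \<Sigma> X \<sigma> (arg p as) \<in> und V (Omega_sup (out \<Sigma> \<sigma>))"
    if "p \<in> und V (par \<Sigma> \<sigma>)" "in_args (\<lambda>S. und V (Omega_sup S)) (ins \<Sigma> \<sigma>) as" for p as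
    using that cop_Term[OF \<sigma>] Omega_join(1)[OF out]
    by (simp add: sigma_hat_arg in_args_Fib[OF \<sigma>, of "Omega_sup", OF Omega_join(1)] Fib_def)
  show "admissible V (dom_obj V (par \<Sigma> \<sigma>) (ins \<Sigma> \<sigma>) (\<Omega> n)) (Omega_sup (out \<Sigma> \<sigma>)) (sigma_hat V \<Sigma> X \<sigma>)" for n
    using admissible_comp[OF sigma_hat_admissible[OF \<sigma>] Omega_join(2)[OF out]] .
qed (rule par_objs[OF \<sigma>])

section \<open>Evaluation of terms and the free algebra on the join\<close>

definition evaluation :: "('u \<times> 'u, 'u) calg \<Rightarrow> ('u \<Rightarrow> 'u \<Rightarrow> 'u) \<Rightarrow> 'u \<Rightarrow> 'u \<Rightarrow> 'u" where
  "evaluation E g S d = evaluate C E g (dec d) S"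

lemma evaluation_incl: "evaluation E g S (incl x) = g S x"
  by (simp add: evaluation_def incl_def)

lemma evaluation_hom: "calg_hom C D E (evaluation E g)"
  unfolding evaluation_def[abs_def] Term_alg_eq by (rule evaluate_hom)

lemma evaluation_closed:
  assumes E: "calg_closed C E" and g: "\<And>S x. S \<in> \<S> \<Longrightarrow> x \<in> und V (X S) \<Longrightarrow> g S x \<in> ccar E S"
    and S: "S \<in> \<S>" and a: "a \<in> Term V \<Sigma> X S"
  shows "evaluation E g S a \<in> ccar E S"
proof -
  obtain t where t: "a = enc t" "has_sort C (\<lambda>S. und V (X S)) t S"
    using a by (auto simp: Term_alg_eq)
  have "evaluate C E g t S \<in> ccar E S"
    using t(2) S
  proof (induction rule: has_sort_induct)
    case (Cst x S)
    then show ?case using g by simp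
  next
    case (App \<sigma> p ts)
    have "in_args (ccar E) (ins \<Sigma> \<sigma>) (map2 (\<lambda>S h. h S) (ins \<Sigma> \<sigma>) (map (evaluate C E g) ts))"
      using App(3) by (intro in_argsI) (auto simp: list_all2_conv_all_nth)
    then show ?case
      using calg_closedD[OF E, of "(\<sigma>, p)"] App(1,2) by simp
  qed
  then show ?thesis
    by (simp add: evaluation_def t(1))
qed

lemma Term_homs_eq:
  assumes "calg_hom C D E h" "calg_hom C D E h'"
    and "\<And>S x. S \<in> \<S> \<Longrightarrow> x \<in> und V (X S) \<Longrightarrow> h S (incl x) = h' S (incl x)"
    and "S \<in> \<S>" "a \<in> Term V \<Sigma> X S"
  shows "h S a = h' S a"
  using assms unfolding Term_alg_eq by (rule term_homs_eq)

definition free_alg :: "('o, 'u) ealg" where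
  "free_alg = \<lparr>car = Omega_sup, opn = sigma_hat V \<Sigma> X\<rparr>"

lemma free_alg_eq: "calg_eq \<S> C (und_alg V free_alg) D"
  using Omega_join(1) by (auto simp: calg_eq_def free_alg_def sigma_hat_arg Fib_def)

lemma free_alg_algebra: "is_algebra V \<S> \<Sigma> free_alg"
  using Omega_join(1) sigma_hat_join_admissible by (auto simp: is_algebra_def free_alg_def Fib_def)

lemma calg_hom_cong:
  assumes "calg_eq \<S> C E E'"
  shows "calg_hom C E B h \<longleftrightarrow> calg_hom C E' B h"
proof -
  have "in_args (ccar E) (cins C \<tau>) as \<longleftrightarrow> in_args (ccar E') (cins C \<tau>) as" if "\<tau> \<in> csyms C" for \<tau> as
  proof -
    have "ccar E S = ccar E' S" if "S \<in> set (cins C \<tau>)" for S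
      using assms that \<open>\<tau> \<in> csyms C\<close> ins_sorts by (cases \<tau>) (auto simp: calg_eq_def)
    then show ?thesis
      by (auto elim!: in_args_mono)
  qed
  then show ?thesis
    using assms by (auto simp: calg_hom_def calg_eq_def)
qed

lemma free_algebra_exists: "is_free_algebra V \<S> \<Sigma> X free_alg"
  unfolding is_free_algebra_def is_free_def
proof (intro conjI allI impI ballI free_alg_eq free_alg_algebra)
  show "admissible V (X S) (car free_alg S) incl" if "S \<in> \<S>" for S
    using admissible_comp[OF Omega_0(2)[OF that] Omega_join(2)[OF that]] by (simp add: free_alg_def)
  fix B g assume Bg: "is_algebra V \<S> \<Sigma> B \<and> (\<forall>S \<in> \<S>. admissible V (X S) (car B S) (g S))"
  then have B: "is_algebra V \<S> \<Sigma> B" and g: "\<And>S. S \<in> \<S> \<Longrightarrow> admissible V (X S) (car B S) (g S)"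
    by auto
  let ?h = "evaluation (und_alg V B) g"
  have mem: "?h S a \<in> und V (car B S)" if "S \<in> \<S>" "a \<in> Term V \<Sigma> X S" for S a
    using evaluation_closed[OF algebra_closed[OF B], of g S a] admissible_mem[OF g] that by simp
  have "is_hom V \<S> \<Sigma> free_alg B ?h"
    unfolding is_hom_iff calg_hom_cong[OF free_alg_eq]
    using Omega_join_hom_admissible[OF B evaluation_hom mem] g evaluation_hom
    by (simp add: free_alg_def evaluation_incl)
  moreover have "h' S a = ?h S a"
    if "is_hom V \<S> \<Sigma> free_alg B h'" "\<forall>S \<in> \<S>. \<forall>x \<in> und V (X S). h' S (incl x) = g S x"
      "S \<in> \<S>" "a \<in> und V (car free_alg S)" for h' S a
  proof (rule Term_homs_eq[OF _ evaluation_hom])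
    show "calg_hom C D (und_alg V B) h'"
      using that(1) by (simp add: is_hom_iff calg_hom_cong[OF free_alg_eq])
    show "a \<in> Term V \<Sigma> X S"
      using that(3,4) Omega_join(1) by (auto simp: free_alg_def Fib_def)
  qed (use that in \<open>auto simp: evaluation_incl\<close>)
  ultimately show "\<exists>h. is_hom V \<S> \<Sigma> free_alg B h \<and> (\<forall>S \<in> \<S>. \<forall>x \<in> und V (X S). h S (incl x) = g S x) \<and>
      (\<forall>h'. is_hom V \<S> \<Sigma> free_alg B h' \<and> (\<forall>S \<in> \<S>. \<forall>x \<in> und V (X S). h' S (incl x) = g S x) \<longrightarrow>
        (\<forall>S \<in> \<S>. \<forall>a \<in> und V (car free_alg S). h' S a = h S a))"
    using evaluation_incl[of "und_alg V B" g] by (intro exI[of _ ?h] conjI) (blast, blast, blast)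
qed

end

section \<open>Free algebras of a theory\<close>

lemma is_free_mem: "is_free V \<S> \<Sigma> K X A \<eta> \<Longrightarrow> K A"
  and is_free_unit: "is_free V \<S> \<Sigma> K X A \<eta> \<Longrightarrow> S \<in> \<S> \<Longrightarrow> admissible V (X S) (car A S) (\<eta> S)"
  by (simp_all add: is_free_def)

lemma is_free_extend:
  assumes "is_free V \<S> \<Sigma> K X A \<eta>" "K B" "\<And>S. S \<in> \<S> \<Longrightarrow> admissible V (X S) (car B S) (g S)"
  shows "\<exists>h. is_hom V \<S> \<Sigma> A B h \<and> (\<forall>S \<in> \<S>. \<forall>x \<in> und V (X S). h S (\<eta> S x) = g S x)"
proof -
  have "\<forall>S \<in> \<S>. admissible V (X S) (car B S) (g S)"
    using assms(3) by blast
  with assms(1,2) show ?thesis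
    unfolding is_free_def by metis
qed

lemma is_congruenceD:
  assumes "is_congruence \<S> C D R" "\<tau> \<in> csyms C"
    and "length as = length (cins C \<tau>)" "length bs = length (cins C \<tau>)"
    and "\<And>i. i < length (cins C \<tau>) \<Longrightarrow> (as ! i, bs ! i) \<in> R (cins C \<tau> ! i)"
  shows "(cop D \<tau> as, cop D \<tau> bs) \<in> R (cout C \<tau>)"
  using assms unfolding is_congruence_def by blast

locale free_theory_construction = free_construction V \<S> \<Sigma> X
  for V :: "('o, 'm, 'u) conc_cat" and \<S> :: "'u set" and \<Sigma> :: "('o, 'u) esig"
    and X :: "'u \<Rightarrow> 'o" +
  fixes \<E> :: "('o, 'u) eeqn set"
  assumes equations: "e \<in> \<E> \<Longrightarrow> is_equation V \<S> \<Sigma> e"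
begin

abbreviation Q :: "('u \<times> 'u, 'u) ceqn set" where
  "Q \<equiv> und_eqns V \<S> \<Sigma> \<E>"

lemma equation_terms:
  assumes e: "e \<in> \<E>" and \<Gamma>: "is_context \<S> \<Gamma>" "map snd \<Gamma> = eins e" and p: "p \<in> und V (epar e)"
  shows "has_sort C (ctx_vars \<Gamma>) (op_term V \<Sigma> (lhs e) p \<Gamma>) (eout e)"
    and "has_sort C (ctx_vars \<Gamma>) (op_term V \<Sigma> (rhs e) p \<Gamma>) (eout e)"
    and "is_algebra V \<S> \<Sigma> A \<Longrightarrow> in_args (\<lambda>T. und V (car A T)) (eins e) as \<Longrightarrow>
      lhs e A (arg p as) = interp (und_alg V A) \<Gamma> (op_term V \<Sigma> (lhs e) p \<Gamma>) as"
    and "is_algebra V \<S> \<Sigma> A \<Longrightarrow> in_args (\<lambda>T. und V (car A T)) (eins e) as \<Longrightarrow>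
      rhs e A (arg p as) = interp (und_alg V A) \<Gamma> (op_term V \<Sigma> (rhs e) p \<Gamma>) as"
  using equations[OF e] operation_term[OF _ _ _ _ \<Gamma> p] unfolding is_equation_def by blast+

sublocale classical: classical_theory \<S> C Q
proof
  fix \<tau> assume "\<tau> \<in> csyms C"
  then show "set (cins C \<tau>) \<subseteq> \<S>" "cout C \<tau> \<in> \<S>"
    using ins_sorts out_sort by (cases \<tau>; auto)+
next
  fix \<Gamma> T s t assume "(\<Gamma>, T, s, t) \<in> Q"
  then obtain e p where e: "e \<in> \<E>" "p \<in> und V (epar e)" "is_context \<S> \<Gamma>" "map snd \<Gamma> = eins e"
    "T = eout e" "s = op_term V \<Sigma> (lhs e) p \<Gamma>" "t = op_term V \<Sigma> (rhs e) p \<Gamma>"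
    by (auto simp: und_eqns_def)
  have "snd ` set \<Gamma> = set (eins e)"
    using e(4) by (metis set_map)
  then show "T \<in> \<S> \<and> snd ` set \<Gamma> \<subseteq> \<S>"
    using equations[OF e(1)] by (simp add: is_equation_def e(5))
  show "distinct (map fst \<Gamma>)"
    using e(3) by (rule is_context_distinct)
  show "has_sort C (ctx_vars \<Gamma>) s T \<and> has_sort C (ctx_vars \<Gamma>) t T"
    using equation_terms(1,2)[OF e(1,3,4,2)] e(5-7) by simp
qed

section \<open>The congruence on terms and its quotient\<close>

definition R :: "'u \<Rightarrow> ('u \<times> 'u) set" where
  "R = generated_congruence \<S> C Q D"

lemma R_respects: "respects_equations \<S> C Q D R"
  unfolding R_def using Term_closed by (rule classical.generated_congruence_respects)

lemma R_equiv: "S \<in> \<S> \<Longrightarrow> equiv (Term V \<Sigma> X S) (R S)"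
  using R_respects by (simp add: respects_equations_def is_congruence_def)

abbreviation q :: "'u \<Rightarrow> 'u \<Rightarrow> 'u" where
  "q S \<equiv> class_of (R S)"

lemma q_Term: "S \<in> \<S> \<Longrightarrow> a \<in> Term V \<Sigma> X S \<Longrightarrow> q S a \<in> Term V \<Sigma> X S"
  by (rule class_of_mem[OF R_equiv])

lemma q_eq_iff:
  "S \<in> \<S> \<Longrightarrow> a \<in> Term V \<Sigma> X S \<Longrightarrow> b \<in> Term V \<Sigma> X S \<Longrightarrow> q S a = q S b \<longleftrightarrow> (a, b) \<in> R S"
  by (rule class_of_eq_iff[OF R_equiv])

lemma q_idem: "S \<in> \<S> \<Longrightarrow> a \<in> Term V \<Sigma> X S \<Longrightarrow> q S (q S a) = q S a"
  using class_of_related[OF R_equiv, of S a] q_eq_iff[of S a "q S a"] q_Term by simp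

abbreviation quot_set :: "'u \<Rightarrow> 'u set" where
  "quot_set S \<equiv> quotient_set (Term V \<Sigma> X S) (R S)"

lemma quot_set_Term: "S \<in> \<S> \<Longrightarrow> quot_set S \<subseteq> Term V \<Sigma> X S"
  using q_Term by (auto simp: quotient_set_eq)

lemma q_quot_set: "S \<in> \<S> \<Longrightarrow> a \<in> quot_set S \<Longrightarrow> q S a = a"
  using q_idem by (auto simp: quotient_set_eq)

definition quot :: "'u \<Rightarrow> 'o" where
  "quot S = quotient_object V (Omega_sup S) (R S)"

lemma quot:
  assumes S: "S \<in> \<S>"
  shows "quot S \<in> Fib V (quot_set S)"
    and "admissible V (Omega_sup S) (quot S) (q S)"
    and "surjective_final_sink (quot S) {(Omega_sup S, q S)}"
proof -
  have und: "und V (Omega_sup S) = Term V \<Sigma> X S" and obj: "Omega_sup S \<in> objs V"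
    using Omega_join(1)[OF S] by (auto simp: Fib_def)
  have eq: "quot S = final_structure V (quot_set S) {(Omega_sup S, q S)}"
    by (simp add: quot_def quotient_object_def und)
  have "small (quot_set S)"
    using small_subset[OF small_Term[OF S] quot_set_Term[OF S]] .
  note final = final_structure[OF this, of "{(Omega_sup S, q S)}", folded eq]
  have wf: "B \<in> objs V \<and> g \<in> und V B \<rightarrow> quot_set S" if "(B, g) \<in> {(Omega_sup S, q S)}" for B g
    using that obj und by (auto simp: quotient_set_eq)
  show fib: "quot S \<in> Fib V (quot_set S)" and adm: "admissible V (Omega_sup S) (quot S) (q S)"
    using final(1,2) wf by blast+
  have "final_sink V (quot S) {(Omega_sup S, q S)}"
    using final(3) wf by blast
  then show "surjective_final_sink (quot S) {(Omega_sup S, q S)}"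
    using fib adm und by (auto simp: surjective_final_sink_def Fib_def quotient_set_eq)
qed

lemma in_args_Term_quot:
  assumes "set Ss \<subseteq> \<S>" "in_args quot_set Ss as"
  shows "in_args (Term V \<Sigma> X) Ss as" "map2 q Ss as = as"
proof -
  show "in_args (Term V \<Sigma> X) Ss as"
    using assms(2) by (rule in_args_mono) (use quot_set_Term assms(1) in blast)
  have "q (Ss ! i) (as ! i) = as ! i" if "i < length Ss" for i
    using q_quot_set in_args_nth[OF assms(2) that] assms(1) that by (meson nth_mem subsetD)
  then show "map2 q Ss as = as"
    using in_args_length[OF assms(2)] by (intro nth_equalityI) auto
qed

text \<open>Elements of the quotient are themselves terms, so an operation is carried out on terms
  and its result is replaced by the representative of its class.\<close>

definition free_theory_alg :: "('o, 'u) ealg" where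
  "free_theory_alg = \<lparr>car = quot, opn = (\<lambda>\<sigma> x. q (out \<Sigma> \<sigma>) (sigma_hat V \<Sigma> X \<sigma> x))\<rparr>"

abbreviation T where "T \<equiv> free_theory_alg"

lemma und_car_T: "S \<in> \<S> \<Longrightarrow> und V (car T S) = quot_set S"
  using quot(1) by (simp add: free_theory_alg_def Fib_def)

lemma opn_T: "opn T \<sigma> (arg p as) = q (out \<Sigma> \<sigma>) (cop D (\<sigma>, p) as)"
  by (simp add: free_theory_alg_def sigma_hat_arg)

lemma q_cop:
  assumes \<sigma>: "\<sigma> \<in> syms \<Sigma>" "p \<in> und V (par \<Sigma> \<sigma>)" and as: "in_args (Term V \<Sigma> X) (ins \<Sigma> \<sigma>) as"
  shows "q (out \<Sigma> \<sigma>) (cop D (\<sigma>, p) (map2 q (ins \<Sigma> \<sigma>) as)) = q (out \<Sigma> \<sigma>) (cop D (\<sigma>, p) as)"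
proof -
  have qs: "in_args (Term V \<Sigma> X) (ins \<Sigma> \<sigma>) (map2 q (ins \<Sigma> \<sigma>) as)"
    using as by (rule in_args_map2) (use q_Term ins_sorts[OF \<sigma>(1)] in blast)
  have "(as ! i, map2 q (ins \<Sigma> \<sigma>) as ! i) \<in> R (ins \<Sigma> \<sigma> ! i)" if "i < length (ins \<Sigma> \<sigma>)" for i
    using class_of_related[OF R_equiv] ins_sorts[OF \<sigma>(1)] in_args_nth[OF as that] in_args_length[OF as] that
    by simp
  moreover have "is_congruence \<S> C D R"
    using R_respects by (simp add: respects_equations_def)
  ultimately have "(cop D (\<sigma>, p) as, cop D (\<sigma>, p) (map2 q (ins \<Sigma> \<sigma>) as)) \<in> R (cout C (\<sigma>, p))"
    using \<sigma> in_args_length[OF as] by (intro is_congruenceD[of \<S> C D R]) simp_all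
  then show ?thesis
    using q_eq_iff[OF out_sort[OF \<sigma>(1)] cop_Term[OF \<sigma> as] cop_Term[OF \<sigma> qs]] by simp
qed

lemma T_quotient: "is_quotient_alg \<S> C D R (und_alg V T)"
  unfolding is_quotient_alg_def
proof (intro conjI ballI allI impI)
  show "ccar (und_alg V T) S = quot_set S" if "S \<in> \<S>" for S
    using und_car_T[OF that] by simp
  fix \<tau> as assume "\<tau> \<in> csyms C" and as: "in_args (Term V \<Sigma> X) (cins C \<tau>) as"
  moreover obtain \<sigma> p where "\<tau> = (\<sigma>, p)"
    by fastforce
  ultimately show "cop (und_alg V T) \<tau> (map2 q (cins C \<tau>) as) = q (cout C \<tau>) (cop D \<tau> as)"
    using q_cop by (simp add: opn_T)
qed

section \<open>Comparison of free algebras with the same underlying data\<close>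

lemma quotient_alg_hom: "is_quotient_alg \<S> C D R E \<Longrightarrow> calg_hom C D E q"
  by (simp add: is_quotient_alg_def calg_hom_def)

lemma quotient_hom_comp:
  assumes E: "is_quotient_alg \<S> C D R E" and h: "calg_hom C E B h"
  shows "calg_hom C D B (\<lambda>S a. h S (q S a))"
  unfolding calg_hom_def
proof (intro ballI allI impI)
  fix \<tau> as assume \<tau>: "\<tau> \<in> csyms C" and as: "in_args (Term V \<Sigma> X) (cins C \<tau>) as"
  have "in_args (ccar E) (cins C \<tau>) (map2 q (cins C \<tau>) as)"
  proof (rule in_args_map2[OF as])
    fix S a assume "S \<in> set (cins C \<tau>)" "a \<in> Term V \<Sigma> X S"
    moreover from this have "S \<in> \<S>"
      using classical.cins_sorts[OF \<tau>] by blast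
    ultimately show "q S a \<in> ccar E S"
      using E by (simp add: is_quotient_alg_def quotient_set_eq)
  qed
  from calg_homD[OF h \<tau> this] calg_homD[OF quotient_alg_hom[OF E] \<tau> as]
  show "h (cout C \<tau>) (q (cout C \<tau>) (cop D \<tau> as)) = cop B \<tau> (map2 (\<lambda>S a. h S (q S a)) (cins C \<tau>) as)"
    by (simp add: map2_map2)
qed

text \<open>The comparison homomorphism between two free algebras with the same unit is the identity on
  underlying sets, as it commutes with the quotient map on generators and hence on all terms.\<close>

lemma free_theory_algebra_le:
  assumes A: "is_free_theory_algebra V \<S> \<Sigma> \<E> X A" and B: "is_free_theory_algebra V \<S> \<Sigma> \<E> X B"
    and S: "S \<in> \<S>"
  shows "admissible V (car A S) (car B S) (\<lambda>x. x)"
proof -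
  have qA: "is_quotient_alg \<S> C D R (und_alg V A)" and qB: "is_quotient_alg \<S> C D R (und_alg V B)"
    and freeA: "is_free V \<S> \<Sigma> (is_theory_algebra V \<S> \<Sigma> \<E>) X A (\<lambda>S x. q S (incl x))"
    and freeB: "is_free V \<S> \<Sigma> (is_theory_algebra V \<S> \<Sigma> \<E>) X B (\<lambda>S x. q S (incl x))"
    using A B by (simp_all add: is_free_theory_algebra_def Let_def R_def[symmetric])
  obtain h where h: "is_hom V \<S> \<Sigma> A B h"
    "\<forall>S \<in> \<S>. \<forall>x \<in> und V (X S). h S (q S (incl x)) = q S (incl x)"
    using is_free_extend[OF freeA is_free_mem[OF freeB] is_free_unit[OF freeB]] by blast
  have comp: "calg_hom C D (und_alg V B) (\<lambda>S a. h S (q S a))"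
    using quotient_hom_comp[OF qA] h(1) by (simp add: is_hom_iff)
  have "h S x = x" if x: "x \<in> und V (car A S)" for x
  proof -
    have "x \<in> quot_set S"
      using qA S x by (simp add: is_quotient_alg_def)
    then obtain a where a: "x = q S a" "a \<in> Term V \<Sigma> X S"
      by (auto simp: quotient_set_eq)
    then show ?thesis
      using Term_homs_eq[OF comp quotient_alg_hom[OF qB] _ S, of a] h(2) by simp
  qed
  moreover have "admissible V (car A S) (car B S) (h S)"
    using h(1) S by (simp add: is_hom_iff)
  ultimately show ?thesis
    by (auto elim: admissible_mono)
qed

lemma free_theory_algebra_unique:
  assumes A: "is_free_theory_algebra V \<S> \<Sigma> \<E> X A" and B: "is_free_theory_algebra V \<S> \<Sigma> \<E> X B"
    and S: "S \<in> \<S>"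
  shows "car A S = car B S"
proof (rule fibre_antisym)
  show "admissible V (car A S) (car B S) (\<lambda>x. x)" "admissible V (car B S) (car A S) (\<lambda>x. x)"
    using free_theory_algebra_le A B S by blast+
  then show "car A S \<in> Fib V (quot_set S)" "car B S \<in> Fib V (quot_set S)"
    using A B S admissible_objs
    by (auto simp: Fib_def is_free_theory_algebra_def Let_def R_def[symmetric] is_quotient_alg_def)
qed

text \<open>The final formula forms the congruence on an arbitrary choice \<open>F\<close> of the
  free algebra, while \<open>R\<close> lives on the term algebra. Their underlying classical
  algebras agree on \<open>\<S>\<close>, so the generated congruences coincide.\<close>

lemma theory_congruence_free:
  assumes "is_free_algebra V \<S> \<Sigma> X F"
  shows "theory_congruence V \<S> \<Sigma> \<E> F S = R S"
  unfolding theory_congruence_def R_def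
proof (rule classical.generated_congruence_cong)
  show "calg_eq \<S> C (und_alg V F) D" "calg_closed C (und_alg V F)"
    using assms by (auto simp: is_free_algebra_def is_free_def intro: algebra_closed)
qed (rule Term_closed)

text \<open>The quotient maps are surjective and final, so by cartesian closedness it suffices to
  test an operation on arguments taken from the join, where it is admissible already.\<close>

lemma T_algebra: "is_algebra V \<S> \<Sigma> T"
  unfolding is_algebra_def
proof (intro conjI ballI)
  show "car T S \<in> objs V" if "S \<in> \<S>" for S
    using quot(1)[OF that] by (simp add: free_theory_alg_def Fib_def)
  fix \<sigma> assume \<sigma>: "\<sigma> \<in> syms \<Sigma>"
  note ins = ins_sorts[OF \<sigma>] and out = out_sort[OF \<sigma>]
  have "admissible V (dom_obj V (par \<Sigma> \<sigma>) (ins \<Sigma> \<sigma>) quot) (quot (out \<Sigma> \<sigma>)) (opn T \<sigma>)"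
  proof (rule final_dom_obj_quotient[where A = Omega_sup and q = q])
    show "quot (out \<Sigma> \<sigma>) \<in> objs V"
      using quot(1)[OF out] by (simp add: Fib_def)
    show "surjective_final_sink (quot S) {(Omega_sup S, q S)}" if "S \<in> set (ins \<Sigma> \<sigma>)" for S
      using quot(3) ins that by blast
    show "opn T \<sigma> (arg p as) \<in> und V (quot (out \<Sigma> \<sigma>))"
      if p: "p \<in> und V (par \<Sigma> \<sigma>)" and as: "in_args (\<lambda>S. und V (quot S)) (ins \<Sigma> \<sigma>) as" for p as
    proof -
      have "in_args quot_set (ins \<Sigma> \<sigma>) as"
        using as by (simp add: in_args_Fib[OF \<sigma>, of quot, OF quot(1)])
      from cop_Term[OF \<sigma> p in_args_Term_quot(1)[OF _ this]] ins show ?thesis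
        using quot(1)[OF out] by (auto simp: opn_T Fib_def quotient_set_eq)
    qed
    have "admissible V (dom_obj V (par \<Sigma> \<sigma>) (ins \<Sigma> \<sigma>) Omega_sup) (quot (out \<Sigma> \<sigma>))
        (\<lambda>x. q (out \<Sigma> \<sigma>) (sigma_hat V \<Sigma> X \<sigma> x))"
      using sigma_hat_join_admissible[OF \<sigma>] quot(2)[OF out] by (rule admissible_comp)
    \<comment> \<open>By \<open>q_cop\<close>, replacing the arguments by their representatives
      first does not change the class of the result.\<close>
    then show "admissible V (dom_obj V (par \<Sigma> \<sigma>) (ins \<Sigma> \<sigma>) Omega_sup) (quot (out \<Sigma> \<sigma>))
        (\<lambda>x. opn T \<sigma> (arg (arg_par x) (map2 q (ins \<Sigma> \<sigma>) (arg_list x))))"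
      by (rule admissible_mono)
        (auto simp: und_dom_obj_Fib(1)[OF \<sigma>, of Omega_sup, OF Omega_join(1)] opn_T q_cop[OF \<sigma>] sigma_hat_arg)
  qed (rule par_objs[OF \<sigma>])
  then show "admissible V (dom_obj V (par \<Sigma> \<sigma>) (ins \<Sigma> \<sigma>) (car T)) (car T (out \<Sigma> \<sigma>)) (opn T \<sigma>)"
    by (simp add: free_theory_alg_def)
qed

text \<open>Both sides act as terms by \<open>operation_term\<close>. Since \<open>q\<close> is a
  homomorphism, the interpretation of a term in the quotient is the class of its interpretation in
  \<open>D\<close>, and \<open>R\<close> relates the two interpretations in
  \<open>D\<close>.\<close>

lemma T_satisfies:
  assumes e: "e \<in> \<E>"
  shows "satisfies V T e"
  unfolding satisfies_def
proof
  fix x assume x: "x \<in> und V (dom_obj V (epar e) (eins e) (car T))"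
  have sorts: "set (eins e) \<subseteq> \<S>" "eout e \<in> \<S>" "epar e \<in> objs V"
    using equations[OF e] by (auto simp: is_equation_def)
  have "car T S \<in> objs V" if "S \<in> set (eins e)" for S
    using T_algebra sorts(1) that by (auto simp: is_algebra_def)
  with x sorts obtain p as where pas: "x = arg p as" "p \<in> und V (epar e)"
    "in_args (\<lambda>S. und V (car T S)) (eins e) as"
    by (auto simp: und_dom_obj)
  have "in_args quot_set (eins e) as"
    using pas(3) by (rule in_args_mono) (use und_car_T sorts in blast)
  note as = in_args_Term_quot[OF sorts(1) this]
  obtain \<Gamma> where \<Gamma>: "is_context \<S> \<Gamma>" "map snd \<Gamma> = eins e"
    using context_exists[OF sorts(1)] .
  let ?s = "op_term V \<Sigma> (lhs e) p \<Gamma>" and ?t = "op_term V \<Sigma> (rhs e) p \<Gamma>"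
  note terms = equation_terms[OF e \<Gamma> pas(2)]
  have as\<Gamma>: "in_args (Term V \<Sigma> X) (map snd \<Gamma>) as"
    using as(1) \<Gamma>(2) by simp
  have interp: "interp (und_alg V T) \<Gamma> u as = q (eout e) (interp D \<Gamma> u as)"
    if "has_sort C (ctx_vars \<Gamma>) u (eout e)" for u
    using interp_hom[OF quotient_alg_hom[OF T_quotient] Term_closed is_context_distinct[OF \<Gamma>(1)] as\<Gamma> that]
      as(2) \<Gamma>(2) by simp
  have "(\<Gamma>, eout e, ?s, ?t) \<in> Q"
    using e pas(2) \<Gamma> by (auto simp: und_eqns_def)
  then have "(interp D \<Gamma> ?s as, interp D \<Gamma> ?t as) \<in> R (eout e)"
    using R_respects as\<Gamma> by (fastforce simp: respects_equations_def)
  moreover have "interp D \<Gamma> u as \<in> Term V \<Sigma> X (eout e)" if "has_sort C (ctx_vars \<Gamma>) u (eout e)" for u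
    using interp_closed[OF Term_closed is_context_distinct[OF \<Gamma>(1)] as\<Gamma> that] .
  ultimately show "lhs e T x = rhs e T x"
    using terms(3,4)[OF T_algebra pas(3)] interp terms(1,2) q_eq_iff[OF sorts(2)]
    by (simp add: pas(1))
qed

text \<open>The converse passage from enriched to classical equations: the values of the two
  operations in \<open>B\<close> are the interpretations of the two terms.\<close>

lemma theory_algebra_equations:
  assumes B: "is_theory_algebra V \<S> \<Sigma> \<E> B" and Q: "(\<Gamma>, S, s, t) \<in> Q"
    and as: "in_args (ccar (und_alg V B)) (map snd \<Gamma>) as"
  shows "interp (und_alg V B) \<Gamma> s as = interp (und_alg V B) \<Gamma> t as"
proof -
  have alg: "is_algebra V \<S> \<Sigma> B"
    using B by (simp add: is_theory_algebra_def)
  obtain e p where e: "e \<in> \<E>" "p \<in> und V (epar e)" "is_context \<S> \<Gamma>" "map snd \<Gamma> = eins e"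
    "s = op_term V \<Sigma> (lhs e) p \<Gamma>" "t = op_term V \<Sigma> (rhs e) p \<Gamma>"
    using Q by (auto simp: und_eqns_def)
  have as': "in_args (\<lambda>S. und V (car B S)) (eins e) as"
    using as e(4) by (simp add: in_args_def)
  have "set (eins e) \<subseteq> \<S>" "epar e \<in> objs V"
    using equations[OF e(1)] by (auto simp: is_equation_def)
  then have "arg p as \<in> und V (dom_obj V (epar e) (eins e) (car B))"
    using alg e(2) as' by (subst und_dom_obj) (auto simp: is_algebra_def)
  then have "lhs e B (arg p as) = rhs e B (arg p as)"
    using B e(1) by (simp add: is_theory_algebra_def satisfies_def)
  then show ?thesis
    using equation_terms(3,4)[OF e(1,3,4,2) alg as'] by (simp add: e(5,6))
qed

text \<open>The kernel of a homomorphism into an algebra of the theory is a congruence that contains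
  the instances of all the equations, so it contains the least such congruence.\<close>

lemma R_subset_kernel:
  assumes B: "is_theory_algebra V \<S> \<Sigma> \<E> B" and hom: "calg_hom C D (und_alg V B) h"
    and mem: "\<And>S a. S \<in> \<S> \<Longrightarrow> a \<in> Term V \<Sigma> X S \<Longrightarrow> h S a \<in> und V (car B S)"
    and ab: "(a, b) \<in> R S"
  shows "h S a = h S b"
proof -
  \<comment> \<open>The kernel is cut down to terms so that it is an equivalence relation on the
    carrier.\<close>
  define K where "K S = {(a, b). a \<in> Term V \<Sigma> X S \<and> b \<in> Term V \<Sigma> X S \<and> h S a = h S b}" for S
  have "respects_equations \<S> C Q D K"
    unfolding respects_equations_def
  proof (intro conjI)
    show "is_congruence \<S> C D K"
      unfolding is_congruence_def
    proof (intro conjI ballI allI impI)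
      show "equiv (Term V \<Sigma> X S) (K S)" for S
        by (auto simp: K_def equiv_def refl_on_def sym_def trans_def)
      fix \<tau> as bs assume \<tau>: "\<tau> \<in> csyms C"
        and asbs: "length as = length (cins C \<tau>) \<and> length bs = length (cins C \<tau>) \<and>
          (\<forall>i < length (cins C \<tau>). (as ! i, bs ! i) \<in> K (cins C \<tau> ! i))"
      then have args: "in_args (Term V \<Sigma> X) (cins C \<tau>) as" "in_args (Term V \<Sigma> X) (cins C \<tau>) bs"
        by (auto simp: K_def intro: in_argsI)
      have "map2 h (cins C \<tau>) as = map2 h (cins C \<tau>) bs"
        using asbs by (intro nth_equalityI) (auto simp: K_def)
      then show "(cop D \<tau> as, cop D \<tau> bs) \<in> K (cout C \<tau>)"
        using calg_closedD[OF Term_closed \<tau>] calg_homD[OF hom \<tau>] args by (simp add: K_def)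
    qed
    show "\<forall>(\<Gamma>, S, s, t) \<in> Q. \<forall>as. in_args (Term V \<Sigma> X) (map snd \<Gamma>) as \<longrightarrow>
        (interp D \<Gamma> s as, interp D \<Gamma> t as) \<in> K S"
    proof clarify
      fix \<Gamma> S s t as assume Q: "(\<Gamma>, S, s, t) \<in> Q" and as: "in_args (Term V \<Sigma> X) (map snd \<Gamma>) as"
      note ctx = classical.eqn_ctx[OF Q] and terms = classical.eqn_terms[OF Q]
      have "in_args (ccar (und_alg V B)) (map snd \<Gamma>) (map2 h (map snd \<Gamma>) as)"
        using as by (rule in_args_map2) (use mem classical.eqn_sorts[OF Q] in auto)
      from theory_algebra_equations[OF B Q this]
      have "h S (interp D \<Gamma> s as) = h S (interp D \<Gamma> t as)"
        using interp_hom[OF hom Term_closed ctx as conjunct1[OF terms]]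
          interp_hom[OF hom Term_closed ctx as conjunct2[OF terms]] by simp
      then show "(interp D \<Gamma> s as, interp D \<Gamma> t as) \<in> K S"
        using interp_closed[OF Term_closed ctx as] terms by (simp add: K_def)
    qed
  qed
  from generated_congruence_least[OF this, of S] ab show ?thesis
    by (auto simp: R_def K_def)
qed

text \<open>The induced homomorphism is evaluation itself, restricted to representatives. It is
  constant on classes by \<open>R_subset_kernel\<close>, so composing it with \<open>q\<close> gives
  evaluation back, and finality of \<open>q\<close> makes it admissible.\<close>

lemma free_theory_algebra_exists: "is_free_theory_algebra V \<S> \<Sigma> \<E> X T"
  unfolding is_free_theory_algebra_def Let_def R_def[symmetric] is_free_def
proof (intro conjI allI impI ballI T_quotient)
  show "is_theory_algebra V \<S> \<Sigma> \<E> T"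
    by (simp add: is_theory_algebra_def T_algebra T_satisfies)
  show "admissible V (X S) (car T S) (\<lambda>x. q S (incl x))" if "S \<in> \<S>" for S
    using admissible_comp[OF admissible_comp[OF Omega_0(2)[OF that] Omega_join(2)[OF that]] quot(2)[OF that]]
    by (simp add: free_theory_alg_def)
  fix B g assume Bg: "is_theory_algebra V \<S> \<Sigma> \<E> B \<and> (\<forall>S \<in> \<S>. admissible V (X S) (car B S) (g S))"
  then have B: "is_theory_algebra V \<S> \<Sigma> \<E> B" "is_algebra V \<S> \<Sigma> B"
    and g: "\<And>S. S \<in> \<S> \<Longrightarrow> admissible V (X S) (car B S) (g S)"
    by (auto simp: is_theory_algebra_def)
  let ?h = "evaluation (und_alg V B) g"
  note hom = evaluation_hom[of "und_alg V B" g]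
  have mem: "?h S a \<in> und V (car B S)" if "S \<in> \<S>" "a \<in> Term V \<Sigma> X S" for S a
    using evaluation_closed[OF algebra_closed[OF B(2)], of g S a] admissible_mem[OF g] that by simp
  have hq: "?h S (q S a) = ?h S a" if "S \<in> \<S>" "a \<in> Term V \<Sigma> X S" for S a
    using R_subset_kernel[OF B(1) hom mem class_of_related[OF R_equiv[OF that(1)] that(2)]] by simp
  have "admissible V (car T S) (car B S) (?h S)" if S: "S \<in> \<S>" for S
  proof (rule final_sinkD)
    show "final_sink V (car T S) {(Omega_sup S, q S)}"
      using quot(3)[OF S] by (simp add: surjective_final_sink_def free_theory_alg_def)
    show "car B S \<in> objs V"
      using B(2) S by (simp add: is_algebra_def)
    show "?h S x \<in> und V (car B S)" if "x \<in> und V (car T S)" for x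
      using that und_car_T[OF S] quot_set_Term[OF S] mem[OF S] by blast
    have "admissible V (Omega_sup S) (car B S) (?h S)"
      using Omega_join_hom_admissible[OF B(2) hom mem _ S] g by (simp add: evaluation_incl)
    then have "admissible V (Omega_sup S) (car B S) (\<lambda>x. ?h S (q S x))"
      by (rule admissible_mono) (use hq S Omega_join(1)[OF S] in \<open>simp add: Fib_def\<close>)
    then show "admissible V A (car B S) (\<lambda>x. ?h S (f x))" if "(A, f) \<in> {(Omega_sup S, q S)}" for A f
      using that by simp
  qed
  moreover have "calg_hom C (und_alg V T) (und_alg V B) ?h"
    unfolding calg_hom_def
  proof (intro ballI allI impI)
    fix \<tau> as assume "\<tau> \<in> csyms C" and as: "in_args (ccar (und_alg V T)) (cins C \<tau>) as"
    moreover obtain \<sigma> p where \<tau>: "\<tau> = (\<sigma>, p)"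
      by fastforce
    ultimately have \<sigma>: "\<sigma> \<in> syms \<Sigma>" "p \<in> und V (par \<Sigma> \<sigma>)"
      by auto
    have as': "in_args (Term V \<Sigma> X) (ins \<Sigma> \<sigma>) as"
      using as unfolding \<tau> und_sig_simps
      by (rule in_args_mono) (use und_car_T quot_set_Term ins_sorts[OF \<sigma>(1)] in auto)
    show "?h (cout C \<tau>) (cop (und_alg V T) \<tau> as) = cop (und_alg V B) \<tau> (map2 ?h (cins C \<tau>) as)"
      using hq[OF out_sort[OF \<sigma>(1)] cop_Term[OF \<sigma> as']] calg_homD[OF hom, of "(\<sigma>, p)" as] \<sigma> as'
      by (simp add: \<tau> opn_T)
  qed
  ultimately have "is_hom V \<S> \<Sigma> T B ?h"
    by (simp add: is_hom_iff)
  moreover have "h' S a = ?h S a"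
    if h': "is_hom V \<S> \<Sigma> T B h'" "\<forall>S \<in> \<S>. \<forall>x \<in> und V (X S). h' S (q S (incl x)) = g S x"
      and S: "S \<in> \<S>" and a: "a \<in> und V (car T S)" for h' S a
  proof -
    \<comment> \<open>Composition with \<open>q\<close> reduces uniqueness to homomorphisms out of
      the term algebra; nothing is lost because \<open>q\<close> fixes the elements of the
      quotient.\<close>
    have "calg_hom C D (und_alg V B) (\<lambda>S a. h' S (q S a))"
      using quotient_hom_comp[OF T_quotient] h'(1) by (simp add: is_hom_iff)
    from Term_homs_eq[OF this hom _ S, of a] h'(2) show ?thesis
      using a quot_set_Term[OF S] q_quot_set[OF S] und_car_T[OF S]
      by (auto simp: evaluation_incl)
  qed
  moreover have "?h S (q S (incl x)) = g S x" if "S \<in> \<S>" "x \<in> und V (X S)" for S x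
    using hq[OF that(1) incl_Term[OF that(2)]] by (simp add: evaluation_incl)
  ultimately show "\<exists>h. is_hom V \<S> \<Sigma> T B h \<and>
      (\<forall>S \<in> \<S>. \<forall>x \<in> und V (X S). h S (q S (incl x)) = g S x) \<and>
      (\<forall>h'. is_hom V \<S> \<Sigma> T B h' \<and> (\<forall>S \<in> \<S>. \<forall>x \<in> und V (X S). h' S (q S (incl x)) = g S x) \<longrightarrow>
        (\<forall>S \<in> \<S>. \<forall>a \<in> und V (car T S). h' S a = h S a))"
    by (intro exI[of _ ?h] conjI) (blast, blast, blast)
qed

end


theorem theorem4p4p9:
  fixes V :: "('o, 'm, 'u) conc_cat"
    and \<S> :: "'u set"
    and \<Sigma> :: "('o, 'u) esig"
    and \<E> :: "('o, 'u) eeqn set"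
    and X :: "'u \<Rightarrow> 'o"
  assumes "inaccessible_universe TYPE('u)"
    and "topological_category V"
    and "cartesian_closed V"
    and "small \<S>"
    and "is_equational_theory V \<S> \<Sigma> \<E>"
    and "\<forall>S \<in> \<S>. X S \<in> objs V"
  shows "(\<exists>F. is_free_algebra V \<S> \<Sigma> X F) \<and>
    (\<exists>T. is_free_theory_algebra V \<S> \<Sigma> \<E> X T) \<and>
    (\<forall>F T. is_free_algebra V \<S> \<Sigma> X F \<and> is_free_theory_algebra V \<S> \<Sigma> \<E> X T \<longrightarrow>
       (\<forall>S \<in> \<S>. car T S =
          quotient_object V (fib_join V (Term V \<Sigma> X S) {Omega V \<Sigma> X n S | n. True})
            (theory_congruence V \<S> \<Sigma> \<E> F S)))"
proof -
  interpret topological_category V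
    by fact
  interpret free_theory_construction V \<S> \<Sigma> X \<E>
    using assms(1,3-6)
    by unfold_locales (auto simp: is_equational_theory_def)
  show ?thesis
  proof (intro conjI allI impI ballI)
    show "\<exists>F. is_free_algebra V \<S> \<Sigma> X F"
      using free_algebra_exists ..
    show "\<exists>T. is_free_theory_algebra V \<S> \<Sigma> \<E> X T"
      using free_theory_algebra_exists ..
    fix F T' S
    assume FT: "is_free_algebra V \<S> \<Sigma> X F \<and> is_free_theory_algebra V \<S> \<Sigma> \<E> X T'" and S: "S \<in> \<S>"
    then have "car T' S = car T S"
      using free_theory_algebra_unique free_theory_algebra_exists by blast
    also have "\<dots> = quotient_object V (Omega_sup S) (R S)"
      by (simp add: free_theory_alg_def quot_def)
    also have "R S = theory_congruence V \<S> \<Sigma> \<E> F S"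
      using theory_congruence_free FT by simp
    finally show "car T' S = quotient_object V (fib_join V (Term V \<Sigma> X S) {Omega V \<Sigma> X n S | n. True})
        (theory_congruence V \<S> \<Sigma> \<E> F S)"
      by (simp add: Omega_sup_def)
  qed
qed

end
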